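(* Let $f(x,y)=\sum_{i=0}^{n}a_i(x)y^{n-i}\in\mathbb{C}\{x\}[y]$ be reduced, with $n=\deg_y(f)=\mathrm{ord}\, f>1$ and $a_0(0)\neq0$, and let $C:\{f(x,y)=0\}$. Let $W\in[Fol(f)]$ and let $W=h\,\mathrm{d}f+pf\,\mathrm{d}x+A\,\mathrm{d}x+B\,\mathrm{d}y$ be its Weierstrass form with respect to $f$. If $h$ is a unit of $\mathbb{C}\{x,y\}$, then $\mathcal{F}_W\in Fol(f)$, that is, $C$ is the union of separatrices of $\mathcal{F}_W$.
   Context: A singular holomorphic foliation at the origin $\mathcal{F}_W:\{W=0\}$ is given by a 1-form $W=R\,\mathrm{d}x+S\,\mathrm{d}y$ with $R,S\in\mathbb{C}\{x,y\}$ without common factors and $R(0,0)=S(0,0)=0$. A separatrix of $\mathcal{F}_W$ is a branch $\{g=0\}$ ($g\in\mathbb{C}\{x,y\}$ irreducible non-unit) such that $g$ divides $W\wedge \mathrm{d}g$ (i.e. divides its coefficient with respect to $\mathrm{d}x\wedge \mathrm{d}y$). $\mathcal{F}_W$ is nondicritical if it has finitely many separatrices; if these are $\{f_i=0\}$, $1\le i\le r$ (distinct), its union of separatrices is the reduced curve $\{f_1\cdots f_r=0\}$. For $f$ reduced, $[Fol(f)]$ is the set of 1-forms $W$ defining a nondicritical foliation $\mathcal{F}_W$ such that $f$ divides $W\wedge \mathrm{d}f$, and $Fol(f)$ is the set of foliations defined by elements of $[Fol(f)]$ whose union of separatrices is $\{f=0\}$. $\mathrm{ord}\,f$ is the minimum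 of the degrees of the terms of the power series $f$. Weierstrass form: for such an $f$ (of degree $n>1$ in $y$), every holomorphic 1-form $W$ is written uniquely as $W=h\,\mathrm{d}f+pf\,\mathrm{d}x+A\,\mathrm{d}x+B\,\mathrm{d}y$ with $h,p\in\mathbb{C}\{x,y\}$, $A,B\in\mathbb{C}\{x\}[y]$, $B=0$ or $\deg_y B<n-1$, and $A=0$ or $\deg_y A<n$; this is the Weierstrass form of $W$ with respect to $f$. *)

theory Defs
  imports
    "HOL-Analysis.Infinite_Sum"
    "HOL-Library.Product_Plus"
    "HOL-Computational_Algebra.Formal_Power_Series"
    "HOL-Computational_Algebra.Squarefree"
begin

unbundle fps_syntax

text \<open>
  A formal power series in \<open>x, y\<close> is an element of \<open>complex fps fps\<close> with \<open>y\<close> as the outer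
  variable: \<open>F $ j $ i\<close> is the coefficient of \<open>x^i y^j\<close>.
\<close>

definition convergent_fps2 :: "complex fps fps \<Rightarrow> bool" where
  "convergent_fps2 F \<longleftrightarrow>
     (\<exists>r>0. (\<lambda>(i, j). norm (F $ j $ i) * r ^ i * r ^ j) summable_on UNIV)"

lemma convergent_fps2D:
  assumes "convergent_fps2 F"
  obtains M R :: real where "M \<ge> 0" "R \<ge> 1" "\<And>i j. norm (F $ j $ i) \<le> M * R ^ (i + j)"
proof -
  obtain r :: real where r: "r > 0"
    and s: "(\<lambda>(i, j). norm (F $ j $ i) * r ^ i * r ^ j) summable_on UNIV"
    using assms unfolding convergent_fps2_def by blast
  define M where "M = (\<Sum>\<^sub>\<infinity>(i, j). norm (F $ j $ i) * r ^ i * r ^ j)"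
  define R where "R = max 1 (1 / r)"
  have nn: "0 \<le> (case p of (i, j) \<Rightarrow> norm (F $ j $ i) * r ^ i * r ^ j)" for p
    using r by (auto split: prod.split)
  have M0: "M \<ge> 0" unfolding M_def by (rule infsum_nonneg) (rule nn)
  have "norm (F $ j $ i) \<le> M * R ^ (i + j)" for i j
  proof -
    have "sum (\<lambda>(i, j). norm (F $ j $ i) * r ^ i * r ^ j) {(i, j)} \<le> M"
      unfolding M_def by (rule finite_sum_le_infsum[OF s]) (use nn in auto)
    hence "norm (F $ j $ i) * r ^ (i + j) \<le> M"
      by (simp add: power_add mult.assoc)
    hence "norm (F $ j $ i) \<le> M * (1 / r) ^ (i + j)"
      using r by (simp add: field_simps)
    also have "\<dots> \<le> M * R ^ (i + j)"
      using r M0 by (intro mult_left_mono power_mono) (auto simp: R_def)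
    finally show ?thesis .
  qed
  moreover have "R \<ge> 1" by (simp add: R_def)
  ultimately show ?thesis using that M0 by blast
qed

lemma convergent_fps2I:
  fixes M R :: real
  assumes "R > 0" and bd: "\<And>i j. norm (F $ j $ i) \<le> M * R ^ (i + j)"
  shows "convergent_fps2 F"
proof -
  define r where "r = 1 / (2 * R)"
  have r: "r > 0" using \<open>R > 0\<close> by (simp add: r_def)
  have M0: "M \<ge> 0" using order_trans[OF norm_ge_zero bd[of 0 0]] by simp
  have g: "(\<lambda>i. norm ((1 / 2 :: real) ^ i)) summable_on UNIV"
    by (rule norm_summable_imp_summable_on) (simp add: summable_geometric)
  have "(\<lambda>p. norm (case p of (i, j) \<Rightarrow> (1 / 2 :: real) ^ i * (1 / 2) ^ j)) summable_on UNIV \<times> UNIV"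
    unfolding abs_summable_on_Sigma_iff
    using g by (auto simp: norm_mult abs_mult infsum_cmult_right'
      intro!: summable_on_cmult_right summable_on_cmult_left)
  hence *: "(\<lambda>p. norm (M * (case p of (i, j) \<Rightarrow> (1 / 2 :: real) ^ i * (1 / 2) ^ j)))
      summable_on UNIV"
    by (simp add: norm_mult abs_mult summable_on_cmult_right)
  have "(\<lambda>p. norm (case p of (i, j) \<Rightarrow> norm (F $ j $ i) * r ^ i * r ^ j)) summable_on UNIV"
  proof (rule abs_summable_on_comparison_test[OF *])
    fix p :: "nat \<times> nat"
    obtain i j where p: "p = (i, j)" by (cases p)
    have "norm (F $ j $ i) * r ^ i * r ^ j \<le> M * R ^ (i + j) * r ^ i * r ^ j"
      using r bd by (intro mult_right_mono) auto
    also have "\<dots> = M * (R * r) ^ i * (R * r) ^ j"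
      by (simp add: power_add power_mult_distrib mult_ac)
    also have "R * r = 1 / 2" using \<open>R > 0\<close> by (simp add: r_def)
    finally have "norm (F $ j $ i) * r ^ i * r ^ j \<le> M * (1 / 2) ^ i * (1 / 2) ^ j" .
    thus "norm (case p of (i, j) \<Rightarrow> norm (F $ j $ i) * r ^ i * r ^ j)
        \<le> norm (M * (case p of (i, j) \<Rightarrow> (1 / 2 :: real) ^ i * (1 / 2) ^ j))"
      using r M0 by (simp add: p mult.assoc abs_mult)
  qed
  hence "(\<lambda>p. case p of (i, j) \<Rightarrow> norm (F $ j $ i) * r ^ i * r ^ j) summable_on UNIV"
    by (rule abs_summable_summable)
  thus ?thesis using r unfolding convergent_fps2_def by auto
qed

lemma convergent_fps2_const: "convergent_fps2 (fps_const (fps_const c))"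
  by (rule convergent_fps2I[of 1 _ "norm c"]) (auto simp: fps_const_def)

lemma convergent_fps2_0: "convergent_fps2 0"
  using convergent_fps2_const[of 0] by simp

lemma convergent_fps2_1: "convergent_fps2 1"
  using convergent_fps2_const[of 1] by simp

lemma convergent_fps2_X: "convergent_fps2 fps_X"
  by (rule convergent_fps2I[of 1 _ 1]) (auto simp: fps_X_def)

lemma convergent_fps2_uminus: "convergent_fps2 F \<Longrightarrow> convergent_fps2 (- F)"
  by (simp add: convergent_fps2_def)

lemma convergent_fps2_add:
  assumes "convergent_fps2 F" "convergent_fps2 G"
  shows "convergent_fps2 (F + G)"
proof -
  obtain M R where F: "M \<ge> 0" "R \<ge> 1" "\<And>i j. norm (F $ j $ i) \<le> M * R ^ (i + j)"
    using convergent_fps2D[OF assms(1)] by blast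
  obtain N S where G: "N \<ge> 0" "S \<ge> 1" "\<And>i j. norm (G $ j $ i) \<le> N * S ^ (i + j)"
    using convergent_fps2D[OF assms(2)] by blast
  show ?thesis
  proof (rule convergent_fps2I[of "max R S" _ "M + N"])
    fix i j
    have "norm ((F + G) $ j $ i) \<le> M * R ^ (i + j) + N * S ^ (i + j)"
      using norm_triangle_ineq F(3)[of j i] G(3)[of j i] by (simp add: norm_triangle_le add_mono)
    also have "\<dots> \<le> M * max R S ^ (i + j) + N * max R S ^ (i + j)"
      using F G by (intro add_mono mult_left_mono power_mono) auto
    finally show "norm ((F + G) $ j $ i) \<le> (M + N) * max R S ^ (i + j)"
      by (simp add: algebra_simps)
  qed (use F in auto)
qed

lemma convergent_fps2_diff:
  "convergent_fps2 F \<Longrightarrow> convergent_fps2 G \<Longrightarrow> convergent_fps2 (F - G)"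
  using convergent_fps2_add[of F "- G"] convergent_fps2_uminus by simp

lemma convergent_fps2_mult:
  assumes "convergent_fps2 F" "convergent_fps2 G"
  shows "convergent_fps2 (F * G)"
proof -
  obtain M R where F: "M \<ge> 0" "R \<ge> 1" "\<And>i j. norm (F $ j $ i) \<le> M * R ^ (i + j)"
    using convergent_fps2D[OF assms(1)] by blast
  obtain N S where G: "N \<ge> 0" "S \<ge> 1" "\<And>i j. norm (G $ j $ i) \<le> N * S ^ (i + j)"
    using convergent_fps2D[OF assms(2)] by blast
  define T where "T = max R S"
  have T: "T \<ge> 1" using F by (simp add: T_def)
  show ?thesis
  proof (rule convergent_fps2I[of "2 * T" _ "M * N"])
    fix i j
    have "(F * G) $ j $ i = (\<Sum>b=0..j. \<Sum>a=0..i. F $ b $ a * G $ (j - b) $ (i - a))"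
      by (simp add: fps_mult_nth fps_sum_nth)
    also have "norm \<dots> \<le> (\<Sum>b=0..j. \<Sum>a=0..i. M * N * T ^ (i + j))"
    proof (intro sum_norm_le)
      fix b a assume "b \<in> {0..j}" "a \<in> {0..i}"
      hence ab: "(a + b) + ((i - a) + (j - b)) = i + j" by auto
      have "norm (F $ b $ a * G $ (j - b) $ (i - a))
          \<le> (M * R ^ (a + b)) * (N * S ^ ((i - a) + (j - b)))"
        unfolding norm_mult using F G by (intro mult_mono) auto
      also have "\<dots> \<le> (M * T ^ (a + b)) * (N * T ^ ((i - a) + (j - b)))"
        using F G by (intro mult_mono mult_left_mono power_mono) (auto simp: T_def)
      also have "\<dots> = M * N * T ^ ((a + b) + ((i - a) + (j - b)))"
        by (simp only: power_add mult_ac)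
      finally show "norm (F $ b $ a * G $ (j - b) $ (i - a)) \<le> M * N * T ^ (i + j)"
        unfolding ab .
    qed
    also have "\<dots> = M * N * (real (Suc i) * real (Suc j)) * T ^ (i + j)"
      by (simp add: algebra_simps)
    also have "\<dots> \<le> M * N * (2 ^ i * 2 ^ j) * T ^ (i + j)"
    proof -
      have "real (Suc k) \<le> 2 ^ k" for k
        using of_nat_mono[OF Suc_leI[OF less_exp[of k]], where 'a = real] by simp
      hence "real (Suc i) * real (Suc j) \<le> 2 ^ i * 2 ^ j" by (intro mult_mono) auto
      thus ?thesis using F G T by (intro mult_right_mono mult_left_mono) auto
    qed
    finally show "norm ((F * G) $ j $ i) \<le> M * N * (2 * T) ^ (i + j)"
      by (simp add: power_add power_mult_distrib mult_ac)
  qed (use T in auto)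
qed

lemma convergent_fps2_deriv:
  assumes "convergent_fps2 F"
  shows "convergent_fps2 (fps_deriv F)" "convergent_fps2 (Abs_fps (\<lambda>j. fps_deriv (F $ j)))"
proof -
  obtain M R where F: "M \<ge> 0" "R \<ge> 1" "\<And>i j. norm (F $ j $ i) \<le> M * R ^ (i + j)"
    using convergent_fps2D[OF assms] by blast
  have *: "norm (of_nat (Suc k) * z) \<le> M * R * (2 * R) ^ (i + j)"
    if "k \<le> i + j" "norm z \<le> M * R ^ Suc (i + j)" for i j k and z :: complex
  proof -
    have "k < 2 ^ k" by (rule less_exp)
    also have "(2 :: nat) ^ k \<le> 2 ^ (i + j)" using that by (intro power_increasing) auto
    finally have "real (Suc k) \<le> 2 ^ (i + j)"
      using of_nat_mono[of "Suc k" "2 ^ (i + j)", where 'a = real] by simp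
    hence "real (Suc k) * norm z \<le> 2 ^ (i + j) * (M * R ^ Suc (i + j))"
      using that by (intro mult_mono) auto
    thus ?thesis
      unfolding norm_mult norm_of_nat by (simp add: power_mult_distrib mult_ac)
  qed
  have of_nat_nth: "(of_nat m * A) $ i = of_nat m * (A $ i)" for m i and A :: "complex fps"
    by (metis fps_mult_left_const_nth fps_of_nat)
  show "convergent_fps2 (fps_deriv F)"
  proof (rule convergent_fps2I[of "2 * R" _ "M * R"])
    fix i j
    have "fps_deriv F $ j $ i = of_nat (Suc j) * (F $ Suc j $ i)"
      unfolding fps_deriv_nth using of_nat_nth[of "Suc j"] by simp
    thus "norm (fps_deriv F $ j $ i) \<le> M * R * (2 * R) ^ (i + j)"
      using *[of j i j "F $ Suc j $ i"] F(3)[of "Suc j" i] by simp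
  qed (use F in auto)
  show "convergent_fps2 (Abs_fps (\<lambda>j. fps_deriv (F $ j)))"
  proof (rule convergent_fps2I[of "2 * R" _ "M * R"])
    fix i j
    show "norm (Abs_fps (\<lambda>j. fps_deriv (F $ j)) $ j $ i) \<le> M * R * (2 * R) ^ (i + j)"
      using *[of i i j "F $ j $ Suc i"] F(3)[of j "Suc i"] by simp
  qed (use F in auto)
qed

text \<open>The ring \<open>\<complex>{x,y}\<close>.\<close>

typedef cps = "{F :: complex fps fps. convergent_fps2 F}"
  morphisms fps2_of_cps Abs_cps
  using convergent_fps2_0 by blast

setup_lifting type_definition_cps

instantiation cps :: idom
begin

lift_definition zero_cps :: cps is 0 by (rule convergent_fps2_0)
lift_definition one_cps :: cps is 1 by (rule convergent_fps2_1)
lift_definition uminus_cps :: "cps \<Rightarrow> cps" is uminus by (rule convergent_fps2_uminus)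
lift_definition plus_cps :: "cps \<Rightarrow> cps \<Rightarrow> cps" is "(+)" by (rule convergent_fps2_add)
lift_definition minus_cps :: "cps \<Rightarrow> cps \<Rightarrow> cps" is "(-)" by (rule convergent_fps2_diff)
lift_definition times_cps :: "cps \<Rightarrow> cps \<Rightarrow> cps" is "(*)" by (rule convergent_fps2_mult)

instance
  by standard (transfer; simp add: algebra_simps)+

end


text \<open>Exact division, so that the library's \<^const>\<open>coprime\<close> applies to \<^typ>\<open>cps\<close>.\<close>

instantiation cps :: idom_divide
begin

definition divide_cps :: "cps \<Rightarrow> cps \<Rightarrow> cps" where
  "divide_cps F G = (if G = 0 then 0 else THE H. F = H * G)"

instance
  by standard (auto simp: divide_cps_def)

end

instance cps :: algebraic_semidom ..

definition cps_coeff :: "cps \<Rightarrow> nat \<Rightarrow> nat \<Rightarrow> complex" where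
  "cps_coeff F i j = fps2_of_cps F $ j $ i"

lift_definition cps_Y :: cps is fps_X by (rule convergent_fps2_X)

lift_definition cps_dx :: "cps \<Rightarrow> cps" is "\<lambda>F. Abs_fps (\<lambda>j. fps_deriv (F $ j))"
  by (rule convergent_fps2_deriv(2))

lift_definition cps_dy :: "cps \<Rightarrow> cps" is fps_deriv
  by (rule convergent_fps2_deriv(1))

text \<open>Only meaningful for \<open>F \<noteq> 0\<close>.\<close>
definition cps_ord :: "cps \<Rightarrow> nat" where
  "cps_ord F = (LEAST d. \<exists>i j. i + j = d \<and> cps_coeff F i j \<noteq> 0)"

text \<open>\<open>\<complex>{x}\<close> and \<open>\<complex>{x}[y]\<close> as subrings of \<open>\<complex>{x,y}\<close>.\<close>
definition cps_Cx :: "cps set" where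
  "cps_Cx = {F. \<forall>i j. j > 0 \<longrightarrow> cps_coeff F i j = 0}"

definition cps_Cx_y :: "cps set" where
  "cps_Cx_y = {F. \<exists>m a. (\<forall>j\<le>m. a j \<in> cps_Cx) \<and> F = (\<Sum>j\<le>m. a j * cps_Y ^ j)}"

text \<open>Only meaningful for nonzero elements of \<^const>\<open>cps_Cx_y\<close>.\<close>
definition deg_y :: "cps \<Rightarrow> nat" where
  "deg_y F = Max {j. \<exists>i. cps_coeff F i j \<noteq> 0}"


text \<open>The pair \<open>(R, S)\<close> is the 1-form \<open>R dx + S dy\<close>.\<close>
type_synonym oneform = "cps \<times> cps"

definition form_scale :: "cps \<Rightarrow> oneform \<Rightarrow> oneform" (infixr \<open>*\<^sub>w\<close> 75) where
  "h *\<^sub>w W = (h * fst W, h * snd W)"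

definition form_dx :: oneform where "form_dx = (1, 0)"

definition form_dy :: oneform where "form_dy = (0, 1)"

definition form_d :: "cps \<Rightarrow> oneform" where
  "form_d F = (cps_dx F, cps_dy F)"

text \<open>The coefficient of the wedge product with respect to \<open>dx \<and> dy\<close>.\<close>
definition form_wedge :: "oneform \<Rightarrow> oneform \<Rightarrow> cps" where
  "form_wedge W V = fst W * snd V - snd W * fst V"

definition singular_form :: "oneform \<Rightarrow> bool" where
  "singular_form W \<longleftrightarrow> coprime (fst W) (snd W) \<and>
     cps_coeff (fst W) 0 0 = 0 \<and> cps_coeff (snd W) 0 0 = 0"

text \<open>
  The foliation \<open>W = 0\<close>: two 1-forms with coprime coefficients have the same kernels
  if and only if they differ by a unit factor.
\<close>
definition foliation :: "oneform \<Rightarrow> oneform set" where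
  "foliation W = {u *\<^sub>w W | u. u dvd 1}"

text \<open>
  The plane curve germ \<open>{F = 0}\<close>, given as the class of all its equations, i.e. \<open>F\<close> up to units.
\<close>
definition curve :: "cps \<Rightarrow> cps set" where
  "curve F = {u * F | u. u dvd 1}"

definition separatrices :: "oneform \<Rightarrow> cps set set" where
  "separatrices W = {curve g | g. irreducible g \<and> g dvd form_wedge W (form_d g)}"

definition nondicritical :: "oneform \<Rightarrow> bool" where
  "nondicritical W \<longleftrightarrow> singular_form W \<and> finite (separatrices W)"

text \<open>\<open>G\<close> contains one equation for each separatrix.\<close>
definition is_union_of_separatrices :: "cps set \<Rightarrow> oneform \<Rightarrow> bool" where
  "is_union_of_separatrices C W \<longleftrightarrow>
     (\<exists>G. finite G \<and> bij_betw curve G (separatrices W) \<and> C = curve (\<Prod>g\<in>G. g))"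

text \<open>\<open>[Fol(f)]\<close>, a set of 1-forms.\<close>
definition Fol_forms :: "cps \<Rightarrow> oneform set" where
  "Fol_forms f = {W. nondicritical W \<and> f dvd form_wedge W (form_d f)}"

text \<open>\<open>Fol(f)\<close>, a set of foliations.\<close>
definition Fol :: "cps \<Rightarrow> oneform set set" where
  "Fol f = {foliation W | W. W \<in> Fol_forms f \<and> is_union_of_separatrices (curve f) W}"

definition weierstrass_form ::
    "cps \<Rightarrow> oneform \<Rightarrow> cps \<Rightarrow> cps \<Rightarrow> cps \<Rightarrow> cps \<Rightarrow> bool" where
  "weierstrass_form f W h p A B \<longleftrightarrow>
     W = h *\<^sub>w form_d f + (p * f) *\<^sub>w form_dx + A *\<^sub>w form_dx + B *\<^sub>w form_dy \<and>
     A \<in> cps_Cx_y \<and> B \<in> cps_Cx_y \<and>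
     (B = 0 \<or> deg_y B < deg_y f - 1) \<and> (A = 0 \<or> deg_y A < deg_y f)"

end

theory Submission
  imports
    Defs
    "HOL-Computational_Algebra.Polynomial_FPS"
    "HOL-Computational_Algebra.Fundamental_Theorem_Algebra"
    "HOL-Analysis.Complex_Transcendental"
begin

unbundle no vec_syntax

text \<open>
  Write \<open>W = R dx + S dy\<close>. Since \<open>h\<close> is a unit, \<open>deg\<^sub>y B < n - 1\<close> and \<open>ord f = n\<close>, the coefficient of
  \<open>y\<^bsup>n - 1\<^esup>\<close> in \<open>S\<close> does not vanish. By Newton--Puiseux, every separatrix other than \<open>x = 0\<close> (which is
  not invariant here) becomes, after a ramification \<open>x = t\<^sup>M\<close>, a union of graphs \<open>y = u(t)\<close>, and these
  solve the differential equation \<open>R(t\<^sup>M, u) d(t\<^sup>M) + S(t\<^sup>M, u) du = 0\<close>. Repeated blowing up shows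
  that such an equation with a nonzero term \<open>y\<^bsup>n - 1\<^esup>\<close> in \<open>S\<close> has at most \<open>n\<close> solutions through the origin,
  unless some exceptional divisor is not invariant, in which case there are infinitely many
  convergent ones, and hence infinitely many separatrices. As \<open>f\<close> already accounts for \<open>n\<close>
  solutions, there is no further separatrix.
\<close>

section \<open>Substitution in power series\<close>

text \<open>Divisibility among convergent series is reached through parametrised curves: the
  equation of a branch \<open>(t^m, u(t))\<close> is the product of \<open>y - v\<close> over the
  distinct conjugates \<open>v\<close> of \<open>u\<close>, it is prime because dividing by it means
  vanishing along the curve, and Newton-Puiseux then provides the prime factors of \<open>f\<close>.
  The roots of \<open>f\<close> and of a further separatrix \<open>g\<close> live over different
  ramifications. They become comparable graphs over one \<open>t\<close> by splitting
  \<open>f * g\<close>, which stays squarefree when \<open>g\<close> does not divide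
  \<open>f\<close>, so that no root is counted twice. The bound on the number of solutions must then
  not grow with the ramification index \<open>M\<close>. It does not: after multiplication by
  \<open>t\<close>, the equation has the coefficients \<open>M t^M R(t^M, y)\<close> and
  \<open>S(t^M, y)\<close>, and the second restricts on \<open>t = 0\<close> to
  \<open>S(0, y)\<close> whatever \<open>M\<close> is. Convergence has to be carried through all
  constructions because separatrices are convergent by definition: an infinity of merely formal
  solutions would not contradict nondicriticality.\<close>

type_synonym pser = "complex fps fps"

abbreviation varx :: pser where "varx \<equiv> fps_const fps_X"
abbreviation vary :: pser where "vary \<equiv> fps_X"
abbreviation cst :: "complex \<Rightarrow> pser" where "cst c \<equiv> fps_const (fps_const c)"

definition max_ideal_pow :: "nat \<Rightarrow> pser \<Rightarrow> bool" where
  "max_ideal_pow N F \<longleftrightarrow> (\<forall>i j. i + j < N \<longrightarrow> F $ j $ i = 0)"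

lemma max_ideal_pow_0 [simp]: "max_ideal_pow 0 F" by (simp add: max_ideal_pow_def)
lemma max_ideal_pow_Suc_0: "max_ideal_pow (Suc 0) F \<longleftrightarrow> F $ 0 $ 0 = 0" by (auto simp: max_ideal_pow_def)
lemma max_ideal_pow_add: "max_ideal_pow N F \<Longrightarrow> max_ideal_pow N G \<Longrightarrow> max_ideal_pow N (F + G)" by (simp add: max_ideal_pow_def)
lemma max_ideal_pow_zeroI: "(\<And>N. max_ideal_pow N F) \<Longrightarrow> F = 0"
  by (rule fps_ext, rule fps_ext) (auto simp: max_ideal_pow_def)

lemma pser_mult_nth: "(F * G :: pser) $ j $ i = (\<Sum>b\<le>j. \<Sum>a\<le>i. F $ b $ a * G $ (j - b) $ (i - a))"
  by (simp add: fps_mult_nth fps_sum_nth atLeast0AtMost)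

lemma max_ideal_pow_mult:
  assumes "max_ideal_pow N F" "max_ideal_pow M G"
  shows "max_ideal_pow (N + M) (F * G)"
  unfolding max_ideal_pow_def
proof (intro allI impI)
  fix i j assume ij: "i + j < N + M"
  have "F $ b $ a * G $ (j - b) $ (i - a) = 0" if "b \<le> j" "a \<le> i" for a b
  proof (cases "a + b < N")
    case True thus ?thesis using assms by (simp add: max_ideal_pow_def)
  next
    case False
    hence "(i - a) + (j - b) < M" using ij that by linarith
    thus ?thesis using assms by (simp add: max_ideal_pow_def)
  qed
  thus "(F * G) $ j $ i = 0" unfolding pser_mult_nth by (simp add: sum.neutral)
qed

lemma max_ideal_pow_mult_Suc: "F $ 0 $ 0 = 0 \<Longrightarrow> max_ideal_pow N G \<Longrightarrow> max_ideal_pow (Suc N) (F * G)"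
  using max_ideal_pow_mult[of 1 F N G] by (simp add: max_ideal_pow_Suc_0)

lemma max_ideal_pow_power: "F $ 0 $ 0 = 0 \<Longrightarrow> max_ideal_pow k (F ^ k)"
  by (induction k) (auto intro: max_ideal_pow_mult_Suc)

lemma max_ideal_pow_power_mult: "X $ 0 $ 0 = 0 \<Longrightarrow> U $ 0 $ 0 = 0 \<Longrightarrow> max_ideal_pow (i + j) (X ^ i * U ^ j)"
  by (intro max_ideal_pow_mult max_ideal_pow_power)

lemma pser_decomp:
  obtains A B where "F = cst (F $ 0 $ 0) + varx * A + vary * B"
proof
  have "F = fps_const (F $ 0) + vary * fps_shift 1 F"
    by (rule fps_ext) (simp add: fps_mult_fps_X_plus_1_nth)
  moreover have "F $ 0 = fps_const (F $ 0 $ 0) + fps_X * fps_shift 1 (F $ 0)"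
    by (rule fps_ext) simp
  ultimately show "F = cst (F $ 0 $ 0) + varx * fps_const (fps_shift 1 (F $ 0)) + vary * fps_shift 1 F"
    by (metis fps_const_add fps_const_mult)
qed

text \<open>
  The workhorse for identities between substitutions: by Krull's intersection theorem a map \<open>E\<close>
  vanishes if the order of \<open>E (c + x A + y B)\<close> exceeds that of \<open>E A\<close> and \<open>E B\<close>.
\<close>
lemma max_ideal_pow_induct:
  assumes "\<And>A B c N. max_ideal_pow N (E A) \<Longrightarrow> max_ideal_pow N (E B) \<Longrightarrow> max_ideal_pow (Suc N) (E (cst c + varx * A + vary * B))"
  shows "E F = 0"
proof -
  have "\<forall>F. max_ideal_pow N (E F)" for N
  proof (induction N)
    case (Suc N)
    show ?case
    proof
      fix F
      obtain A B where F: "F = cst (F $ 0 $ 0) + varx * A + vary * B" by (rule pser_decomp)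
      show "max_ideal_pow (Suc N) (E F)" using assms[of N A B "F $ 0 $ 0"] Suc F by metis
    qed
  qed simp
  thus ?thesis using max_ideal_pow_zeroI by blast
qed

text \<open>
  \<open>F(X, U)\<close>, only meaningful for \<open>X\<close>, \<open>U\<close> without constant term: then \<open>X\<^sup>i U\<^sup>j\<close> has no
  terms of degree below \<open>i + j\<close>, which justifies the cut-off.
\<close>
definition subst :: "pser \<Rightarrow> pser \<Rightarrow> pser \<Rightarrow> pser" where
  "subst X U F = Abs_fps (\<lambda>l. Abs_fps (\<lambda>k.
     \<Sum>i\<le>l+k. \<Sum>j\<le>l+k. F $ j $ i * (X ^ i * U ^ j) $ l $ k))"

lemma subst_nth:
  assumes "X $ 0 $ 0 = 0" "U $ 0 $ 0 = 0" "l + k \<le> N"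
  shows "subst X U F $ l $ k = (\<Sum>i\<le>N. \<Sum>j\<le>N. F $ j $ i * (X ^ i * U ^ j) $ l $ k)"
proof -
  have z: "(X ^ i * U ^ j) $ l $ k = 0" if "i > l + k \<or> j > l + k" for i j
    using max_ideal_pow_power_mult[of X U i j] assms that unfolding max_ideal_pow_def by auto
  have "(\<Sum>i\<le>N. \<Sum>j\<le>N. F $ j $ i * (X ^ i * U ^ j) $ l $ k) =
      (\<Sum>i\<le>l+k. \<Sum>j\<le>N. F $ j $ i * (X ^ i * U ^ j) $ l $ k)"
    by (rule sum.mono_neutral_right) (use assms z in auto)
  also have "\<dots> = (\<Sum>i\<le>l+k. \<Sum>j\<le>l+k. F $ j $ i * (X ^ i * U ^ j) $ l $ k)"
    by (intro sum.cong refl sum.mono_neutral_right) (use assms z in auto)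
  finally show ?thesis by (simp add: subst_def)
qed

lemma cst_mult_nth [simp]: "(cst c * F) $ l $ k = c * F $ l $ k"
  by simp

lemma mult_cst_nth: "(F * (cst c * G)) $ l $ k = c * (F * G) $ l $ k"
  unfolding mult.left_commute[of F] by (rule cst_mult_nth)

lemma subst_add: "subst X U (F + G) = subst X U F + subst X U G"
  by (intro fps_ext) (simp add: subst_def sum.distrib algebra_simps)

lemma subst_diff: "subst X U (F - G) = subst X U F - subst X U G"
  by (intro fps_ext) (simp add: subst_def sum_subtractf algebra_simps)

lemma subst_cst_mult: "subst X U (cst c * F) = cst c * subst X U F"
  by (intro fps_ext) (simp add: subst_def sum_distrib_left mult.assoc)

lemma subst_const [simp]:
  assumes "X $ 0 $ 0 = 0" "U $ 0 $ 0 = 0"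
  shows "subst X U (cst c) = cst c"
proof (intro fps_ext)
  fix l k
  have "subst X U (cst c) $ l $ k = (\<Sum>i\<le>l+k. if i = 0 then (\<Sum>j\<le>l+k. if j = 0 then c * (1::pser) $ l $ k else 0) else 0)"
    unfolding subst_def by (auto intro!: sum.cong sum.neutral)
  also have "\<dots> = cst c $ l $ k" by (simp only: sum.delta finite_atMost) simp
  finally show "subst X U (cst c) $ l $ k = cst c $ l $ k" .
qed

lemma subst_1 [simp]: "X $ 0 $ 0 = 0 \<Longrightarrow> U $ 0 $ 0 = 0 \<Longrightarrow> subst X U 1 = 1"
  using subst_const[of X U 1] by simp

lemma subst_varx_mult:
  assumes "X $ 0 $ 0 = 0" "U $ 0 $ 0 = 0"
  shows "subst X U (varx * F) = X * subst X U F"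
proof (intro fps_ext)
  fix l k :: nat
  define N where "N = l + k"
  \<comment> \<open>\<open>T\<close> is cut off one step later in \<open>j\<close> than in
    \<open>i\<close>: in the sum up to \<open>Suc N\<close> for \<open>x F\<close>, the term
    \<open>i = 0\<close> vanishes and shifts \<open>i\<close> only. The surplus terms
    \<open>j = Suc N\<close> have order above \<open>N\<close>.\<close>
  define T where "T = (\<Sum>i\<le>N. \<Sum>j\<le>Suc N. cst (F $ j $ i) * (X ^ i * U ^ j))"
  have a: "subst X U F $ b $ a = T $ b $ a" if "a + b \<le> N" for a b
  proof -
    have z: "(X ^ i * U ^ Suc N) $ b $ a = 0" for i
      using max_ideal_pow_power_mult[of X U i "Suc N"] assms that unfolding max_ideal_pow_def by auto
    have "b + a \<le> N" using that by simp
    from subst_nth[OF assms this] z show ?thesis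
      by (simp add: T_def fps_sum_nth del: power_Suc)
  qed
  have "subst X U (varx * F) $ l $ k = (\<Sum>i\<le>Suc N. \<Sum>j\<le>Suc N. (varx * F) $ j $ i * (X ^ i * U ^ j) $ l $ k)"
    by (rule subst_nth) (use assms N_def in auto)
  also have "\<dots> = (\<Sum>i\<le>N. \<Sum>j\<le>Suc N. F $ j $ i * (X * (X ^ i * U ^ j)) $ l $ k)"
    by (subst sum.atMost_Suc_shift) (simp add: mult.assoc)
  also have "\<dots> = (X * T) $ l $ k"
    by (simp only: T_def sum_distrib_left fps_sum_nth mult_cst_nth)
  also have "\<dots> = (X * subst X U F) $ l $ k"
    unfolding pser_mult_nth by (intro sum.cong refl) (use a in \<open>auto simp: N_def\<close>)
  finally show "subst X U (varx * F) $ l $ k = (X * subst X U F) $ l $ k" .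
qed

lemma subst_vary_mult:
  assumes "X $ 0 $ 0 = 0" "U $ 0 $ 0 = 0"
  shows "subst X U (vary * F) = U * subst X U F"
proof (intro fps_ext)
  fix l k :: nat
  define N where "N = l + k"
  define T where "T = (\<Sum>i\<le>Suc N. \<Sum>j\<le>N. cst (F $ j $ i) * (X ^ i * U ^ j))"
  have a: "subst X U F $ b $ a = T $ b $ a" if "a + b \<le> N" for a b
  proof -
    have z: "(X ^ Suc N * U ^ j) $ b $ a = 0" for j
      using max_ideal_pow_power_mult[of X U "Suc N" j] assms that unfolding max_ideal_pow_def by auto
    have "b + a \<le> N" using that by simp
    from subst_nth[OF assms this] z show ?thesis
      by (simp add: T_def fps_sum_nth del: power_Suc)
  qed
  have "subst X U (vary * F) $ l $ k = (\<Sum>i\<le>Suc N. \<Sum>j\<le>Suc N. (vary * F) $ j $ i * (X ^ i * U ^ j) $ l $ k)"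
    by (rule subst_nth) (use assms N_def in auto)
  also have "\<dots> = (\<Sum>i\<le>Suc N. \<Sum>j\<le>N. F $ j $ i * (U * (X ^ i * U ^ j)) $ l $ k)"
    by (rule sum.cong[OF refl], subst sum.atMost_Suc_shift) (simp add: mult_ac)
  also have "\<dots> = (U * T) $ l $ k"
    by (simp only: T_def sum_distrib_left fps_sum_nth mult_cst_nth)
  also have "\<dots> = (U * subst X U F) $ l $ k"
    unfolding pser_mult_nth by (intro sum.cong refl) (use a in \<open>auto simp: N_def\<close>)
  finally show "subst X U (vary * F) $ l $ k = (U * subst X U F) $ l $ k" .
qed

lemma subst_decomp:
  assumes "X $ 0 $ 0 = 0" "U $ 0 $ 0 = 0"
  shows "subst X U (cst c + varx * A + vary * B) = cst c + X * subst X U A + U * subst X U B"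
  using assms by (simp only: subst_add subst_varx_mult subst_vary_mult subst_const)

lemma subst_varx [simp]: "X $ 0 $ 0 = 0 \<Longrightarrow> U $ 0 $ 0 = 0 \<Longrightarrow> subst X U varx = X"
  using subst_varx_mult[of X U 1] by simp

lemma subst_vary [simp]: "X $ 0 $ 0 = 0 \<Longrightarrow> U $ 0 $ 0 = 0 \<Longrightarrow> subst X U vary = U"
  using subst_vary_mult[of X U 1] by simp

text \<open>The defect satisfies \<open>E (c + x A + y B) = X * E A + U * E B\<close>, and
  multiplication by \<open>X\<close> or \<open>U\<close> raises the order. Composition and the chain
  rule below follow the same scheme.\<close>

lemma subst_mult:
  assumes XU: "X $ 0 $ 0 = 0" "U $ 0 $ 0 = 0"
  shows "subst X U (F * G) = subst X U F * subst X U G"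
proof -
  define E where "E F = subst X U (F * G) - subst X U F * subst X U G" for F
  have "E F = 0"
  proof (rule max_ideal_pow_induct[of E])
    fix A B c N
    assume IH: "max_ideal_pow N (E A)" "max_ideal_pow N (E B)"
    have "E (cst c + varx * A + vary * B) = X * E A + U * E B"
    proof -
      have "(cst c + varx * A + vary * B) * G = cst c * G + varx * (A * G) + vary * (B * G)"
        by (simp add: algebra_simps del: fps_const_mult_left)
      hence "subst X U ((cst c + varx * A + vary * B) * G)
          = cst c * subst X U G + X * subst X U (A * G) + U * subst X U (B * G)"
        using XU by (simp only: subst_add subst_varx_mult subst_vary_mult subst_cst_mult)
      thus ?thesis unfolding E_def subst_decomp[OF XU]
        by (simp add: algebra_simps)
    qed
    thus "max_ideal_pow (Suc N) (E (cst c + varx * A + vary * B))"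
      using XU IH by (auto intro: max_ideal_pow_add max_ideal_pow_mult_Suc)
  qed
  thus ?thesis by (simp add: E_def)
qed

lemma subst_power: "X $ 0 $ 0 = 0 \<Longrightarrow> U $ 0 $ 0 = 0 \<Longrightarrow> subst X U (F ^ k) = subst X U F ^ k"
  by (induction k) (auto simp: subst_mult)

lemma subst_nth_00 [simp]:
  assumes "X $ 0 $ 0 = 0" "U $ 0 $ 0 = 0" shows "subst X U F $ 0 $ 0 = F $ 0 $ 0"
  by (simp add: subst_def)

lemma subst_subst:
  assumes XU: "X $ 0 $ 0 = 0" "U $ 0 $ 0 = 0" and YV: "Y $ 0 $ 0 = 0" "V $ 0 $ 0 = 0"
  shows "subst Y V (subst X U F) = subst (subst Y V X) (subst Y V U) F"
proof -
  define E where "E F = subst Y V (subst X U F) - subst (subst Y V X) (subst Y V U) F" for F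
  have 0: "subst Y V X $ 0 $ 0 = 0" "subst Y V U $ 0 $ 0 = 0" using assms by auto
  have "E F = 0"
  proof (rule max_ideal_pow_induct[of E])
    fix A B c N
    assume IH: "max_ideal_pow N (E A)" "max_ideal_pow N (E B)"
    have "E (cst c + varx * A + vary * B) = subst Y V X * E A + subst Y V U * E B"
    proof -
      have "subst Y V (subst X U (cst c + varx * A + vary * B)) =
          cst c + subst Y V X * subst Y V (subst X U A) + subst Y V U * subst Y V (subst X U B)"
        unfolding subst_decomp[OF XU] by (simp only: subst_add subst_mult[OF YV] subst_const[OF YV])
      thus ?thesis unfolding E_def subst_decomp[OF 0] by (simp add: algebra_simps)
    qed
    thus "max_ideal_pow (Suc N) (E (cst c + varx * A + vary * B))"
      using 0 IH by (auto intro: max_ideal_pow_add max_ideal_pow_mult_Suc)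
  qed
  thus ?thesis by (simp add: E_def)
qed

lemma subst_id [simp]: "subst varx vary F = F"
proof -
  have 0: "varx $ 0 $ 0 = 0" "vary $ 0 $ 0 = (0::complex)" by auto
  define E where "E F = subst varx vary F - F" for F
  have "E F = 0"
  proof (rule max_ideal_pow_induct[of E])
    fix A B c N
    assume IH: "max_ideal_pow N (E A)" "max_ideal_pow N (E B)"
    have eq: "E (cst c + varx * A + vary * B) = varx * E A + vary * E B"
      unfolding E_def subst_decomp[OF 0] by (simp add: algebra_simps)
    show "max_ideal_pow (Suc N) (E (cst c + varx * A + vary * B))"
      unfolding eq by (intro max_ideal_pow_add max_ideal_pow_mult_Suc 0 IH)
  qed
  thus ?thesis by (simp add: E_def)
qed

section \<open>Partial derivatives and the chain rule\<close>

definition dx :: "pser \<Rightarrow> pser" where "dx F = Abs_fps (\<lambda>j. fps_deriv (F $ j))"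
abbreviation dy :: "pser \<Rightarrow> pser" where "dy \<equiv> fps_deriv"

lemma dx_nth [simp]: "dx F $ j $ i = of_nat (Suc i) * F $ j $ Suc i"
  by (simp add: dx_def)

lemma dy_nth [simp]: "dy F $ j $ i = of_nat (Suc j) * F $ Suc j $ i"
proof -
  have "(of_nat m * A) $ i = of_nat m * (A $ i)" for m i and A :: "complex fps"
    by (metis fps_mult_left_const_nth fps_of_nat)
  thus ?thesis by (metis fps_deriv_nth Suc_eq_plus1)
qed

lemma dx_add: "dx (F + G) = dx F + dx G"
  by (intro fps_ext) (simp add: algebra_simps)
lemma dx_fps_const [simp]: "dx (fps_const u) = fps_const (fps_deriv u)"
  by (rule fps_ext) (simp add: dx_def)
lemma dx_vary [simp]: "dx vary = 0"
  by (rule fps_ext) (simp add: dx_def)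
lemma dx_mult: "dx (F * G) = dx F * G + F * dx G"
proof (rule fps_ext)
  fix j
  have "dx (F * G) $ j = (\<Sum>b=0..j. fps_deriv (F $ b * G $ (j - b)))"
    by (simp add: dx_def fps_mult_nth fps_deriv_sum)
  also have "\<dots> = (dx F * G + F * dx G) $ j"
    unfolding fps_mult_nth fps_add_nth sum.distrib[symmetric]
    by (intro sum.cong) (simp_all add: dx_def add.commute)
  finally show "dx (F * G) $ j = (dx F * G + F * dx G) $ j" .
qed

lemma dx_subst:
  assumes XU: "X $ 0 $ 0 = 0" "U $ 0 $ 0 = 0"
  shows "dx (subst X U F) = subst X U (dx F) * dx X + subst X U (dy F) * dx U"
proof -
  define E where "E F = dx (subst X U F) - (subst X U (dx F) * dx X + subst X U (dy F) * dx U)" for F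
  have "E F = 0"
  proof (rule max_ideal_pow_induct[of E])
    fix A B c N
    assume IH: "max_ideal_pow N (E A)" "max_ideal_pow N (E B)"
    have "E (cst c + varx * A + vary * B) = X * E A + U * E B"
      unfolding E_def subst_decomp[OF XU]
      by (simp add: dx_add dx_mult subst_add subst_mult[OF XU] XU algebra_simps)
    thus "max_ideal_pow (Suc N) (E (cst c + varx * A + vary * B))"
      using XU IH by (auto intro: max_ideal_pow_add max_ideal_pow_mult_Suc)
  qed
  thus ?thesis by (simp add: E_def)
qed

lemma dy_subst:
  assumes XU: "X $ 0 $ 0 = 0" "U $ 0 $ 0 = 0"
  shows "dy (subst X U F) = subst X U (dx F) * dy X + subst X U (dy F) * dy U"
proof -
  define E where "E F = dy (subst X U F) - (subst X U (dx F) * dy X + subst X U (dy F) * dy U)" for F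
  have "E F = 0"
  proof (rule max_ideal_pow_induct[of E])
    fix A B c N
    assume IH: "max_ideal_pow N (E A)" "max_ideal_pow N (E B)"
    have "E (cst c + varx * A + vary * B) = X * E A + U * E B"
      unfolding E_def subst_decomp[OF XU]
      by (simp add: dx_add dx_mult subst_add subst_mult[OF XU] XU algebra_simps)
    thus "max_ideal_pow (Suc N) (E (cst c + varx * A + vary * B))"
      using XU IH by (auto intro: max_ideal_pow_add max_ideal_pow_mult_Suc)
  qed
  thus ?thesis by (simp add: E_def)
qed

section \<open>Majorants and convergence\<close>

text \<open>The triangle \<open>i + j \<le> N\<close> lies inside the square. This is what makes the
  truncated norms submultiplicative.\<close>

lemma sum_convolution_le:
  fixes x y :: "nat \<Rightarrow> real"
  assumes "\<And>i. 0 \<le> x i" "\<And>i. 0 \<le> y i"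
  shows "(\<Sum>i\<le>N. \<Sum>a\<le>i. x a * y (i - a)) \<le> (\<Sum>i\<le>N. x i) * (\<Sum>i\<le>N. y i)"
proof -
  have "(\<Sum>i\<le>N. \<Sum>a\<le>i. x a * y (i - a)) = (\<Sum>(i, j)\<in>{(i, j). i + j \<le> N}. x i * y j)"
    by (rule sum.triangle_reindex_eq[symmetric])
  also have "\<dots> \<le> (\<Sum>(i, j)\<in>{..N} \<times> {..N}. x i * y j)"
    using assms by (intro sum_mono2) auto
  also have "\<dots> = (\<Sum>i\<le>N. x i) * (\<Sum>i\<le>N. y i)"
    by (simp add: sum_product sum.cartesian_product)
  finally show ?thesis .
qed

text \<open>Weighted l1-norm at radius \<open>\<rho>\<close>, truncated so that it is defined
  without any convergence; convergence becomes boundedness in \<open>N\<close>. Truncation also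
  permits inductions on \<open>N\<close> for series not yet known to converge.\<close>

definition fps_norm :: "nat \<Rightarrow> real \<Rightarrow> complex fps \<Rightarrow> real" where
  "fps_norm N \<rho> f = (\<Sum>i\<le>N. norm (f $ i) * \<rho> ^ i)"

definition pser_norm :: "nat \<Rightarrow> real \<Rightarrow> pser \<Rightarrow> real" where
  "pser_norm N \<rho> F = (\<Sum>j\<le>N. fps_norm N \<rho> (F $ j) * \<rho> ^ j)"

lemma fps_norm_nonneg: "\<rho> \<ge> 0 \<Longrightarrow> fps_norm N \<rho> f \<ge> 0"
  unfolding fps_norm_def by (intro sum_nonneg) auto

lemma pser_norm_nonneg: "\<rho> \<ge> 0 \<Longrightarrow> pser_norm N \<rho> F \<ge> 0"
  unfolding pser_norm_def by (intro sum_nonneg mult_nonneg_nonneg fps_norm_nonneg) auto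

lemma fps_norm_add: "\<rho> \<ge> 0 \<Longrightarrow> fps_norm N \<rho> (f + g) \<le> fps_norm N \<rho> f + fps_norm N \<rho> g"
  unfolding fps_norm_def sum.distrib[symmetric]
  by (intro sum_mono) (auto simp: distrib_right[symmetric] intro!: mult_right_mono norm_triangle_ineq)

lemma fps_norm_uminus [simp]: "fps_norm N \<rho> (- f) = fps_norm N \<rho> f"
  by (simp add: fps_norm_def)

lemma fps_norm_const_mult: "fps_norm N \<rho> (fps_const c * f) = norm c * fps_norm N \<rho> f"
  by (simp add: fps_norm_def norm_mult sum_distrib_left mult.assoc)

lemma fps_norm_sum: "\<rho> \<ge> 0 \<Longrightarrow> fps_norm N \<rho> (\<Sum>a\<in>A. f a) \<le> (\<Sum>a\<in>A. fps_norm N \<rho> (f a))"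
proof (induction A rule: infinite_finite_induct)
  case (insert x F)
  thus ?case using fps_norm_add[of \<rho> N "f x" "sum f F"] by simp
qed (simp_all add: fps_norm_def)

lemma fps_norm_mult:
  assumes "\<rho> \<ge> 0"
  shows "fps_norm N \<rho> (f * g) \<le> fps_norm N \<rho> f * fps_norm N \<rho> g"
proof -
  have "fps_norm N \<rho> (f * g) \<le> (\<Sum>i\<le>N. \<Sum>a\<le>i. norm (f $ a) * \<rho> ^ a * (norm (g $ (i - a)) * \<rho> ^ (i - a)))"
    unfolding fps_norm_def
  proof (rule sum_mono)
    fix i
    have "norm ((f * g) $ i) * \<rho> ^ i \<le> (\<Sum>a\<le>i. norm (f $ a * g $ (i - a))) * \<rho> ^ i"
      using assms by (intro mult_right_mono) (auto simp: fps_mult_nth atLeast0AtMost intro: norm_sum)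
    also have "\<dots> = (\<Sum>a\<le>i. norm (f $ a) * \<rho> ^ a * (norm (g $ (i - a)) * \<rho> ^ (i - a)))"
      unfolding sum_distrib_right
      by (intro sum.cong refl) (auto simp: norm_mult mult_ac power_add[symmetric])
    finally show "norm ((f * g) $ i) * \<rho> ^ i \<le> \<dots>" .
  qed
  also have "\<dots> \<le> fps_norm N \<rho> f * fps_norm N \<rho> g"
    unfolding fps_norm_def by (rule sum_convolution_le) (use assms in auto)
  finally show ?thesis .
qed

lemma pser_norm_add: "\<rho> \<ge> 0 \<Longrightarrow> pser_norm N \<rho> (F + G) \<le> pser_norm N \<rho> F + pser_norm N \<rho> G"
  unfolding pser_norm_def sum.distrib[symmetric]
  by (intro sum_mono) (auto simp: distrib_right[symmetric] intro!: mult_right_mono fps_norm_add)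

lemma pser_norm_cst_mult: "pser_norm N \<rho> (cst c * F) = norm c * pser_norm N \<rho> F"
  by (simp add: pser_norm_def fps_norm_const_mult sum_distrib_left mult.assoc)

lemma pser_norm_0 [simp]: "pser_norm N \<rho> 0 = 0"
  by (simp add: pser_norm_def fps_norm_def)

lemma pser_norm_sum: "\<rho> \<ge> 0 \<Longrightarrow> pser_norm N \<rho> (\<Sum>a\<in>A. f a) \<le> (\<Sum>a\<in>A. pser_norm N \<rho> (f a))"
proof (induction A rule: infinite_finite_induct)
  case (insert x F)
  thus ?case using pser_norm_add[of \<rho> N "f x" "sum f F"] by simp
qed simp_all

lemma pser_norm_mult:
  assumes "\<rho> \<ge> 0"
  shows "pser_norm N \<rho> (F * G) \<le> pser_norm N \<rho> F * pser_norm N \<rho> G"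
proof -
  have "pser_norm N \<rho> (F * G) \<le> (\<Sum>i\<le>N. \<Sum>a\<le>i. fps_norm N \<rho> (F $ a) * \<rho> ^ a * (fps_norm N \<rho> (G $ (i - a)) * \<rho> ^ (i - a)))"
    unfolding pser_norm_def
  proof (rule sum_mono)
    fix i
    have "fps_norm N \<rho> ((F * G) $ i) \<le> (\<Sum>a\<le>i. fps_norm N \<rho> (F $ a * G $ (i - a)))"
      using fps_norm_sum[OF assms, of N "\<lambda>a. F $ a * G $ (i - a)" "{..i}"]
      by (simp add: fps_mult_nth atLeast0AtMost)
    also have "\<dots> \<le> (\<Sum>a\<le>i. fps_norm N \<rho> (F $ a) * fps_norm N \<rho> (G $ (i - a)))"
      by (intro sum_mono fps_norm_mult assms)
    finally have "fps_norm N \<rho> ((F * G) $ i) * \<rho> ^ i \<le> \<dots> * \<rho> ^ i"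
      using assms by (intro mult_right_mono) auto
    also have "\<dots> = (\<Sum>a\<le>i. fps_norm N \<rho> (F $ a) * \<rho> ^ a * (fps_norm N \<rho> (G $ (i - a)) * \<rho> ^ (i - a)))"
      unfolding sum_distrib_right
      by (intro sum.cong refl) (auto simp: mult_ac power_add[symmetric])
    finally show "fps_norm N \<rho> ((F * G) $ i) * \<rho> ^ i \<le> \<dots>" .
  qed
  also have "\<dots> \<le> pser_norm N \<rho> F * pser_norm N \<rho> G"
    unfolding pser_norm_def by (rule sum_convolution_le) (use assms fps_norm_nonneg in auto)
  finally show ?thesis .
qed

lemma fps_norm_fps_const: "\<rho> \<ge> 0 \<Longrightarrow> fps_norm N \<rho> (fps_const c) = norm c"
proof -
  have "fps_norm N \<rho> (fps_const c) = (\<Sum>i\<le>N. if i = 0 then norm c else 0)"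
    unfolding fps_norm_def by (intro sum.cong) auto
  thus ?thesis by simp
qed

lemma pser_norm_fps_const: "pser_norm N \<rho> (fps_const u) = fps_norm N \<rho> u"
proof -
  have "pser_norm N \<rho> (fps_const u) = (\<Sum>j\<le>N. if j = 0 then fps_norm N \<rho> u else 0)"
    unfolding pser_norm_def by (intro sum.cong) (auto simp: fps_norm_def)
  thus ?thesis by simp
qed

lemma pser_norm_1: "\<rho> \<ge> 0 \<Longrightarrow> pser_norm N \<rho> 1 = 1"
  using pser_norm_fps_const[of N \<rho> 1] fps_norm_fps_const[of \<rho> N 1] by simp

lemma pser_norm_varx: "\<rho> \<ge> 0 \<Longrightarrow> pser_norm N \<rho> varx \<le> \<rho>"
proof -
  assume "\<rho> \<ge> 0"
  have "fps_norm N \<rho> fps_X = (\<Sum>j\<le>N. if j = 1 then \<rho> else 0)"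
    unfolding fps_norm_def by (intro sum.cong) (auto simp: fps_X_def)
  also have "\<dots> \<le> \<rho>" using \<open>\<rho> \<ge> 0\<close> by simp
  finally show ?thesis by (simp add: pser_norm_fps_const)
qed

lemma pser_norm_power: "\<rho> \<ge> 0 \<Longrightarrow> pser_norm N \<rho> (F ^ k) \<le> pser_norm N \<rho> F ^ k"
proof (induction k)
  case (Suc k)
  have "pser_norm N \<rho> (F ^ Suc k) \<le> pser_norm N \<rho> F * pser_norm N \<rho> (F ^ k)"
    using pser_norm_mult[OF Suc.prems] by simp
  also have "\<dots> \<le> pser_norm N \<rho> F * pser_norm N \<rho> F ^ k"
    using Suc by (intro mult_left_mono pser_norm_nonneg) auto
  finally show ?case by simp
qed (simp add: pser_norm_1)

lemma pser_norm_alt: "pser_norm N \<rho> F = (\<Sum>j\<le>N. \<Sum>i\<le>N. norm (F $ j $ i) * \<rho> ^ i * \<rho> ^ j)"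
  by (simp add: pser_norm_def fps_norm_def sum_distrib_right)

lemma pser_norm_mono:
  assumes "0 \<le> \<rho>" "\<rho> \<le> r" shows "pser_norm N \<rho> F \<le> pser_norm N r F"
  unfolding pser_norm_alt using assms by (intro sum_mono mult_mono power_mono) auto

lemma convergent_fps2_pser_norm:
  assumes "convergent_fps2 F"
  obtains r B where "r > 0" "\<And>N. pser_norm N r F \<le> B"
proof -
  obtain r :: real where r: "r > 0"
    and s: "(\<lambda>(i, j). norm (F $ j $ i) * r ^ i * r ^ j) summable_on UNIV"
    using assms unfolding convergent_fps2_def by blast
  have "pser_norm N r F \<le> (\<Sum>\<^sub>\<infinity>(i, j). norm (F $ j $ i) * r ^ i * r ^ j)" for N
  proof -
    have "pser_norm N r F = (\<Sum>(i, j)\<in>{..N} \<times> {..N}. norm (F $ j $ i) * r ^ i * r ^ j)"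
      unfolding pser_norm_alt sum.cartesian_product[symmetric] by (rule sum.swap)
    also have "\<dots> \<le> (\<Sum>\<^sub>\<infinity>(i, j). norm (F $ j $ i) * r ^ i * r ^ j)"
      by (rule finite_sum_le_infsum[OF s]) (use r in auto)
    finally show ?thesis .
  qed
  thus ?thesis using r that by blast
qed

lemma convergent_fps2_pser_normI:
  assumes r: "r > 0" and B: "\<And>N. pser_norm N r F \<le> B"
  shows "convergent_fps2 F"
proof (rule convergent_fps2I[of "1 / r" _ B])
  fix i j :: nat
  define N where "N = max i j"
  have "norm (F $ j $ i) * r ^ i * r ^ j \<le> (\<Sum>i\<le>N. norm (F $ j $ i) * r ^ i * r ^ j)"
    by (rule member_le_sum[of i "{..N}" "\<lambda>i. norm (F $ j $ i) * r ^ i * r ^ j"]) (use r in \<open>auto simp: N_def\<close>)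
  also have "\<dots> \<le> pser_norm N r F" unfolding pser_norm_alt
    by (rule member_le_sum[of j "{..N}" "\<lambda>j. \<Sum>i\<le>N. norm (F $ j $ i) * r ^ i * r ^ j"])
       (use r in \<open>auto simp: N_def intro!: sum_nonneg\<close>)
  finally have "norm (F $ j $ i) * r ^ (i + j) \<le> B" using B[of N] by (simp add: power_add mult.assoc)
  thus "norm (F $ j $ i) \<le> B * (1 / r) ^ (i + j)"
    using r by (simp add: field_simps)
qed (use r in auto)

text \<open>Only monomials of positive degree occur, and each shrinks at least by the factor
  \<open>\<rho> / s\<close> when the radius drops from \<open>s\<close> to
  \<open>\<rho>\<close>.\<close>

lemma pser_norm_small:
  assumes F: "convergent_fps2 F" "F $ 0 $ 0 = 0" and e: "\<epsilon> > 0"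
  obtains r where "r > 0" "\<And>\<rho> N. 0 < \<rho> \<Longrightarrow> \<rho> \<le> r \<Longrightarrow> pser_norm N \<rho> F \<le> \<epsilon>"
proof -
  obtain s B where s: "s > 0" and B: "\<And>N. pser_norm N s F \<le> B"
    using convergent_fps2_pser_norm[OF F(1)] by blast
  have B0: "B \<ge> 0" using B[of 0] pser_norm_nonneg[of s 0 F] s by linarith
  define r where "r = min s (s * \<epsilon> / (B + 1))"
  have r: "r > 0" "r \<le> s"
    using s e B0 by (auto simp: r_def)
  have "r \<le> s * \<epsilon> / (B + 1)" by (simp add: r_def)
  hence "r * (B + 1) \<le> s * \<epsilon>" using B0 by (simp add: pos_le_divide_eq)
  hence rB: "r * B \<le> s * \<epsilon>" using r by (simp add: algebra_simps)
  have "pser_norm N \<rho> F \<le> \<epsilon>" if "0 < \<rho>" "\<rho> \<le> r" for \<rho> N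
  proof -
    have "pser_norm N \<rho> F \<le> (\<rho> / s) * pser_norm N s F"
      unfolding pser_norm_alt sum_distrib_left
    proof (intro sum_mono)
      fix i j :: nat
      show "norm (F $ j $ i) * \<rho> ^ i * \<rho> ^ j \<le> \<rho> / s * (norm (F $ j $ i) * s ^ i * s ^ j)"
      proof (cases "i + j = 0")
        case False
        then obtain k where k: "i + j = Suc k" by (cases "i + j") auto
        have "\<rho> ^ i * \<rho> ^ j = \<rho> * \<rho> ^ k" using k by (metis power_Suc power_add)
        also have "\<dots> \<le> \<rho> * s ^ k" using that r by (intro mult_left_mono power_mono) auto
        also have "\<dots> = \<rho> / s * (s ^ i * s ^ j)"
        proof -
          have "s ^ i * s ^ j = s * s ^ k" using k by (metis power_Suc power_add)
          thus ?thesis using s by simp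
        qed
        finally have "norm (F $ j $ i) * (\<rho> ^ i * \<rho> ^ j) \<le> norm (F $ j $ i) * (\<rho> / s * (s ^ i * s ^ j))"
          by (intro mult_left_mono) auto
        thus ?thesis by (simp add: mult_ac)
      qed (use F in auto)
    qed
    also have "\<dots> \<le> (r / s) * B" using that s r B B0 pser_norm_nonneg[of s N F]
      by (intro mult_mono divide_right_mono) auto
    also have "\<dots> \<le> \<epsilon>" using rB s by (simp add: field_simps)
    finally show ?thesis .
  qed
  thus ?thesis using r that by blast
qed

text \<open>Replacing \<open>X\<close> and \<open>U\<close> by their norms majorises the
  substitution. Coefficients with both indices up to \<open>N\<close> have total degree up to
  \<open>2 * N\<close>, hence the larger truncation on the right.\<close>

lemma pser_norm_subst:
  assumes XU: "X $ 0 $ 0 = 0" "U $ 0 $ 0 = 0"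
    and "\<rho> \<ge> 0" "pser_norm N \<rho> X \<le> r" "pser_norm N \<rho> U \<le> r"
  shows "pser_norm N \<rho> (subst X U F) \<le> pser_norm (2 * N) r F"
proof -
  define T where "T = (\<Sum>i\<le>2*N. \<Sum>j\<le>2*N. cst (F $ j $ i) * (X ^ i * U ^ j))"
  have r: "r \<ge> 0" using assms pser_norm_nonneg[of \<rho> N X] by linarith
  have eq: "subst X U F $ l $ k = T $ l $ k" if "l \<le> N" "k \<le> N" for l k
    using subst_nth[OF XU, of l k "2 * N"] that by (simp add: T_def fps_sum_nth)
  have "pser_norm N \<rho> (subst X U F) = pser_norm N \<rho> T"
    unfolding pser_norm_alt using eq by (intro sum.cong refl) auto
  also have "\<dots> \<le> (\<Sum>i\<le>2*N. \<Sum>j\<le>2*N. pser_norm N \<rho> (cst (F $ j $ i) * (X ^ i * U ^ j)))"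
    unfolding T_def by (rule order_trans[OF pser_norm_sum]) (use assms in \<open>auto intro!: sum_mono pser_norm_sum\<close>)
  also have "\<dots> \<le> (\<Sum>i\<le>2*N. \<Sum>j\<le>2*N. norm (F $ j $ i) * (r ^ i * r ^ j))"
    unfolding pser_norm_cst_mult
  proof (intro sum_mono mult_left_mono)
    fix i j
    have "pser_norm N \<rho> (X ^ i * U ^ j) \<le> pser_norm N \<rho> (X ^ i) * pser_norm N \<rho> (U ^ j)"
      using assms by (intro pser_norm_mult)
    also have "\<dots> \<le> pser_norm N \<rho> X ^ i * pser_norm N \<rho> U ^ j"
      using assms by (intro mult_mono pser_norm_power pser_norm_nonneg zero_le_power) auto
    also have "\<dots> \<le> r ^ i * r ^ j"
      using assms r by (intro mult_mono power_mono pser_norm_nonneg zero_le_power) auto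
    finally show "pser_norm N \<rho> (X ^ i * U ^ j) \<le> r ^ i * r ^ j" .
  qed auto
  also have "\<dots> = pser_norm (2 * N) r F"
    unfolding pser_norm_alt by (subst sum.swap) (simp add: mult.assoc)
  finally show ?thesis .
qed

lemma convergent_fps2_subst:
  assumes "convergent_fps2 F" "convergent_fps2 X" "convergent_fps2 U"
    and XU: "X $ 0 $ 0 = 0" "U $ 0 $ 0 = 0"
  shows "convergent_fps2 (subst X U F)"
proof -
  obtain r B where r: "r > 0" and B: "\<And>N. pser_norm N r F \<le> B"
    using convergent_fps2_pser_norm[OF assms(1)] by blast
  obtain s1 where s1: "s1 > 0" "\<And>\<rho> N. 0 < \<rho> \<Longrightarrow> \<rho> \<le> s1 \<Longrightarrow> pser_norm N \<rho> X \<le> r"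
    using pser_norm_small[OF assms(2) XU(1) r] by blast
  obtain s2 where s2: "s2 > 0" "\<And>\<rho> N. 0 < \<rho> \<Longrightarrow> \<rho> \<le> s2 \<Longrightarrow> pser_norm N \<rho> U \<le> r"
    using pser_norm_small[OF assms(3) XU(2) r] by blast
  show ?thesis
  proof (rule convergent_fps2_pser_normI)
    show "min s1 s2 > 0" using s1 s2 by simp
    fix N
    show "pser_norm N (min s1 s2) (subst X U F) \<le> B"
      using s1 s2 by (intro order_trans[OF pser_norm_subst[OF XU] B]) auto
  qed
qed

lemma convergent_fps2_cst [simp]: "convergent_fps2 (cst c)" by (rule convergent_fps2_const)
lemma convergent_fps2_varx [simp]: "convergent_fps2 varx"
  by (rule convergent_fps2_pser_normI[of 1 _ 1]) (auto intro: pser_norm_varx)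
lemma convergent_fps2_power: "convergent_fps2 F \<Longrightarrow> convergent_fps2 (F ^ k)"
  by (induction k) (auto intro: convergent_fps2_mult convergent_fps2_1)

lemmas convergent_fps2_intros = convergent_fps2_0 convergent_fps2_1 convergent_fps2_X convergent_fps2_add
  convergent_fps2_diff convergent_fps2_mult convergent_fps2_uminus convergent_fps2_varx
  convergent_fps2_cst convergent_fps2_power

lemma convergent_fps2_dx: "convergent_fps2 F \<Longrightarrow> convergent_fps2 (dx F)"
  unfolding dx_def by (rule convergent_fps2_deriv)

text \<open>\<open>F / F(0,0) = 1 - H\<close> with \<open>H\<close> in the maximal ideal, so the
  inverse is the geometric series with \<open>H\<close> substituted, and convergence is inherited
  from \<open>convergent_fps2_subst\<close>.\<close>

lemma convergent_fps2_inverse: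
  assumes F: "convergent_fps2 F" "F $ 0 $ 0 \<noteq> 0"
  obtains G where "convergent_fps2 G" "F * G = 1"
proof -
  define c where "c = F $ 0 $ 0"
  define H where "H = 1 - cst (1 / c) * F"
  define geo :: pser where "geo = fps_const (Abs_fps (\<lambda>_. 1))"
  have c: "c \<noteq> 0" using F by (simp add: c_def)
  have H: "H $ 0 $ 0 = 0" "convergent_fps2 H"
    using F c by (auto simp: H_def c_def[symmetric] intro!: convergent_fps2_intros simp del: fps_const_mult_left)
  have "convergent_fps2 geo"
    by (rule convergent_fps2I[of 1 _ 1]) (auto simp: geo_def)
  hence G: "convergent_fps2 (subst H 0 geo)"
    using H by (intro convergent_fps2_subst) (auto intro: convergent_fps2_intros)
  have "(1 - fps_X) * Abs_fps (\<lambda>_. 1::complex) = 1"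
    by (rule fps_ext) (auto simp: algebra_simps)
  hence "(1 - varx) * geo = 1"
    unfolding geo_def by (metis fps_const_1_eq_1 fps_const_mult fps_const_sub)
  hence "subst H 0 (1 - varx) * subst H 0 geo = 1"
    using H subst_mult[of H 0 "1 - varx" geo] by simp
  hence "(1 - H) * subst H 0 geo = 1"
    using H by (simp add: subst_diff)
  hence "F * (cst (1 / c) * subst H 0 geo) = 1"
    by (simp add: H_def mult_ac del: fps_const_mult_left)
  thus ?thesis using G that by (blast intro: convergent_fps2_intros)
qed

section \<open>Convergent solutions of differential equations\<close>

text \<open>\<open>F(a(t), b(t))\<close>, only meaningful for \<open>a\<close>, \<open>b\<close> without constant term.\<close>
definition eval_at :: "complex fps \<Rightarrow> complex fps \<Rightarrow> pser \<Rightarrow> complex fps" where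
  "eval_at a b F = subst (fps_const a) (fps_const b) F $ 0"

lemma subst_fps_const: "subst (fps_const a) (fps_const b) F = fps_const (eval_at a b F)"
proof (rule fps_ext)
  fix l
  show "subst (fps_const a) (fps_const b) F $ l = fps_const (eval_at a b F) $ l"
    by (cases "l = 0") (auto simp: eval_at_def subst_def fps_eq_iff fps_const_power)
qed

lemma eval_at_nth: "a $ 0 = 0 \<Longrightarrow> b $ 0 = 0 \<Longrightarrow> k \<le> N \<Longrightarrow>
    eval_at a b F $ k = (\<Sum>i\<le>N. \<Sum>j\<le>N. F $ j $ i * (a ^ i * b ^ j) $ k)"
  unfolding eval_at_def by (subst subst_nth[of _ _ _ _ N]) (auto simp: fps_const_power)

context
  fixes a b :: "complex fps"
  assumes ab: "a $ 0 = 0" "b $ 0 = 0"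
begin

lemma eval_at_mult: "eval_at a b (F * G) = eval_at a b F * eval_at a b G"
  unfolding eval_at_def by (subst subst_mult) (auto simp: ab)

lemma eval_at_add: "eval_at a b (F + G) = eval_at a b F + eval_at a b G"
  by (simp add: eval_at_def subst_add)

lemma eval_at_diff: "eval_at a b (F - G) = eval_at a b F - eval_at a b G"
  by (simp add: eval_at_def subst_diff)

lemma eval_at_vary: "eval_at a b vary = b"
  using ab by (simp add: eval_at_def)

lemma eval_at_varx: "eval_at a b varx = a"
  using ab by (simp add: eval_at_def)

lemma eval_at_const: "eval_at a b (cst c) = fps_const c"
  using ab by (simp add: eval_at_def)

lemma eval_at_1: "eval_at a b 1 = 1"
  using ab by (simp add: eval_at_def)

lemma eval_at_power: "eval_at a b (F ^ k) = eval_at a b F ^ k"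
  by (induction k) (auto simp: eval_at_mult eval_at_1)

lemma eval_at_nth_0: "eval_at a b F $ 0 = F $ 0 $ 0"
  using ab by (simp add: eval_at_def)

lemma eval_at_subst:
  assumes "X $ 0 $ 0 = 0" "U $ 0 $ 0 = 0"
  shows "eval_at a b (subst X U F) = eval_at (eval_at a b X) (eval_at a b U) F"
proof -
  have "fps_const (eval_at a b (subst X U F)) = subst (fps_const (eval_at a b X)) (fps_const (eval_at a b U)) F"
    unfolding subst_fps_const[symmetric] using assms ab by (subst subst_subst) auto
  thus ?thesis by (simp add: subst_fps_const)
qed

lemma deriv_eval_at:
  "fps_deriv (eval_at a b F) = eval_at a b (dx F) * fps_deriv a + eval_at a b (dy F) * fps_deriv b"
proof -
  have "dx (fps_const (eval_at a b F)) = fps_const (eval_at a b (dx F) * fps_deriv a + eval_at a b (dy F) * fps_deriv b)"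
    unfolding subst_fps_const[symmetric] using ab
    by (subst dx_subst) (simp_all add: subst_fps_const)
  thus ?thesis by simp
qed

end

section \<open>Agreement up to a given order and fixed points\<close>

lemma fps_agree_mult:
  fixes f g f' g' :: "'a :: comm_ring_1 fps"
  assumes "\<And>i. i < k \<Longrightarrow> f $ i = f' $ i" "\<And>i. i < k \<Longrightarrow> g $ i = g' $ i" "i < k"
  shows "(f * g) $ i = (f' * g') $ i"
  unfolding fps_mult_nth using assms by (intro sum.cong) auto

lemma fps_agree_power:
  fixes f f' :: "'a :: comm_ring_1 fps"
  assumes "\<And>i. i < k \<Longrightarrow> f $ i = f' $ i" "i < k"
  shows "(f ^ n) $ i = (f' ^ n) $ i"
  using assms(2)
proof (induction n arbitrary: i)
  case (Suc n)
  show ?case unfolding power_Suc by (rule fps_agree_mult[of k]) (use Suc assms in auto)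
qed simp

lemma eval_at_agree:
  assumes "a $ 0 = 0" "b $ 0 = 0" "b' $ 0 = 0" "\<And>i. i < k \<Longrightarrow> b $ i = b' $ i" "i < k"
  shows "eval_at a b F $ i = eval_at a b' F $ i"
proof -
  have "(a ^ m * b ^ n) $ i = (a ^ m * b' ^ n) $ i" for m n
    by (rule fps_agree_mult[of k]) (use assms fps_agree_power[of k b b'] in auto)
  thus ?thesis using assms by (simp add: eval_at_nth[of _ _ i i])
qed

text \<open>A contraction for the adic topology: each application fixes one more coefficient.
  Coefficient \<open>n\<close> of the iterates starting at 0 is stable from iterate
  \<open>Suc n\<close> on, and the diagonal gives the fixed point.\<close>

lemma fps_fixpoint:
  fixes \<Theta> :: "'a :: zero fps \<Rightarrow> 'a fps"
  assumes 0: "\<And>w. \<Theta> w $ 0 = 0"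
    and contr: "\<And>w v k i. w $ 0 = 0 \<Longrightarrow> v $ 0 = 0 \<Longrightarrow> (\<And>i. i < k \<Longrightarrow> w $ i = v $ i) \<Longrightarrow> i \<le> k \<Longrightarrow> \<Theta> w $ i = \<Theta> v $ i"
  obtains w where "w $ 0 = 0" "\<Theta> w = w"
proof -
  define W where "W n = (\<Theta> ^^ n) 0" for n
  have W0: "W n $ 0 = 0" for n by (cases n) (auto simp: W_def 0)
  have WS: "W (Suc n) = \<Theta> (W n)" for n by (simp add: W_def)
  have step: "\<forall>i\<le>n. W (Suc n) $ i = W (Suc (Suc n)) $ i" for n
  proof (induction n)
    case 0 thus ?case by (simp add: W0)
  next
    case (Suc n)
    show ?case
    proof (intro allI impI)
      fix i assume "i \<le> Suc n"
      have "\<Theta> (W (Suc n)) $ i = \<Theta> (W (Suc (Suc n))) $ i"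
        by (rule contr[of _ _ "Suc n"]) (use Suc W0 \<open>i \<le> Suc n\<close> in auto)
      thus "W (Suc (Suc n)) $ i = W (Suc (Suc (Suc n))) $ i"
        by (simp only: WS[symmetric])
    qed
  qed
  have st: "W (Suc n + m) $ i = W (Suc n) $ i" if "i \<le> n" for n m i
  proof (induction m)
    case (Suc m)
    thus ?case using step[of "n + m"] that by auto
  qed simp
  define w where "w = Abs_fps (\<lambda>n. W (Suc n) $ n)"
  have w: "w $ i = W (Suc n) $ i" if "i \<le> n" for i n
    using st[of i i "n - i"] that by (simp add: w_def)
  show ?thesis
  proof
    show w0: "w $ 0 = 0" by (simp add: w_def W0)
    show "\<Theta> w = w"
    proof (rule fps_ext)
      fix n
      have "\<Theta> w $ n = \<Theta> (W (Suc n)) $ n"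
        by (rule contr[of _ _ "Suc n"]) (use w0 W0 w[of _ n] in auto)
      thus "\<Theta> w $ n = w $ n" using w[of n "Suc n"] by (simp add: WS)
    qed
  qed
qed

abbreviation convergent_fps :: "complex fps \<Rightarrow> bool" where
  "convergent_fps u \<equiv> convergent_fps2 (fps_const u)"

text \<open>
  Convergence by majorants: with \<open>q = Q(0,0)\<close>, the equation reads \<open>q w' = - (P(t,w) + (Q(t,w) - q) w')\<close>,
  and for small radii the norm of \<open>Q(t,w) - q\<close> is at most \<open>|q| / 2\<close>, so that \<open>w'\<close> can be absorbed.
\<close>
theorem ode_solution:
  assumes P: "convergent_fps2 P" and Q: "convergent_fps2 Q" and q0: "Q $ 0 $ 0 \<noteq> 0"
  obtains w where "w $ 0 = 0" "convergent_fps w" "eval_at fps_X w P + eval_at fps_X w Q * fps_deriv w = 0"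
proof -
  define q where "q = Q $ 0 $ 0"
  define Q' where "Q' = Q - cst q"
  define rhs where "rhs w = eval_at fps_X w P + eval_at fps_X w Q' * fps_deriv w" for w
  define \<Theta> where "\<Theta> w = fps_integral0 (fps_const (- 1 / q) * rhs w)" for w
  have Q'0: "Q' $ 0 $ 0 = 0" by (simp add: Q'_def q_def)
  have q: "q \<noteq> 0" using q0 by (simp add: q_def)
  have agree: "rhs w $ i = rhs v $ i"
    if wv: "w $ 0 = 0" "v $ 0 = 0" "\<And>i. i < k \<Longrightarrow> w $ i = v $ i" "i < k" for w v k i
  proof -
    have 1: "eval_at fps_X w F $ i = eval_at fps_X v F $ i" if "i < k" for F i
      by (rule eval_at_agree[of _ _ _ k]) (use wv that in auto)
    have "(eval_at fps_X w Q' * fps_deriv w) $ i = (\<Sum>a=0..i. eval_at fps_X w Q' $ a * fps_deriv w $ (i - a))"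
      by (simp add: fps_mult_nth)
    also have "\<dots> = (\<Sum>a=0..i. eval_at fps_X v Q' $ a * fps_deriv v $ (i - a))"
    proof (intro sum.cong refl)
      fix a assume a: "a \<in> {0..i}"
      show "eval_at fps_X w Q' $ a * fps_deriv w $ (i - a) = eval_at fps_X v Q' $ a * fps_deriv v $ (i - a)"
      \<comment> \<open>For \<open>a = 0\<close> the factor \<open>w'\<close> involves coefficient
        \<open>i + 1\<close> of \<open>w\<close>, on which \<open>w\<close> and \<open>v\<close> may
        differ; it is multiplied by \<open>Q'(0,0) = 0\<close>.\<close>
      proof (cases "a = 0")
        case True thus ?thesis using Q'0 wv by (simp add: eval_at_nth_0)
      next
        case False
        thus ?thesis using 1[of a Q'] wv(3)[of "i - a + 1"] wv(4) a by auto
      qed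
    qed
    also have "\<dots> = (eval_at fps_X v Q' * fps_deriv v) $ i"
      by (simp add: fps_mult_nth)
    finally show ?thesis using 1[of i P] wv(4) by (simp add: rhs_def)
  qed
  obtain w where w0: "w $ 0 = 0" and fix_w: "\<Theta> w = w"
  proof (rule fps_fixpoint[of \<Theta>])
    show "\<Theta> w $ 0 = 0" for w by (simp add: \<Theta>_def fps_integral_def)
    show "\<Theta> w $ i = \<Theta> v $ i" if "w $ 0 = 0" "v $ 0 = 0" "\<And>i. i < k \<Longrightarrow> w $ i = v $ i" "i \<le> k" for w v k i
      using agree[of w v k "i - 1"] that by (cases "i = 0") (auto simp: \<Theta>_def fps_integral_def)
  qed blast
  have "fps_deriv w = fps_const (- 1 / q) * rhs w"
    by (subst fix_w[symmetric]) (simp add: \<Theta>_def fps_deriv_fps_integral)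
  hence "fps_const q * fps_deriv w = fps_const (q * (- 1 / q)) * rhs w"
    by (simp add: mult.assoc[symmetric])
  hence eq: "fps_const q * fps_deriv w = - rhs w" using q by (simp add: fps_const_neg[symmetric] del: fps_const_neg)
  have "eval_at fps_X w Q = eval_at fps_X w Q' + fps_const q"
    using w0 by (simp add: Q'_def eval_at_diff eval_at_const)
  hence ode: "eval_at fps_X w P + eval_at fps_X w Q * fps_deriv w = 0"
    using eq by (simp add: rhs_def algebra_simps)

  obtain r1 B where r1: "r1 > 0" and B: "\<And>N. pser_norm N r1 P \<le> B"
    using convergent_fps2_pser_norm[OF P] by blast
  have "convergent_fps2 Q'" using Q by (simp add: Q'_def convergent_fps2_intros)
  moreover have "norm q / 2 > 0" using q by simp
  ultimately obtain r2 where r2: "r2 > 0" "\<And>\<rho> N. 0 < \<rho> \<Longrightarrow> \<rho> \<le> r2 \<Longrightarrow> pser_norm N \<rho> Q' \<le> norm q / 2"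
    using pser_norm_small[OF _ Q'0] by metis
  define r where "r = min r1 r2"
  have r: "r > 0" "\<And>N. pser_norm N r P \<le> B" "\<And>N. pser_norm N r Q' \<le> norm q / 2"
    using r1 r2 order_trans[OF pser_norm_mono[of r r1 _ P] B] by (auto simp: r_def)
  have B0: "B \<ge> 0" using r(2)[of 0] pser_norm_nonneg[of r 0 P] r(1) by linarith
  \<comment> \<open>The estimate below bounds the norm \<open>D\<close> of \<open>w'\<close> by
    \<open>2 * B / norm q\<close>; this radius turns it into \<open>\<rho> * D \<le> r\<close>. The
    summand 1 avoids a zero denominator.\<close>
  define \<rho> where "\<rho> = min r (r * norm q / (2 * B + 1))"
  have \<rho>: "\<rho> > 0" "\<rho> \<le> r" using r q B0 by (auto simp: \<rho>_def)
  have "\<rho> \<le> r * norm q / (2 * B + 1)" by (simp add: \<rho>_def)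
  hence "\<rho> * (2 * B + 1) \<le> r * norm q" using B0 by (simp add: pos_le_divide_eq)
  hence \<rho>B: "\<rho> * (2 * B) \<le> r * norm q" using \<rho> by (simp add: algebra_simps)
  \<comment> \<open>Bootstrapping on the truncation: a bound for \<open>w\<close> up to
    \<open>N\<close> bounds the right-hand side, hence \<open>w'\<close>, up to \<open>N\<close>,
    and integration gives \<open>w\<close> up to \<open>Suc N\<close> with the same bound
    \<open>r\<close>.\<close>
  have wN: "fps_norm N \<rho> w \<le> r" for N
  proof (induction N)
    case 0 thus ?case using w0 r by (simp add: fps_norm_def)
  next
    case (Suc N)
    define D where "D = fps_norm N \<rho> (fps_deriv w)"
    have D0: "D \<ge> 0" using \<rho> by (simp add: D_def fps_norm_nonneg)
    have ev: "fps_norm N \<rho> (eval_at fps_X w F) \<le> pser_norm (2 * N) r F" for F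
      unfolding pser_norm_fps_const[symmetric] subst_fps_const[symmetric]
      by (rule pser_norm_subst) (use w0 \<rho> Suc pser_norm_varx[of \<rho> N] in \<open>auto simp: pser_norm_fps_const\<close>)
    have "norm q * D = fps_norm N \<rho> (rhs w)"
      using arg_cong[OF eq, of "fps_norm N \<rho>"] by (simp add: D_def fps_norm_const_mult)
    also have "\<dots> \<le> fps_norm N \<rho> (eval_at fps_X w P) + fps_norm N \<rho> (eval_at fps_X w Q' * fps_deriv w)"
      unfolding rhs_def using \<rho> by (intro fps_norm_add) auto
    also have "fps_norm N \<rho> (eval_at fps_X w Q' * fps_deriv w) \<le> fps_norm N \<rho> (eval_at fps_X w Q') * D"
      unfolding D_def using \<rho> by (intro fps_norm_mult) auto
    also have "fps_norm N \<rho> (eval_at fps_X w Q') * D \<le> norm q / 2 * D"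
      using D0 ev[of Q'] r(3)[of "2 * N"] by (intro mult_right_mono) auto
    also have "fps_norm N \<rho> (eval_at fps_X w P) \<le> B"
      using ev[of P] r(2)[of "2 * N"] by linarith
    finally have "norm q * D \<le> 2 * B" by simp
    hence "\<rho> * (norm q * D) \<le> \<rho> * (2 * B)" using \<rho> by (intro mult_left_mono) auto
    with \<rho>B have "norm q * (\<rho> * D) \<le> norm q * r" by (simp add: mult_ac)
    hence D: "\<rho> * D \<le> r" using q by simp
    have "fps_norm (Suc N) \<rho> w = (\<Sum>i\<le>N. norm (w $ Suc i) * \<rho> ^ Suc i)"
      unfolding fps_norm_def by (subst sum.atMost_Suc_shift) (simp add: w0)
    also have "\<dots> \<le> \<rho> * D"
      unfolding D_def fps_norm_def sum_distrib_left
    proof (rule sum_mono)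
      fix i
      have "1 * norm (w $ Suc i) \<le> real (Suc i) * norm (w $ Suc i)" by (intro mult_right_mono) auto
      also have "\<dots> = norm (fps_deriv w $ i)"
        by (simp only: fps_deriv_nth norm_mult norm_of_nat Suc_eq_plus1)
      finally have "norm (w $ Suc i) * (\<rho> * \<rho> ^ i) \<le> norm (fps_deriv w $ i) * (\<rho> * \<rho> ^ i)"
        using \<rho> by (intro mult_right_mono) auto
      thus "norm (w $ Suc i) * \<rho> ^ Suc i \<le> \<rho> * (norm (fps_deriv w $ i) * \<rho> ^ i)"
        by (simp add: mult_ac)
    qed
    finally show ?case using D by linarith
  qed
  have "convergent_fps w"
    by (rule convergent_fps2_pser_normI[of \<rho> _ r]) (use \<rho> wN in \<open>auto simp: pser_norm_fps_const\<close>)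
  thus ?thesis using that w0 ode by blast
qed

text \<open>The differentiated equation \<open>F_x + F_y w' = 0\<close> is solvable since
  \<open>F_y(0,0)\<close> is nonzero; along its solution \<open>F\<close> is constant, equal to
  \<open>F(0,0) = 0\<close>.\<close>

corollary implicit_function:
  assumes F: "convergent_fps2 F" "F $ 0 $ 0 = 0" "F $ 1 $ 0 \<noteq> 0"
  obtains w where "w $ 0 = 0" "convergent_fps w" "eval_at fps_X w F = 0"
proof -
  obtain w where w: "w $ 0 = 0" "convergent_fps w"
      "eval_at fps_X w (dx F) + eval_at fps_X w (dy F) * fps_deriv w = 0"
    using ode_solution[of "dx F" "dy F"] F by (auto intro: convergent_fps2_dx convergent_fps2_deriv)
  have "fps_deriv (eval_at fps_X w F) = 0"
    using w by (simp add: deriv_eval_at)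
  moreover have "eval_at fps_X w F $ 0 = 0" using F w by (simp add: eval_at_nth_0)
  ultimately have "eval_at fps_X w F = 0"
    by (metis fps_deriv_eq_0_iff fps_const_0_eq_0)
  thus ?thesis using w that by blast
qed

section \<open>Blow-ups and ramification\<close>

text \<open>The restriction \<open>F(0, y)\<close>. When it is nonzero, its \<open>subdegree\<close>
  counts the Puiseux roots of \<open>F\<close>, and serves as induction measure where one would
  otherwise use the Weierstrass degree.\<close>

definition at_x0 :: "pser \<Rightarrow> complex fps" where "at_x0 F = Abs_fps (\<lambda>j. F $ j $ 0)"

lemma at_x0_nth [simp]: "at_x0 F $ j = F $ j $ 0" by (simp add: at_x0_def)
lemma at_x0_mult: "at_x0 (F * G) = at_x0 F * at_x0 G"
  by (rule fps_ext, simp only: at_x0_nth pser_mult_nth) (simp add: fps_mult_nth atLeast0AtMost)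
lemma at_x0_1 [simp]: "at_x0 1 = 1" by (rule fps_ext) simp
lemma at_x0_power: "at_x0 (F ^ k) = at_x0 F ^ k"
  by (induction k) (auto simp: at_x0_mult)
lemma at_x0_vary [simp]: "at_x0 vary = fps_X" by (rule fps_ext) (simp add: fps_X_def)
lemma at_x0_fps_const [simp]: "at_x0 (fps_const u) = fps_const (u $ 0)"
  by (rule fps_ext) simp
lemma at_x0_add: "at_x0 (F + G) = at_x0 F + at_x0 G" by (rule fps_ext) simp
lemma at_x0_diff: "at_x0 (F - G) = at_x0 F - at_x0 G" by (rule fps_ext) simp

lemma sum_sum_delta:
  fixes a b N :: nat
  assumes "a \<le> N" "b \<le> N"
  shows "(\<Sum>i\<le>N. \<Sum>j\<le>N. if i = a \<and> j = b then f i j else 0) = f a b"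
proof -
  have "(\<Sum>i\<le>N. \<Sum>j\<le>N. if i = a \<and> j = b then f i j else 0) =
      (\<Sum>i\<le>N. if i = a then (\<Sum>j\<le>N. if j = b then f i j else 0) else 0)"
    by (intro sum.cong refl) auto
  thus ?thesis using assms by simp
qed

lemma mult_if_1_0: "x * (if P then 1 else 0) = (if P then x else (0 :: 'a :: semiring_1))"
  by simp

lemma at_x0_subst:
  assumes X: "at_x0 X = 0" and U: "at_x0 U = fps_X"
  shows "at_x0 (subst X U F) = at_x0 F"
proof (rule fps_ext)
  fix l
  have 0: "X $ 0 $ 0 = 0" "U $ 0 $ 0 = 0" using assms by (metis at_x0_nth fps_zero_nth, metis at_x0_nth fps_X_nth zero_neq_one)
  have "(X ^ i * U ^ j) $ l $ 0 = (if i = 0 \<and> j = l then 1 else 0)" for i j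
  proof -
    have "(X ^ i * U ^ j) $ l $ 0 = at_x0 (X ^ i * U ^ j) $ l" by simp
    also have "\<dots> = (0 ^ i * fps_X ^ j) $ l" by (simp only: at_x0_mult at_x0_power X U)
    also have "\<dots> = (if i = 0 \<and> j = l then 1 else 0)" by (cases i) auto
    finally show ?thesis .
  qed
  hence "at_x0 (subst X U F) $ l = (\<Sum>i\<le>l. \<Sum>j\<le>l. F $ j $ i * (if i = 0 \<and> j = l then 1 else 0))"
    by (simp add: subst_nth[OF 0, of l 0 l])
  also have "\<dots> = F $ l $ 0" unfolding mult_if_1_0 by (rule sum_sum_delta) auto
  finally show "at_x0 (subst X U F) $ l = at_x0 F $ l" by simp
qed

lemma varx_power: "varx ^ k = fps_const (fps_X ^ k)"
  by (simp add: fps_const_power)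

lemma varx_power_mult_nth: "(varx ^ e * F) $ j $ i = (if i < e then 0 else F $ j $ (i - e))"
  unfolding varx_power by (simp add: fps_X_power_mult_nth)

definition xshift :: "nat \<Rightarrow> pser \<Rightarrow> pser" where
  "xshift e F = Abs_fps (\<lambda>j. fps_shift e (F $ j))"

lemma xshift_nth [simp]: "xshift e F $ j $ i = F $ j $ (i + e)"
  by (simp add: xshift_def)

lemma xshift_eq:
  assumes "\<And>j i. i < e \<Longrightarrow> F $ j $ i = 0"
  shows "F = varx ^ e * xshift e F"
proof (intro fps_ext)
  show "F $ j $ i = (varx ^ e * xshift e F) $ j $ i" for j i
    unfolding varx_power_mult_nth using assms by auto
qed

lemma convergent_fps2_xshift:
  assumes "convergent_fps2 F" shows "convergent_fps2 (xshift e F)"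
proof -
  obtain M R where F: "M \<ge> 0" "R \<ge> 1" "\<And>i j. norm (F $ j $ i) \<le> M * R ^ (i + j)"
    using convergent_fps2D[OF assms] by blast
  show ?thesis
  proof (rule convergent_fps2I[of R _ "M * R ^ e"])
    fix i j
    show "norm (xshift e F $ j $ i) \<le> M * R ^ e * R ^ (i + j)"
      using F(3)[of j "i + e"] by (simp add: power_add mult_ac)
  qed (use F in auto)
qed

lemma fps_shift_vary_eq:
  fixes F :: pser
  assumes "F $ 0 = 0" shows "F = vary * fps_shift 1 F"
  by (rule fps_ext) (use assms in simp)

lemma convergent_fps2_shift:
  assumes "convergent_fps2 F" shows "convergent_fps2 (fps_shift e F)"
proof -
  obtain M R where F: "M \<ge> 0" "R \<ge> 1" "\<And>i j. norm (F $ j $ i) \<le> M * R ^ (i + j)"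
    using convergent_fps2D[OF assms] by blast
  show ?thesis
  proof (rule convergent_fps2I[of R _ "M * R ^ e"])
    fix i j
    show "norm (fps_shift e F $ j $ i) \<le> M * R ^ e * R ^ (i + j)"
      using F(3)[of "j + e" i] by (simp add: power_add mult_ac)
  qed (use F in auto)
qed

lemma vary_cst_power_nth: "(vary + cst c) ^ j $ l = fps_const (coeff ([:c, 1:] ^ j) l)"
proof (induction j arbitrary: l)
  case 0 thus ?case by (cases l) auto
next
  case (Suc j)
  have "(vary + cst c) ^ Suc j $ l = (vary * (vary + cst c) ^ j) $ l + (cst c * (vary + cst c) ^ j) $ l"
    by (simp add: algebra_simps)
  also have "\<dots> = fps_const (coeff ([:c, 1:] ^ Suc j) l)"
    using Suc by (cases l) (auto simp: fps_const_mult simp flip: fps_const_add)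
  finally show ?case .
qed

text \<open>
  The part of \<open>F\<close> of weighted degree \<open>k\<close>, where \<open>x\<close> has weight 1 and \<open>y\<close> weight \<open>s\<close>,
  dehomogenised by \<open>x = 1\<close>.
\<close>
definition weighted_part :: "nat \<Rightarrow> nat \<Rightarrow> pser \<Rightarrow> complex poly" where
  "weighted_part s k F = (\<Sum>j\<le>k. monom (if s * j \<le> k then F $ j $ (k - s * j) else 0) j)"

lemma coeff_weighted_part:
  assumes "s \<ge> 1"
  shows "coeff (weighted_part s k F) j = (if s * j \<le> k then F $ j $ (k - s * j) else 0)"
proof -
  have "coeff (weighted_part s k F) j = (\<Sum>i\<le>k. if i = j then (if s * i \<le> k then F $ i $ (k - s * i) else 0) else 0)"
    unfolding weighted_part_def coeff_sum by (intro sum.cong) (auto simp: coeff_monom)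
  moreover have "j \<le> k" if "s * j \<le> k"
  proof -
    have "j \<le> s * j" using assms by simp
    thus ?thesis using that by linarith
  qed
  ultimately show ?thesis by (auto simp: sum.delta)
qed

lemma degree_weighted_part_le: "degree (weighted_part s k F) \<le> k"
  unfolding weighted_part_def by (rule degree_sum_le) (auto intro: order_trans[OF degree_monom_le])

lemma pcompose_monom: "pcompose (monom a j) q = smult a (q ^ j)"
  for q :: "'a :: comm_ring_1 poly"
  by (induction j) (auto simp: monom_0 monom_Suc pcompose_pCons mult_ac)

text \<open>Under \<open>y = x^s (y' + c)\<close> the monomial \<open>x^i y^j\<close> becomes
  \<open>x^(i + s j) (y' + c)^j\<close>, so the coefficient of \<open>x^k\<close> collects exactly
  the part of weighted degree \<open>k\<close>. Each such coefficient is a polynomial in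
  \<open>y'\<close>, and its roots govern the blow-up.\<close>

lemma subst_blowup_nth:
  assumes s: "s \<ge> 1"
  shows "subst varx (varx ^ s * (vary + cst c)) F $ l $ k = coeff (pcompose (weighted_part s k F) [:c, 1:]) l"
proof -
  define U where "U = varx ^ s * (vary + cst c)"
  define N where "N = l + k"
  have U0: "U $ 0 $ 0 = 0" using s by (simp add: U_def varx_power_mult_nth)
  have *: "(varx ^ i * U ^ j) $ l $ k = (if i = k - s * j \<and> s * j \<le> k then coeff ([:c, 1:] ^ j) l else 0)" for i j
  proof -
    have "varx ^ i * U ^ j = varx ^ (i + s * j) * (vary + cst c) ^ j"
    proof -
      have "x ^ i * (x ^ s * z) ^ j = x ^ (i + s * j) * z ^ j" for x z :: pser
        by (simp add: power_add power_mult_distrib power_mult[symmetric] mult_ac)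
      thus ?thesis unfolding U_def .
    qed
    hence "(varx ^ i * U ^ j) $ l $ k = (if k < i + s * j then 0 else fps_const (coeff ([:c, 1:] ^ j) l) $ (k - (i + s * j)))"
      by (simp only: varx_power_mult_nth vary_cst_power_nth)
    thus ?thesis by auto
  qed
  have "subst varx U F $ l $ k = (\<Sum>j\<le>N. \<Sum>i\<le>N. F $ j $ i * (varx ^ i * U ^ j) $ l $ k)"
    by (subst subst_nth[of _ _ _ _ N]) (auto simp: U0 N_def intro: sum.swap)
  also have "\<dots> = (\<Sum>j\<le>N. if s * j \<le> k then F $ j $ (k - s * j) * coeff ([:c, 1:] ^ j) l else 0)"
  proof (rule sum.cong[OF refl])
    fix j
    have "(\<Sum>i\<le>N. F $ j $ i * (varx ^ i * U ^ j) $ l $ k) =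
       (\<Sum>i\<le>N. if i = k - s * j then (if s * j \<le> k then F $ j $ i * coeff ([:c, 1:] ^ j) l else 0) else 0)"
      unfolding * by (intro sum.cong) auto
    thus "(\<Sum>i\<le>N. F $ j $ i * (varx ^ i * U ^ j) $ l $ k) =
      (if s * j \<le> k then F $ j $ (k - s * j) * coeff ([:c, 1:] ^ j) l else 0)"
      by (auto simp: N_def)
  qed
  also have "\<dots> = (\<Sum>j\<le>k. if s * j \<le> k then F $ j $ (k - s * j) * coeff ([:c, 1:] ^ j) l else 0)"
  proof (rule sum.mono_neutral_right)
    show "\<forall>i\<in>{..N} - {..k}. (if s * i \<le> k then F $ i $ (k - s * i) * coeff ([:c, 1:] ^ i) l else 0) = 0"
    proof
      fix i assume "i \<in> {..N} - {..k}"
      hence "k < i" by simp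
      also have "i \<le> s * i" using s by simp
      finally show "(if s * i \<le> k then F $ i $ (k - s * i) * coeff ([:c, 1:] ^ i) l else 0) = 0" by simp
    qed
  qed (auto simp: N_def)
  also have "\<dots> = coeff (pcompose (weighted_part s k F) [:c, 1:]) l"
    unfolding weighted_part_def pcompose_sum coeff_sum pcompose_monom by (intro sum.cong) auto
  finally show ?thesis by (simp add: U_def)
qed

lemma subst_ramify_nth:
  assumes m: "m \<ge> 1"
  shows "subst (varx ^ m) vary F $ l $ k = (if m dvd k then F $ l $ (k div m) else 0)"
proof -
  define N where "N = l + k"
  have 0: "(varx ^ m) $ 0 $ 0 = 0" "vary $ 0 $ 0 = (0::complex)" using m by (auto simp: varx_power)
  have *: "((varx ^ m) ^ i * vary ^ j) $ l $ k = (if i = k div m \<and> m dvd k \<and> j = l then 1 else 0)" for i j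
  proof -
    have "((varx ^ m) ^ i * vary ^ j) $ l $ k = (if k < m * i then 0 else (vary ^ j :: pser) $ l $ (k - m * i))"
      by (simp only: power_mult[symmetric] varx_power_mult_nth)
    also have "\<dots> = (if k = m * i \<and> j = l then 1 else 0)" by (auto simp: fps_X_power_nth)
    also have "k = m * i \<longleftrightarrow> i = k div m \<and> m dvd k" using m by auto
    finally show ?thesis by simp
  qed
  have "subst (varx ^ m) vary F $ l $ k = (\<Sum>i\<le>N. \<Sum>j\<le>N. F $ j $ i * ((varx ^ m) ^ i * vary ^ j) $ l $ k)"
    by (rule subst_nth[OF 0]) (simp add: N_def)
  also have "\<dots> = (\<Sum>i\<le>N. \<Sum>j\<le>N. if i = k div m \<and> j = l then (if m dvd k then F $ j $ i else 0) else 0)"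
    unfolding * by (intro sum.cong refl) auto
  also have "\<dots> = (if m dvd k then F $ l $ (k div m) else 0)"
    using div_le_dividend[of k m] by (intro sum_sum_delta) (auto simp: N_def intro: trans_le_add2)
  finally show ?thesis .
qed

section \<open>Substitution into series in \<open>x\<close> alone, and translations in
  \<open>y\<close>\<close>

lemma subst_fps_const_left:
  assumes "a $ 0 = 0" "U $ 0 $ 0 = 0"
  shows "subst (fps_const a) U (fps_const v) = fps_const (v oo a)"
proof (intro fps_ext)
  fix l k
  have *: "(\<Sum>j\<le>l+k. fps_const v $ j $ i * (fps_const a ^ i * U ^ j) $ l $ k) = v $ i * (fps_const a ^ i) $ l $ k" for i
  proof -
    have "(\<Sum>j\<le>l+k. fps_const v $ j $ i * (fps_const a ^ i * U ^ j) $ l $ k) =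
      (\<Sum>j\<le>l+k. if j = 0 then v $ i * (fps_const a ^ i) $ l $ k else 0)"
      by (intro sum.cong) auto
    thus ?thesis by simp
  qed
  have "subst (fps_const a) U (fps_const v) $ l $ k = (\<Sum>i\<le>l+k. v $ i * (fps_const a ^ i) $ l $ k)"
    unfolding subst_def using * by simp
  also have "\<dots> = fps_const (v oo a) $ l $ k"
    by (cases "l = 0") (auto simp: fps_const_power fps_compose_nth atLeast0AtMost)
  finally show "subst (fps_const a) U (fps_const v) $ l $ k = fps_const (v oo a) $ l $ k" .
qed

lemma convergent_fps_compose:
  "convergent_fps v \<Longrightarrow> convergent_fps a \<Longrightarrow> a $ 0 = 0 \<Longrightarrow> convergent_fps (v oo a)"
  using convergent_fps2_subst[of "fps_const v" "fps_const a" 0]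
  by (simp add: subst_fps_const_left convergent_fps2_0)

lemma eval_at_fps_const: "a $ 0 = 0 \<Longrightarrow> b $ 0 = 0 \<Longrightarrow> eval_at a b (fps_const v) = v oo a"
  unfolding eval_at_def by (subst subst_fps_const_left) auto

lemma eval_at_varx_power: "a $ 0 = 0 \<Longrightarrow> b $ 0 = 0 \<Longrightarrow> eval_at a b (varx ^ k) = a ^ k"
  by (simp add: eval_at_power eval_at_varx del: fps_const_power)

lemma eval_at_X_0: "eval_at fps_X 0 F = F $ 0"
proof (rule fps_ext)
  fix k
  have "eval_at fps_X 0 F $ k = (\<Sum>i\<le>k. \<Sum>j\<le>k. F $ j $ i * (fps_X ^ i * 0 ^ j) $ k)"
    by (rule eval_at_nth) auto
  also have "\<dots> = (\<Sum>i\<le>k. \<Sum>j\<le>k. if i = k \<and> j = 0 then F $ j $ i else 0)"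
    by (intro sum.cong refl) (auto simp: fps_X_power_nth power_0_left)
  also have "\<dots> = F $ 0 $ k" by (rule sum_sum_delta) auto
  finally show "eval_at fps_X 0 F $ k = F $ 0 $ k" .
qed

text \<open>Together with \<open>subst_translate_nth_0\<close> this is Taylor's formula: up to
  \<open>fact k\<close>, the coefficient of \<open>y^k\<close> in \<open>F(x, y + v)\<close> is the
  \<open>k\<close>-th \<open>y\<close>-derivative of \<open>F\<close> along
  \<open>y = v\<close>.\<close>

lemma fps_nth_deriv_subst_translate:
  assumes "v $ 0 = 0"
  shows "fps_nth_deriv k (subst varx (vary + fps_const v) F) = subst varx (vary + fps_const v) (fps_nth_deriv k F)"
proof (induction k arbitrary: F)
  case (Suc k)
  have "dy (subst varx (vary + fps_const v) F) = subst varx (vary + fps_const v) (dy F)"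
    by (subst dy_subst) (use assms in auto)
  thus ?case using Suc by simp
qed simp

lemma subst_translate_nth_0:
  assumes "v $ 0 = 0"
  shows "subst varx (vary + fps_const v) F $ 0 = eval_at fps_X v F"
proof -
  have "subst varx (vary + fps_const v) F $ 0 = eval_at fps_X 0 (subst varx (vary + fps_const v) F)"
    by (simp add: eval_at_X_0)
  also have "\<dots> = eval_at fps_X v F"
    using assms by (subst eval_at_subst) (auto simp: eval_at_varx eval_at_add eval_at_vary eval_at_fps_const)
  finally show ?thesis .
qed

lemma fps_nth_deriv_nth_0: "fps_nth_deriv k F $ 0 = of_nat (fact k) * F $ k"
  for F :: "'a :: comm_ring_1 fps"
proof (induction k arbitrary: F)
  case (Suc k)
  thus ?case by (simp add: algebra_simps)
qed simp

lemma convergent_fps2_nth_deriv: "convergent_fps2 F \<Longrightarrow> convergent_fps2 (fps_nth_deriv k F)"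
  by (induction k arbitrary: F) (auto intro: convergent_fps2_deriv)

section \<open>Newton--Puiseux\<close>

text \<open>The translation by \<open>c\<close> turns the factor \<open>(y - c)^k\<close> into
  \<open>y^k\<close> and leaves a cofactor that does not vanish at 0.\<close>

lemma subdegree_fps_of_poly_pcompose:
  fixes \<phi> :: "complex poly"
  assumes "\<phi> \<noteq> 0"
  shows "subdegree (fps_of_poly (pcompose \<phi> [:c, 1:])) = order c \<phi>" (is ?A)
    and "fps_of_poly (pcompose \<phi> [:c, 1:]) \<noteq> 0" (is ?B)
proof -
  obtain q where q: "\<phi> = [:- c, 1:] ^ order c \<phi> * q" "\<not> [:- c, 1:] dvd q"
    using order_decomp[OF assms] by blast
  have pw: "pcompose ([:- c, 1:] ^ k) [:c, 1:] = [:0, 1:] ^ k" for k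
  proof (induction k)
    case (Suc k)
    have "pcompose [:- c, 1:] [:c, 1:] = [:0, 1:]" by (simp add: pcompose_pCons)
    thus ?case by (simp only: power_Suc pcompose_mult Suc)
  qed (simp add: pcompose_1)
  have "pcompose \<phi> [:c, 1:] = [:0, 1:] ^ order c \<phi> * pcompose q [:c, 1:]"
    by (subst q(1)) (simp add: pcompose_mult pw)
  hence eq: "fps_of_poly (pcompose \<phi> [:c, 1:]) = fps_X ^ order c \<phi> * fps_of_poly (pcompose q [:c, 1:])"
    by (simp add: fps_of_poly_mult fps_of_poly_power)
  have "poly q c \<noteq> 0" using q(2) by (simp add: poly_eq_0_iff_dvd)
  hence n0: "fps_of_poly (pcompose q [:c, 1:]) $ 0 \<noteq> 0"
    by (simp add: poly_pcompose flip: poly_0_coeff_0)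
  hence nz: "fps_of_poly (pcompose q [:c, 1:]) \<noteq> 0" by force
  show ?A unfolding eq using nz n0 by (simp add: subdegree_mult)
  show ?B unfolding eq using nz by simp
qed

text \<open>A root of order \<open>d\<close> would force \<open>\<phi> = a (y - c)^d\<close>. The
  coefficient \<open>- d a c\<close> of \<open>y^(d - 1)\<close> vanishes only for
  \<open>c = 0\<close>, and then \<open>\<phi>\<close> is a monomial, against the nonzero
  coefficient at \<open>j < d\<close>.\<close>

lemma exists_root_order_less_degree:
  fixes \<phi> :: "complex poly"
  assumes deg: "degree \<phi> = d" "d \<ge> 2" and "coeff \<phi> (d - 1) = 0" and j: "j < d" "coeff \<phi> j \<noteq> 0"
  obtains c where "poly \<phi> c = 0" "order c \<phi> < d"
proof -
  have nz: "\<phi> \<noteq> 0" using j by auto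
  obtain c where c: "poly \<phi> c = 0"
    using fundamental_theorem_of_algebra[of \<phi>] deg by (auto simp: constant_degree)
  have "order c \<phi> \<noteq> d"
  proof
    assume o: "order c \<phi> = d"
    obtain q where q: "\<phi> = [:- c, 1:] ^ d * q" using order_decomp[OF nz, of c] o by blast
    have "q \<noteq> 0" using q nz by auto
    hence "degree q = 0" using deg q by (simp add: degree_mult_eq degree_power_eq)
    then obtain a where a: "q = [:a:]" by (meson degree_eq_zeroE)
    have \<phi>: "\<phi> = smult a ([:- c, 1:] ^ d)" using q a by simp
    have "a \<noteq> 0" using \<open>q \<noteq> 0\<close> a by simp
    have "coeff ([:- c, 1:] ^ d) (d - 1) = of_nat d * (- c)"
    proof -
      obtain d' where "d = Suc d'" using deg by (cases d) auto
      thus ?thesis by (simp add: coeff_linear_poly_power del: power_Suc)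
    qed
    hence "c = 0" using assms(3) \<open>a \<noteq> 0\<close> deg unfolding \<phi> by auto
    hence "\<phi> = monom a d" unfolding \<phi> by (simp add: monom_altdef)
    thus False using j by simp
  qed
  moreover have "order c \<phi> \<le> d" using order_degree[OF nz] deg by simp
  ultimately show ?thesis using c that by auto
qed

lemma varx_nth_00: "varx $ 0 $ 0 = 0" and vary_nth_00: "vary $ 0 $ 0 = 0"
  by simp_all

text \<open>
  Induction on the order \<open>d\<close> of \<open>F(0, y)\<close>. A translation kills the coefficient of \<open>y\<^bsup>d - 1\<^esup>\<close>, so that
  the polynomial on the first edge of the Newton polygon is not the \<open>d\<close>-th power of a linear
  factor; ramifying and blowing up along one of its roots lowers \<open>d\<close>.
\<close>
theorem newton_puiseux:
  assumes "convergent_fps2 F" "at_x0 F \<noteq> 0" "F $ 0 $ 0 = 0"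
  shows "\<exists>m u. m \<ge> 1 \<and> u $ 0 = 0 \<and> convergent_fps u \<and> eval_at (fps_X ^ m) u F = 0"
  using assms
proof (induction "subdegree (at_x0 F)" arbitrary: F rule: less_induct)
  case (less F)
  define d where "d = subdegree (at_x0 F)"
  have d1: "d \<ge> 1"
  proof (rule ccontr)
    assume "\<not> d \<ge> 1"
    hence "subdegree (at_x0 F) = 0" by (simp add: d_def)
    with nth_subdegree_nonzero[OF less.prems(2)] have "at_x0 F $ 0 \<noteq> 0" by metis
    thus False using less.prems by simp
  qed
  \<comment> \<open>The \<open>(d - 1)\<close>-st \<open>y\<close>-derivative has a simple zero in
    \<open>y\<close> at the origin. Its root \<open>v\<close> from the implicit function theorem is
    the translation that removes the term \<open>y^(d - 1)\<close>.\<close>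
  define G where "G = fps_nth_deriv (d - 1) F"
  have G0: "G $ 0 = of_nat (fact (d - 1)) * F $ (d - 1)" by (simp add: G_def fps_nth_deriv_nth_0)
  have "F $ (d - 1) $ 0 = 0"
    using d1 nth_less_subdegree_zero[of "d - 1" "at_x0 F"] by (simp add: d_def)
  hence G00: "G $ 0 $ 0 = 0" by (simp add: G0)
  have "dy G = fps_nth_deriv d F"
    using d1 fps_nth_deriv_commute[of "d - 1" F] by (simp add: G_def)
  moreover have G1': "dy G $ 0 = G $ 1" unfolding fps_deriv_nth by simp
  ultimately have "G $ 1 = of_nat (fact d) * F $ d" using fps_nth_deriv_nth_0[of d F]
    by simp
  moreover have "F $ d $ 0 \<noteq> 0"
    using less.prems nth_subdegree_nonzero[of "at_x0 F"] by (simp add: d_def)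
  ultimately have G10: "G $ 1 $ 0 \<noteq> 0" by (simp del: of_nat_fact)
  have "convergent_fps2 G" unfolding G_def by (intro convergent_fps2_nth_deriv less.prems)
  then obtain v where v: "v $ 0 = 0" "convergent_fps v" "eval_at fps_X v G = 0"
    using implicit_function[OF _ G00 G10] by blast
  define T where "T = subst varx (vary + fps_const v) F"
  have T: "convergent_fps2 T" unfolding T_def
    using less.prems v by (intro convergent_fps2_subst convergent_fps2_intros) auto
  have atT: "at_x0 T = at_x0 F" unfolding T_def
    by (rule at_x0_subst) (use v in \<open>auto simp: at_x0_add\<close>)
  have "of_nat (fact (d - 1)) * T $ (d - 1) = 0"
    unfolding T_def fps_nth_deriv_nth_0[symmetric] fps_nth_deriv_subst_translate[OF v(1)] G_def[symmetric]
    using v by (simp add: subst_translate_nth_0)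
  hence Td1: "T $ (d - 1) = 0" by simp
  have Td: "T $ d $ 0 \<noteq> 0"
    using nth_subdegree_nonzero[of "at_x0 F"] less.prems by (simp flip: atT add: d_def)
  have Tj: "T $ j $ 0 = 0" if "j < d" for j
    using nth_less_subdegree_zero[of j "at_x0 F"] that by (simp flip: atT add: d_def)
  have "\<exists>m u. m \<ge> 1 \<and> u $ 0 = 0 \<and> convergent_fps u \<and> eval_at (fps_X ^ m) u T = 0"
  proof (cases "\<forall>j<d. T $ j = 0")
    \<comment> \<open>Here \<open>y^d\<close> divides \<open>T\<close>, so \<open>y = 0\<close> is a
      root without ramification.\<close>
    case True
    thus ?thesis using d1 by (intro exI[of _ 1] exI[of _ 0]) (auto simp: eval_at_X_0 convergent_fps2_0)
  next
    case False
    define J where "J = {j. j < d \<and> T $ j \<noteq> 0}"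
    define slope where "slope j = real (subdegree (T $ j)) / real (d - j)" for j
    have "finite J" "J \<noteq> {}" using False by (auto simp: J_def)
    define j0 where "j0 = arg_min_on slope J"
    have j0: "j0 \<in> J" unfolding j0_def using \<open>finite J\<close> \<open>J \<noteq> {}\<close> by (intro arg_min_if_finite)
    have sl: "slope j0 \<le> slope j" if "j \<in> J" for j
      unfolding j0_def using \<open>finite J\<close> \<open>J \<noteq> {}\<close> that by (intro arg_min_least)
    \<comment> \<open>The edge from \<open>y^d\<close> to \<open>x^q y^j0\<close> has slope
      \<open>q / p\<close>, not necessarily in lowest terms. After \<open>x = t^p\<close> the slope
      is the integer \<open>q\<close>, which can be the weight of a blow-up.\<close>
    define p where "p = d - j0"
    define q where "q = subdegree (T $ j0)"
    have j0d: "j0 < d" "T $ j0 \<noteq> 0" using j0 by (auto simp: J_def)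
    have p: "p \<ge> 1" using j0d by (simp add: p_def)
    have q: "q \<ge> 1"
    proof (rule ccontr)
      assume "\<not> q \<ge> 1"
      hence "subdegree (T $ j0) = 0" by (simp add: q_def)
      with nth_subdegree_nonzero[OF j0d(2)] have "T $ j0 $ 0 \<noteq> 0" by metis
      thus False using Tj j0d by simp
    qed
    have pq: "q * (d - j) \<le> p * subdegree (T $ j)" if "j \<in> J" for j
    proof -
      have "j < d" using that by (simp add: J_def)
      hence "real q * real (d - j) \<le> real (subdegree (T $ j)) * real p"
        using sl[OF that] p by (simp add: slope_def p_def[symmetric] q_def[symmetric] divide_simps mult_ac)
      hence "real (q * (d - j)) \<le> real (p * subdegree (T $ j))" by (simp only: of_nat_mult mult.commute)
      thus ?thesis by (simp only: of_nat_le_iff)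
    qed
    define T2 where "T2 = subst (varx ^ p) vary T"
    have px: "(varx ^ p) $ 0 $ 0 = 0" using p by (simp add: varx_power)
    have T2: "T2 $ j $ k = (if p dvd k then T $ j $ (k div p) else 0)" for j k
      unfolding T2_def by (rule subst_ramify_nth[OF p])
    have convT2: "convergent_fps2 T2" unfolding T2_def
      using T px by (intro convergent_fps2_subst convergent_fps2_intros) auto
    have A: "T2 $ j $ k = 0" if "j < d" "k < q * (d - j)" for j k
    proof (cases "p dvd k \<and> T $ j \<noteq> 0")
      case True
      then obtain k' where k': "k = p * k'" by (auto elim: dvdE)
      have "j \<in> J" "p * k' < q * (d - j)" using that True unfolding k' by (auto simp: J_def)
      from less_le_trans[OF this(2) pq[OF this(1)]] have "p * k' < p * subdegree (T $ j)" .
      hence "k' < subdegree (T $ j)" using nat_mult_less_cancel_disj by blast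
      hence "T $ j $ k' = 0" by (rule nth_less_subdegree_zero)
      thus ?thesis using p unfolding T2 k' by simp
    qed (auto simp: T2)
    \<comment> \<open>The weight of \<open>y^d\<close>. By minimality of the slope no monomial of
      \<open>T2\<close> has smaller weight, so \<open>x^e\<close> splits off after the
      blow-up.\<close>
    define e where "e = q * d"
    define \<phi> where "\<phi> = weighted_part q e T2"
    have co: "coeff \<phi> j = (if j \<le> d then T2 $ j $ (q * (d - j)) else 0)" for j
      unfolding \<phi>_def coeff_weighted_part[OF q] e_def using q by (auto simp: diff_mult_distrib2)
    have cod: "coeff \<phi> d \<noteq> 0" using Td by (simp add: co T2)
    have deg: "degree \<phi> = d"
    proof (rule antisym)
      show "degree \<phi> \<le> d" by (rule degree_le) (simp add: co)
    qed (rule le_degree[OF cod])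
    have coj0: "coeff \<phi> j0 \<noteq> 0"
      using j0d p by (simp add: co T2 p_def[symmetric] q_def)
    have cod1: "coeff \<phi> (d - 1) = 0" using Td1 by (simp add: co T2)
    \<comment> \<open>For \<open>d = 1\<close> the index \<open>j0\<close> would be
      \<open>0 = d - 1\<close>, whose coefficient was just killed.\<close>
    have d2: "d \<ge> 2" using coj0 cod1 j0d by (cases "d = 1") auto
    obtain c where c: "poly \<phi> c = 0" "order c \<phi> < d"
      using exists_root_order_less_degree[OF deg d2 cod1 j0d(1) coj0] by blast
    have \<phi>0: "\<phi> \<noteq> 0" using cod by auto
    define U where "U = varx ^ q * (vary + cst c)"
    have U0: "U $ 0 $ 0 = 0" using q by (simp add: U_def varx_power_mult_nth)
    define T3 where "T3 = subst varx U T2"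
    have T3: "T3 $ l $ k = coeff (pcompose (weighted_part q k T2) [:c, 1:]) l" for l k
      unfolding T3_def U_def by (rule subst_blowup_nth[OF q])
    have convT3: "convergent_fps2 T3" unfolding T3_def using convT2 U0
      by (intro convergent_fps2_subst) (auto simp: U_def simp del: fps_const_power intro!: convergent_fps2_intros)
    have "weighted_part q k T2 = 0" if "k < e" for k
    proof (rule poly_eqI)
      fix j
      show "coeff (weighted_part q k T2) j = coeff 0 j"
      proof (cases "q * j \<le> k")
        case True
        from le_less_trans[OF True that] have "q * j < q * d" unfolding e_def .
        hence "j < d" by simp
        moreover have "k - q * j < q * (d - j)" using that True by (simp add: e_def diff_mult_distrib2)
        ultimately show ?thesis using A by (simp add: coeff_weighted_part[OF q])
      qed (simp add: coeff_weighted_part[OF q])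
    qed
    hence T3e: "T3 = varx ^ e * xshift e T3" by (intro xshift_eq) (simp add: T3)
    define T4 where "T4 = xshift e T3"
    have convT4: "convergent_fps2 T4" unfolding T4_def by (rule convergent_fps2_xshift[OF convT3])
    have at4: "at_x0 T4 = fps_of_poly (pcompose \<phi> [:c, 1:])"
      by (rule fps_ext) (simp add: T4_def T3 \<phi>_def)
    have sd: "subdegree (at_x0 T4) = order c \<phi>" "at_x0 T4 \<noteq> 0"
      unfolding at4 by (rule subdegree_fps_of_poly_pcompose[OF \<phi>0])+
    have "order c \<phi> \<noteq> 0" using c \<phi>0 by (simp add: order_root)
    hence "at_x0 T4 $ 0 = 0" using sd by (intro nth_less_subdegree_zero) simp
    hence "T4 $ 0 $ 0 = 0" by simp
    then obtain m u where mu: "m \<ge> 1" "u $ 0 = 0" "convergent_fps u" "eval_at (fps_X ^ m) u T4 = 0"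
      using less.hyps[of T4] sd c convT4 by (auto simp: d_def)
    have m0: "(fps_X ^ m) $ 0 = (0 :: complex)" using mu by simp
    define w where "w = (fps_X ^ m) ^ q * (u + fps_const c)"
    have w0: "w $ 0 = 0" using mu q by (simp add: w_def flip: power_mult)
    have "convergent_fps2 ((varx ^ m) ^ q * (fps_const u + cst c))"
      using mu by (intro convergent_fps2_intros) auto
    hence convw: "convergent_fps w" by (simp add: w_def)
    have "eval_at (fps_X ^ m) u T3 = 0"
      by (subst T3e) (simp only: eval_at_mult[OF m0 mu(2)] mu(4) T4_def[symmetric] mult_zero_right)
    moreover have "eval_at (fps_X ^ m) u U = w"
      unfolding U_def w_def eval_at_mult[OF m0 mu(2)] eval_at_varx_power[OF m0 mu(2)] eval_at_add[OF m0 mu(2)]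
        eval_at_vary[OF m0 mu(2)] eval_at_const[OF m0 mu(2)] ..
    ultimately have T2w: "eval_at (fps_X ^ m) w T2 = 0"
      unfolding T3_def eval_at_subst[OF m0 mu(2) varx_nth_00 U0] eval_at_varx[OF m0 mu(2)] by simp
    have "eval_at ((fps_X ^ m) ^ p) w T = 0"
      using T2w unfolding T2_def eval_at_subst[OF m0 w0 px vary_nth_00] eval_at_varx_power[OF m0 w0] eval_at_vary[OF m0 w0] .
    moreover have "m * p \<ge> 1" using mu p by simp
    ultimately show ?thesis using w0 convw unfolding power_mult[symmetric] by blast
  qed
  then obtain m u where mu: "m \<ge> 1" "u $ 0 = 0" "convergent_fps u" "eval_at (fps_X ^ m) u T = 0" by blast
  have m0: "(fps_X ^ m) $ 0 = (0 :: complex)" using mu by simp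
  define w where "w = u + (v oo fps_X ^ m)"
  have w0: "w $ 0 = 0" using mu v by (simp add: w_def)
  have "convergent_fps2 (varx ^ m)" by (intro convergent_fps2_intros)
  hence "convergent_fps (v oo fps_X ^ m)" using v m0 by (intro convergent_fps_compose) (simp_all add: varx_power)
  from convergent_fps2_add[OF mu(3) this] have convw: "convergent_fps w" by (simp add: w_def)
  have 0: "(vary + fps_const v) $ 0 $ 0 = 0" using v by simp
  have "eval_at (fps_X ^ m) u (vary + fps_const v) = w"
    unfolding eval_at_add[OF m0 mu(2)] eval_at_vary[OF m0 mu(2)] eval_at_fps_const[OF m0 mu(2)] w_def ..
  hence "eval_at (fps_X ^ m) w F = 0"
    using mu(4) unfolding T_def eval_at_subst[OF m0 mu(2) varx_nth_00 0] eval_at_varx[OF m0 mu(2)] by simp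
  thus ?case using w0 convw mu(1) by blast
qed

section \<open>Branches as prime elements\<close>

lemma subst_translate_inverse:
  assumes "v $ 0 = 0"
  shows "subst varx (vary - fps_const v) (subst varx (vary + fps_const v) F) = F"
proof -
  have 1: "(vary + fps_const v) $ 0 $ 0 = 0" and 2: "(vary - fps_const v) $ 0 $ 0 = 0"
    using assms by simp_all
  have "subst varx (vary - fps_const v) (fps_const v) = fps_const v"
    using subst_fps_const_left[OF _ 2, of fps_X v] by simp
  hence "subst varx (vary - fps_const v) (vary + fps_const v) = vary"
    by (simp add: subst_add subst_vary[OF varx_nth_00 2])
  thus ?thesis
    by (simp add: subst_subst[OF varx_nth_00 1 varx_nth_00 2] subst_varx[OF varx_nth_00 2])
qed

text \<open>Translating the root to \<open>y = 0\<close> reduces this to dividing by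
  \<open>y\<close>, which is a shift of coefficients and visibly preserves convergence.\<close>

lemma root_imp_linear_factor:
  assumes F: "convergent_fps2 F" and v: "convergent_fps v" "v $ 0 = 0" and root: "eval_at fps_X v F = 0"
  obtains Q where "convergent_fps2 Q" "F = (vary - fps_const v) * Q"
proof -
  define T where "T = subst varx (vary + fps_const v) F"
  have 1: "(vary + fps_const v) $ 0 $ 0 = 0" and 2: "(vary - fps_const v) $ 0 $ 0 = 0"
    using v by simp_all
  have T: "convergent_fps2 T" unfolding T_def
    by (intro convergent_fps2_subst convergent_fps2_intros F v 1 varx_nth_00)
  have "T $ 0 = 0" by (simp add: T_def subst_translate_nth_0 v root)
  hence Tv: "T = vary * fps_shift 1 T" by (rule fps_shift_vary_eq)
  have "F = subst varx (vary - fps_const v) T" by (simp add: T_def subst_translate_inverse v)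
  also have "\<dots> = (vary - fps_const v) * subst varx (vary - fps_const v) (fps_shift 1 T)"
    by (subst Tv) (simp only: subst_vary_mult[OF varx_nth_00 2])
  finally show ?thesis
    using that convergent_fps2_subst[OF convergent_fps2_shift[OF T, of 1] convergent_fps2_varx _ varx_nth_00 2]
      convergent_fps2_diff[OF convergent_fps2_X v(1)] by blast
qed

lemma eval_at_linear: "a $ 0 = 0 \<Longrightarrow> b $ 0 = 0 \<Longrightarrow> eval_at a b (vary - fps_const v) = b - (v oo a)"
  by (simp add: eval_at_diff eval_at_vary eval_at_fps_const)

lemma eval_at_prod: "a $ 0 = 0 \<Longrightarrow> b $ 0 = 0 \<Longrightarrow> eval_at a b (prod f A) = (\<Prod>x\<in>A. eval_at a b (f x))"
  by (induction A rule: infinite_finite_induct) (auto simp: eval_at_mult eval_at_1)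

lemma linear_neq_0: "vary - fps_const v \<noteq> 0"
proof
  assume "vary - fps_const v = 0"
  hence "(vary - fps_const v) $ 1 = 0" by simp
  thus False by simp
qed

lemma roots_imp_factor:
  assumes "finite V" "convergent_fps2 F" "\<And>v. v \<in> V \<Longrightarrow> convergent_fps v \<and> v $ 0 = 0 \<and> eval_at fps_X v F = 0"
  shows "\<exists>Q. convergent_fps2 Q \<and> F = (\<Prod>v\<in>V. vary - fps_const v) * Q"
  using assms
proof (induction V arbitrary: F rule: finite_induct)
  case empty
  thus ?case by auto
next
  case (insert v V)
  have v: "convergent_fps v" "v $ 0 = 0" "eval_at fps_X v F = 0" using insert.prems(2) by auto
  obtain Q where Q: "convergent_fps2 Q" "F = (vary - fps_const v) * Q"
    using root_imp_linear_factor[OF insert.prems(1) v] by blast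
  have "convergent_fps w \<and> w $ 0 = 0 \<and> eval_at fps_X w Q = 0" if "w \<in> V" for w
  proof -
    have w: "convergent_fps w" "w $ 0 = 0" "eval_at fps_X w F = 0" using insert.prems(2) that by auto
    have "(w - v) * eval_at fps_X w Q = 0"
      using w(3) unfolding Q(2) by (simp add: eval_at_mult eval_at_linear w)
    moreover have "w \<noteq> v" using that insert.hyps by auto
    ultimately show ?thesis using w by simp
  qed
  then obtain Q' where Q': "convergent_fps2 Q'" "Q = (\<Prod>v\<in>V. vary - fps_const v) * Q'"
    using insert.IH[OF Q(1)] by blast
  show ?case using Q' Q(2) insert.hyps by (intro exI[of _ Q']) (simp add: mult.assoc)
qed

section \<open>Ramification and the Galois action of the roots of unity\<close>

abbreviation ramify :: "nat \<Rightarrow> pser \<Rightarrow> pser" where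
  "ramify m \<equiv> subst (varx ^ m) vary"

lemma varx_power_nth_00: "m \<ge> 1 \<Longrightarrow> (varx ^ m) $ 0 $ 0 = 0"
  by (simp add: varx_power)

lemma fps_X_power_nth_0: "m \<ge> 1 \<Longrightarrow> (fps_X ^ m) $ 0 = 0"
  by simp

lemma eval_at_ramify: "m \<ge> 1 \<Longrightarrow> u $ 0 = 0 \<Longrightarrow> a $ 0 = 0 \<Longrightarrow> eval_at a u (ramify m F) = eval_at (a ^ m) u F"
  by (subst eval_at_subst) (auto simp: varx_power_nth_00 eval_at_varx_power eval_at_vary simp del: fps_const_power)

lemma ramify_mult: "m \<ge> 1 \<Longrightarrow> ramify m (F * G) = ramify m F * ramify m G"
  by (rule subst_mult) (auto simp: varx_power_nth_00 simp del: fps_const_power)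

lemma convergent_fps2_ramify: "m \<ge> 1 \<Longrightarrow> convergent_fps2 F \<Longrightarrow> convergent_fps2 (ramify m F)"
  by (intro convergent_fps2_subst convergent_fps2_intros varx_power_nth_00 vary_nth_00)

lemma ramify_inject: 
  assumes "m \<ge> 1" "ramify m F = ramify m G" shows "F = G"
proof (intro fps_ext)
  fix l k
  have "ramify m F $ l $ (m * k) = ramify m G $ l $ (m * k)" using assms by simp
  thus "F $ l $ k = G $ l $ k" using assms(1) unfolding subst_ramify_nth[OF assms(1)] by simp
qed

lemma at_x0_ramify: "m \<ge> 1 \<Longrightarrow> at_x0 (ramify m F) = at_x0 F"
  by (rule at_x0_subst) (auto simp: varx_power)

lemma unramify:
  assumes m: "m \<ge> 1" and G: "convergent_fps2 G" and z: "\<And>k l. \<not> m dvd k \<Longrightarrow> G $ l $ k = 0"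
  obtains F where "convergent_fps2 F" "G = ramify m F"
proof
  define F where "F = Abs_fps (\<lambda>l. Abs_fps (\<lambda>k. G $ l $ (m * k)))"
  obtain M R where MR: "M \<ge> 0" "R \<ge> 1" "\<And>i j. norm (G $ j $ i) \<le> M * R ^ (i + j)"
    using convergent_fps2D[OF G] by blast
  show "convergent_fps2 F"
  proof (rule convergent_fps2I[of "R ^ m" _ M])
    fix i j
    have "norm (F $ j $ i) \<le> M * R ^ (m * i + j)" using MR(3)[of j "m * i"] by (simp add: F_def)
    also have "\<dots> \<le> M * R ^ (m * (i + j))"
      using m MR by (intro mult_left_mono power_increasing) (auto simp: algebra_simps)
    finally show "norm (F $ j $ i) \<le> M * (R ^ m) ^ (i + j)" by (simp only: power_mult)
  qed (use MR in auto)
  show "G = ramify m F"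
    by (intro fps_ext) (use z m in \<open>auto simp: subst_ramify_nth F_def simp del: fps_const_power\<close>)
qed

text \<open>The substitution of \<open>\<zeta> t\<close> for \<open>t\<close>. With
  \<open>\<zeta>^m = 1\<close> these are the deck transformations of \<open>x = t^m\<close>.\<close>

definition fps_rotate :: "complex \<Rightarrow> complex fps \<Rightarrow> complex fps" where
  "fps_rotate \<zeta> u = Abs_fps (\<lambda>k. \<zeta> ^ k * u $ k)"

definition pser_rotate :: "complex \<Rightarrow> pser \<Rightarrow> pser" where
  "pser_rotate \<zeta> F = Abs_fps (\<lambda>l. fps_rotate \<zeta> (F $ l))"

lemma fps_rotate_nth [simp]: "fps_rotate \<zeta> u $ k = \<zeta> ^ k * u $ k" by (simp add: fps_rotate_def)
lemma pser_rotate_nth [simp]: "pser_rotate \<zeta> F $ l $ k = \<zeta> ^ k * F $ l $ k" by (simp add: pser_rotate_def)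

lemma pser_rotate_mult: "pser_rotate \<zeta> (F * G) = pser_rotate \<zeta> F * pser_rotate \<zeta> G"
proof (intro fps_ext)
  fix l k
  show "pser_rotate \<zeta> (F * G) $ l $ k = (pser_rotate \<zeta> F * pser_rotate \<zeta> G) $ l $ k"
    unfolding pser_rotate_nth pser_mult_nth sum_distrib_left
    by (intro sum.cong refl) (auto simp: power_add[symmetric])
qed

lemma pser_rotate_linear: "pser_rotate \<zeta> (vary - fps_const v) = vary - fps_const (fps_rotate \<zeta> v)"
  by (intro fps_ext) (auto simp: fps_X_def)

lemma pser_rotate_1: "pser_rotate \<zeta> 1 = 1"
  by (intro fps_ext) auto

lemma pser_rotate_prod: "pser_rotate \<zeta> (prod f A) = (\<Prod>x\<in>A. pser_rotate \<zeta> (f x))"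
  by (induction A rule: infinite_finite_induct) (auto simp: pser_rotate_mult pser_rotate_1)

lemma fps_rotate_fps_rotate: "fps_rotate \<zeta> (fps_rotate \<xi> u) = fps_rotate (\<zeta> * \<xi>) u"
  by (rule fps_ext) (simp add: power_mult_distrib)

lemma fps_rotate_1 [simp]: "fps_rotate 1 u = u"
  by (rule fps_ext) simp

lemma convergent_fps_rotate:
  assumes "convergent_fps u" "norm \<zeta> = 1" shows "convergent_fps (fps_rotate \<zeta> u)"
proof -
  have "norm (fps_const (fps_rotate \<zeta> u) $ j $ i) = norm (fps_const u $ j $ i)" for i j
    using assms(2) by (simp add: norm_mult norm_power)
  thus ?thesis using assms(1) unfolding convergent_fps2_def by simp
qed

lemma pser_rotate_ramify: "\<zeta> ^ m = 1 \<Longrightarrow> m \<ge> 1 \<Longrightarrow> pser_rotate \<zeta> (ramify m F) = ramify m F"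
  by (intro fps_ext) (auto simp: subst_ramify_nth power_mult simp del: fps_const_power elim!: dvdE)

text \<open>For a primitive root of unity, invariance gives \<open>\<zeta>^k G_k = G_k\<close>,
  while \<open>\<zeta>^k\<close> differs from 1 unless \<open>m\<close> divides
  \<open>k\<close>.\<close>

lemma pser_rotate_invariant_imp:
  assumes m: "m \<ge> 1" and inv: "\<And>\<zeta>. \<zeta> ^ m = 1 \<Longrightarrow> pser_rotate \<zeta> G = G" and "\<not> m dvd k"
  shows "G $ l $ k = 0"
proof -
  define \<zeta> where "\<zeta> = exp (2 * of_real pi * \<i> * of_nat 1 / of_nat m)"
  have pw: "\<zeta> ^ j = exp (2 * of_real pi * \<i> * of_nat j / of_nat m)" for j
    unfolding \<zeta>_def exp_of_nat_mult[symmetric] by (simp add: field_simps)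
  have "\<zeta> ^ m = 1" using m unfolding pw by (subst complex_root_unity_eq_1) auto
  hence "\<zeta> ^ k * G $ l $ k = G $ l $ k" using inv by (metis pser_rotate_nth)
  moreover have "\<zeta> ^ k \<noteq> 1" using m assms(3) unfolding pw by (subst complex_root_unity_eq_1) auto
  ultimately show ?thesis by simp
qed

text \<open>
  If \<open>F(t\<^sup>m, u) = 0\<close>, then \<open>F(t\<^sup>m, y)\<close> vanishes on all conjugates \<open>u(\<zeta> t)\<close>; its quotient by the product
  over them is invariant under \<open>t \<mapsto> \<zeta> t\<close>, hence again a series in \<open>t\<^sup>m\<close> and \<open>y\<close>.
\<close>
lemma roots_of_unity_orbit_poly:
  fixes u :: "complex fps"
  assumes m: "m \<ge> 1" and u: "convergent_fps u" "u $ 0 = 0"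
  defines "V \<equiv> (\<lambda>\<zeta>. fps_rotate \<zeta> u) ` {\<zeta>. \<zeta> ^ m = 1}"
  obtains g where "convergent_fps2 g" "ramify m g = (\<Prod>v\<in>V. vary - fps_const v)"
    "\<And>F. convergent_fps2 F \<Longrightarrow> eval_at (fps_X ^ m) u F = 0 \<longleftrightarrow> (\<exists>Q. convergent_fps2 Q \<and> F = g * Q)"
proof -
  have fin: "finite V" unfolding V_def using m by (intro finite_imageI finite_roots_unity) auto
  have n1: "norm \<zeta> = 1" if "\<zeta> ^ m = 1" for \<zeta> :: complex
    using that m by (metis norm_one norm_power power_eq_1_iff norm_ge_zero not_one_le_zero)
  have V: "convergent_fps v" "v $ 0 = 0" if "v \<in> V" for v
    using that u n1 by (auto simp: V_def intro: convergent_fps_rotate)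
  define G where "G = (\<Prod>v\<in>V. vary - fps_const v)"
  have G0: "G \<noteq> 0" unfolding G_def using fin linear_neq_0 by simp
  have convG: "convergent_fps2 G" unfolding G_def using fin V
    by (induction V rule: finite_induct) (auto intro!: convergent_fps2_intros)
  have rotG: "pser_rotate \<zeta> G = G" if z: "\<zeta> ^ m = 1" for \<zeta>
  proof -
    have inj: "inj_on (fps_rotate \<zeta>) V"
    proof (rule inj_onI)
      fix v w assume "fps_rotate \<zeta> v = fps_rotate \<zeta> w"
      hence "fps_rotate (inverse \<zeta>) (fps_rotate \<zeta> v) = fps_rotate (inverse \<zeta>) (fps_rotate \<zeta> w)" by simp
      moreover have "\<zeta> \<noteq> 0" using z m by (auto simp: power_0_left)
      ultimately show "v = w" by (simp add: fps_rotate_fps_rotate)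
    qed
    have "fps_rotate \<zeta> ` V \<subseteq> V" using z by (auto simp: V_def fps_rotate_fps_rotate power_mult_distrib)
    hence im: "fps_rotate \<zeta> ` V = V" by (rule endo_inj_surj[OF fin _ inj])
    have "pser_rotate \<zeta> G = (\<Prod>v\<in>V. vary - fps_const (fps_rotate \<zeta> v))"
      by (simp add: G_def pser_rotate_prod pser_rotate_linear)
    also have "\<dots> = (\<Prod>v\<in>fps_rotate \<zeta> ` V. vary - fps_const v)"
      by (simp add: prod.reindex[OF inj])
    finally show ?thesis by (simp add: im G_def)
  qed
  obtain g where g: "convergent_fps2 g" "G = ramify m g"
    using unramify[OF m convG] pser_rotate_invariant_imp[OF m rotG] by metis
  show ?thesis
  proof (rule that)
    show "convergent_fps2 g" by fact
    show "ramify m g = (\<Prod>v\<in>V. vary - fps_const v)" using g G_def by simp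
    fix F assume F: "convergent_fps2 F"
    have uV: "u \<in> V" unfolding V_def by (rule image_eqI[of _ _ 1]) auto
    show "eval_at (fps_X ^ m) u F = 0 \<longleftrightarrow> (\<exists>Q. convergent_fps2 Q \<and> F = g * Q)"
    proof
      assume "\<exists>Q. convergent_fps2 Q \<and> F = g * Q"
      then obtain Q where Q: "F = g * Q" by blast
      have "eval_at (fps_X ^ m) u g = eval_at fps_X u G" using g m u by (simp add: eval_at_ramify del: fps_const_power)
      also have "\<dots> = 0" unfolding G_def using uV fin u by (simp add: eval_at_prod eval_at_linear) 
      finally show "eval_at (fps_X ^ m) u F = 0"
        unfolding Q eval_at_mult[OF fps_X_power_nth_0[OF m] u(2)] by simp
    next
      assume root: "eval_at (fps_X ^ m) u F = 0"
      define H where "H = ramify m F"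
      have H: "convergent_fps2 H" unfolding H_def by (rule convergent_fps2_ramify[OF m F])
      have "eval_at fps_X u H = 0" using root m u by (simp add: H_def eval_at_ramify del: fps_const_power)
      then obtain K where K: "H = (vary - fps_const u) * K"
        using root_imp_linear_factor[OF H u] by blast
      have "eval_at fps_X v H = 0" if vV: "v \<in> V" for v
      proof -
        obtain \<zeta> :: complex where z: "\<zeta> ^ m = 1" "v = fps_rotate \<zeta> u" using vV unfolding V_def by blast
        have "H = pser_rotate \<zeta> H" using z m by (simp add: H_def pser_rotate_ramify del: fps_const_power)
        also have "\<dots> = (vary - fps_const v) * pser_rotate \<zeta> K" by (simp add: K pser_rotate_mult pser_rotate_linear z)
        finally show ?thesis using V[OF vV] by (metis eval_at_mult eval_at_linear fps_compose_fps_X diff_self fps_X_nth mult_zero_left zero_neq_one)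
      qed
      then obtain Q where Q: "convergent_fps2 Q" "H = G * Q"
        using roots_imp_factor[OF fin H] V unfolding G_def by blast
      have "pser_rotate \<zeta> Q = Q" if z: "\<zeta> ^ m = 1" for \<zeta>
      proof -
        have "G * pser_rotate \<zeta> Q = pser_rotate \<zeta> H" using rotG[OF z] by (simp add: Q pser_rotate_mult)
        also have "\<dots> = H" using pser_rotate_ramify[OF z m] by (simp only: H_def)
        also have "\<dots> = G * Q" by (rule Q)
        finally show ?thesis using G0 by simp
      qed
      then obtain q where q: "convergent_fps2 q" "Q = ramify m q"
        using unramify[OF m Q(1)] pser_rotate_invariant_imp[OF m] by metis
      have "ramify m F = ramify m (g * q)"
        using Q(2) g(2) q(2) by (simp add: H_def ramify_mult[OF m] del: fps_const_power)
      hence "F = g * q" by (rule ramify_inject[OF m])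
      thus "\<exists>Q. convergent_fps2 Q \<and> F = g * Q" using q by blast
    qed
  qed
qed

section \<open>Divisibility and units among convergent series\<close>

lemma cps_dvd_iff: "F dvd G \<longleftrightarrow> (\<exists>Q. convergent_fps2 Q \<and> fps2_of_cps G = fps2_of_cps F * Q)"
proof
  assume "F dvd G"
  then obtain K where "G = F * K" by (elim dvdE)
  thus "\<exists>Q. convergent_fps2 Q \<and> fps2_of_cps G = fps2_of_cps F * Q"
    using fps2_of_cps[of K] by (intro exI[of _ "fps2_of_cps K"]) (simp add: times_cps.rep_eq)
next
  assume "\<exists>Q. convergent_fps2 Q \<and> fps2_of_cps G = fps2_of_cps F * Q"
  then obtain Q where "convergent_fps2 Q" "fps2_of_cps G = fps2_of_cps F * Q" by blast
  hence "G = F * Abs_cps Q"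
    by (metis Abs_cps_inverse fps2_of_cps_inject mem_Collect_eq times_cps.rep_eq)
  thus "F dvd G" by simp
qed

lemma convergent_fps2_of_cps [simp]: "convergent_fps2 (fps2_of_cps F)"
  using fps2_of_cps[of F] by simp

lemma cps_unit_iff: "F dvd 1 \<longleftrightarrow> fps2_of_cps F $ 0 $ 0 \<noteq> 0"
proof
  assume "F dvd 1"
  then obtain Q where "1 = fps2_of_cps F * Q" by (auto simp: cps_dvd_iff one_cps.rep_eq)
  hence "(1 :: pser) $ 0 $ 0 = (fps2_of_cps F * Q) $ 0 $ 0" by simp
  hence "1 = fps2_of_cps F $ 0 $ 0 * Q $ 0 $ 0" by (simp add: pser_mult_nth)
  thus "fps2_of_cps F $ 0 $ 0 \<noteq> 0" by auto
next
  assume "fps2_of_cps F $ 0 $ 0 \<noteq> 0"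
  thus "F dvd 1" unfolding cps_dvd_iff one_cps.rep_eq
    using convergent_fps2_inverse[OF convergent_fps2_of_cps[of F]] by metis
qed

text \<open>Divisibility by \<open>g\<close> is vanishing along \<open>(t^m, u(t))\<close>, a
  condition on values in an integral domain; hence \<open>g\<close> is prime. The conjugates form a
  set, so coinciding ones are taken once even if the parametrisation is not primitive; this makes
  \<open>u\<close> a simple root, which the last conclusion records.\<close>

theorem branch_prime:
  assumes m: "m \<ge> 1" and u: "convergent_fps u" "u $ 0 = 0"
  obtains g where "prime_elem g" "\<And>F. g dvd F \<longleftrightarrow> eval_at (fps_X ^ m) u (fps2_of_cps F) = 0"
    "at_x0 (fps2_of_cps g) \<noteq> 0"
    "\<And>v. v $ 0 = 0 \<Longrightarrow> eval_at (fps_X ^ m) v (fps2_of_cps g) = 0 \<Longrightarrow> \<exists>\<zeta>. \<zeta> ^ m = 1 \<and> v = fps_rotate \<zeta> u"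
    "\<exists>R. ramify m (fps2_of_cps g) = (vary - fps_const u) * R \<and> eval_at fps_X u R \<noteq> 0"
proof -
  define V where "V = (\<lambda>\<zeta>. fps_rotate \<zeta> u) ` {\<zeta>. \<zeta> ^ m = 1}"
  obtain g' where g': "convergent_fps2 g'" "ramify m g' = (\<Prod>v\<in>V. vary - fps_const v)"
      "\<And>F. convergent_fps2 F \<Longrightarrow> eval_at (fps_X ^ m) u F = 0 \<longleftrightarrow> (\<exists>Q. convergent_fps2 Q \<and> F = g' * Q)"
    using roots_of_unity_orbit_poly[OF m u] unfolding V_def by blast
  define g where "g = Abs_cps g'"
  have g: "fps2_of_cps g = g'" using g' by (simp add: g_def Abs_cps_inverse)
  have fin: "finite V" unfolding V_def using m by (intro finite_imageI finite_roots_unity) auto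
  have V0: "v $ 0 = 0" if "v \<in> V" for v using that u by (auto simp: V_def)
  have uV: "u \<in> V" unfolding V_def by (rule image_eqI[of _ _ 1]) auto
  have m0: "(fps_X ^ m) $ 0 = (0 :: complex)" using m by simp
  have dvd: "g dvd F \<longleftrightarrow> eval_at (fps_X ^ m) u (fps2_of_cps F) = 0" for F
    unfolding cps_dvd_iff g using g'(3)[of "fps2_of_cps F"] by simp
  have at: "at_x0 g' = fps_X ^ card V"
  proof -
    have "at_x0 g' = at_x0 (\<Prod>v\<in>V. vary - fps_const v)" using at_x0_ramify[OF m] g'(2) by metis
    also have "\<dots> = fps_X ^ card V" using fin V0
      by (induction V rule: finite_induct) (auto simp: at_x0_mult at_x0_diff)
    finally show ?thesis .
  qed
  show ?thesis
  proof (rule that)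
    show "g dvd F \<longleftrightarrow> eval_at (fps_X ^ m) u (fps2_of_cps F) = 0" for F by (rule dvd)
    show "at_x0 (fps2_of_cps g) \<noteq> 0" by (simp add: g at)
    show "prime_elem g"
    proof (rule prime_elemI)
      show "g \<noteq> 0"
      proof
        assume "g = 0"
        hence "at_x0 (fps2_of_cps g) = 0" by (intro fps_ext) (simp add: zero_cps.rep_eq)
        thus False by (simp add: g at)
      qed
      show "\<not> g dvd 1" using dvd[of 1] m0 u by (simp add: one_cps.rep_eq eval_at_1)
      show "g dvd a \<or> g dvd b" if "g dvd a * b" for a b
        using that unfolding dvd times_cps.rep_eq eval_at_mult[OF m0 u(2)] by simp
    qed
    show "\<exists>\<zeta>. \<zeta> ^ m = 1 \<and> v = fps_rotate \<zeta> u"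
      if v: "v $ 0 = 0" "eval_at (fps_X ^ m) v (fps2_of_cps g) = 0" for v
    proof -
      have "eval_at fps_X v (ramify m g') = 0" using v m g by (simp add: eval_at_ramify del: fps_const_power)
      hence "(\<Prod>w\<in>V. v - w) = 0" unfolding g'(2) using v by (simp add: eval_at_prod eval_at_linear)
      hence "v \<in> V" using fin by auto
      thus ?thesis by (auto simp: V_def)
    qed
    show "\<exists>R. ramify m (fps2_of_cps g) = (vary - fps_const u) * R \<and> eval_at fps_X u R \<noteq> 0"
    proof (intro exI conjI)
      show "ramify m (fps2_of_cps g) = (vary - fps_const u) * (\<Prod>v\<in>V - {u}. vary - fps_const v)"
        unfolding g g'(2) by (rule prod.remove[OF fin uV])
      show "eval_at fps_X u (\<Prod>v\<in>V - {u}. vary - fps_const v) \<noteq> 0"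
        using fin u by (simp add: eval_at_prod eval_at_linear)
    qed
  qed
qed

section \<open>Factorization and invariant branches\<close>

lemma ramify_ramify: "m \<ge> 1 \<Longrightarrow> M \<ge> 1 \<Longrightarrow> ramify M (ramify m F) = ramify (m * M) F"
  by (subst subst_subst) (auto simp: varx_power_nth_00 subst_power subst_varx power_mult[symmetric] mult.commute simp del: fps_const_power)

lemma ramify_linear: "m \<ge> 1 \<Longrightarrow> ramify m (vary - fps_const u) = vary - fps_const (u oo fps_X ^ m)"
  using subst_fps_const_left[of "fps_X ^ m" vary u]
  by (simp add: subst_diff varx_power varx_power_nth_00)

text \<open>Each Puiseux root lowers the order of \<open>F(0, y)\<close> by one. The quotient may
  need a further ramification \<open>M\<close>, along which the root found first is pulled back to
  \<open>u(t^M)\<close>. The list may contain repetitions.\<close>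

lemma puiseux_split:
  assumes "convergent_fps2 F" "at_x0 F \<noteq> 0"
  shows "\<exists>M us Q. M \<ge> 1 \<and> length us = subdegree (at_x0 F) \<and> (\<forall>u\<in>set us. convergent_fps u \<and> u $ 0 = 0) \<and>
    ramify M F = (\<Prod>u\<leftarrow>us. vary - fps_const u) * Q"
  using assms
proof (induction "subdegree (at_x0 F)" arbitrary: F)
  case 0
  thus ?case by (intro exI[of _ 1] exI[of _ "[]"] exI[of _ "ramify 1 F"]) auto
next
  case (Suc d F)
  have "at_x0 F $ 0 = 0" using Suc.hyps(2) by (intro nth_less_subdegree_zero) simp
  hence "F $ 0 $ 0 = 0" by simp
  then obtain m u where mu: "m \<ge> 1" "u $ 0 = 0" "convergent_fps u" "eval_at (fps_X ^ m) u F = 0"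
    using newton_puiseux[OF Suc.prems] by blast
  have H: "convergent_fps2 (ramify m F)" by (rule convergent_fps2_ramify[OF mu(1) Suc.prems(1)])
  have "eval_at fps_X u (ramify m F) = 0"
    using mu by (subst eval_at_ramify) auto
  then obtain Q where Q: "convergent_fps2 Q" "ramify m F = (vary - fps_const u) * Q"
    using root_imp_linear_factor[OF H mu(3,2)] by blast
  have at: "at_x0 F = fps_X * at_x0 Q"
    using arg_cong[OF Q(2), of at_x0] mu(2) unfolding at_x0_ramify[OF mu(1)]
    by (simp add: at_x0_mult at_x0_diff)
  hence Qnz: "at_x0 Q \<noteq> 0" using Suc.prems by auto
  hence "subdegree (at_x0 Q) = d" using Suc.hyps(2) by (simp add: at)
  then obtain M us R where M: "M \<ge> 1" "length us = d" "\<forall>u\<in>set us. convergent_fps u \<and> u $ 0 = 0"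
      "ramify M Q = (\<Prod>u\<leftarrow>us. vary - fps_const u) * R"
    using Suc.hyps(1)[OF _ Q(1) Qnz] by metis
  define v where "v = u oo fps_X ^ M"
  have "convergent_fps2 (varx ^ M)" by (intro convergent_fps2_intros)
  hence v: "convergent_fps v" "v $ 0 = 0"
    using mu fps_X_power_nth_0[OF M(1)] unfolding v_def
    by (auto intro!: convergent_fps_compose simp: varx_power simp del: fps_const_power)
  have "ramify (m * M) F = ramify M (vary - fps_const u) * ramify M Q"
    unfolding ramify_ramify[OF mu(1) M(1), symmetric] Q(2) by (rule ramify_mult[OF M(1)])
  also have "\<dots> = (\<Prod>u\<leftarrow>v # us. vary - fps_const u) * R"
    unfolding M(4) ramify_linear[OF M(1)] by (simp add: v_def mult.assoc)
  finally have "ramify (m * M) F = (\<Prod>u\<leftarrow>v # us. vary - fps_const u) * R" .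
  moreover have "m * M \<ge> 1" "length (v # us) = subdegree (at_x0 F)" using mu M Suc.hyps(2) by auto
  moreover have "\<forall>u\<in>set (v # us). convergent_fps u \<and> u $ 0 = 0" using v M(3) by auto
  ultimately show ?case by blast
qed

text \<open>Let \<open>F = p q\<close> with \<open>p\<close> the prime of the branch. Cancelling one
  factor \<open>y - u\<close> leaves \<open>R q = (y - u) Q\<close>, where \<open>R\<close> does not
  vanish along \<open>u\<close> because \<open>u\<close> is a simple root of \<open>p\<close>. So
  \<open>q\<close> vanishes there, and \<open>p\<close> divides it again.\<close>

lemma square_dvd_of_double_root:
  assumes m: "m \<ge> 1" and u: "convergent_fps u" "u $ 0 = 0"
    and eq: "ramify m (fps2_of_cps F) = (vary - fps_const u) ^ 2 * Q"
  obtains p where "prime_elem p" "p ^ 2 dvd F"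
proof -
  obtain p where p: "prime_elem p" "\<And>F. p dvd F \<longleftrightarrow> eval_at (fps_X ^ m) u (fps2_of_cps F) = 0"
      "\<exists>R. ramify m (fps2_of_cps p) = (vary - fps_const u) * R \<and> eval_at fps_X u R \<noteq> 0"
    using branch_prime[OF m u] by metis
  obtain R where R: "ramify m (fps2_of_cps p) = (vary - fps_const u) * R" "eval_at fps_X u R \<noteq> 0"
    using p(3) by blast
  have X0: "(fps_X :: complex fps) $ 0 = 0" by simp
  have lin: "eval_at fps_X u (vary - fps_const u) = 0" using u by (simp add: eval_at_linear)
  have ev: "p dvd H \<longleftrightarrow> eval_at fps_X u (ramify m (fps2_of_cps H)) = 0" for H
    unfolding p(2) eval_at_ramify[OF m u(2) X0] ..
  have "p dvd F"
    unfolding ev eq power2_eq_square eval_at_mult[OF X0 u(2)] lin by simp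
  then obtain q where q: "F = p * q" by (elim dvdE)
  have "(vary - fps_const u) * (R * ramify m (fps2_of_cps q)) = (vary - fps_const u) * ((vary - fps_const u) * Q)"
    using eq unfolding q times_cps.rep_eq ramify_mult[OF m] R(1) by (simp add: power2_eq_square mult.assoc)
  hence "R * ramify m (fps2_of_cps q) = (vary - fps_const u) * Q"
    using linear_neq_0[of u] by (metis mult_cancel_left)
  hence "eval_at fps_X u R * eval_at fps_X u (ramify m (fps2_of_cps q)) = 0"
    by (metis eval_at_mult[OF X0 u(2)] lin mult_zero_left)
  hence "p dvd q" using R(2) by (simp add: ev)
  hence "p ^ 2 dvd F" unfolding q power2_eq_square by (intro mult_dvd_mono) auto
  thus ?thesis using p(1) that by blast
qed

lemma squarefree_imp_distinct_roots:
  assumes m: "m \<ge> 1" and us: "\<And>u. u \<in> set us \<Longrightarrow> convergent_fps u \<and> u $ 0 = 0"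
    and eq: "ramify m (fps2_of_cps F) = (\<Prod>u\<leftarrow>us. vary - fps_const u) * Q"
    and sqf: "\<And>p. prime_elem p \<Longrightarrow> \<not> p ^ 2 dvd F"
  shows "distinct us"
proof (rule ccontr)
  assume "\<not> distinct us"
  then obtain xs ys zs u where us_eq: "us = xs @ [u] @ ys @ [u] @ zs"
    using not_distinct_decomp by blast
  have u: "convergent_fps u" "u $ 0 = 0" using us[of u] us_eq by auto
  have "ramify m (fps2_of_cps F) = (vary - fps_const u) ^ 2 *
     ((\<Prod>u\<leftarrow>xs. vary - fps_const u) * (\<Prod>u\<leftarrow>ys. vary - fps_const u) * (\<Prod>u\<leftarrow>zs. vary - fps_const u) * Q)"
    unfolding eq us_eq by (simp add: power2_eq_square mult_ac)
  then obtain p where "prime_elem p" "p ^ 2 dvd F" using square_dvd_of_double_root[OF m u] by metis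
  thus False using sqf by blast
qed

text \<open>A Puiseux root supplies a prime divisor, and dividing by it lowers the order of
  \<open>F(0, y)\<close>, until a unit remains.\<close>

lemma prime_factorization_regular:
  assumes "at_x0 (fps2_of_cps F) \<noteq> 0"
  shows "\<exists>A c. (\<forall>p\<in>#A. prime_elem p) \<and> c dvd 1 \<and> F = c * prod_mset A"
  using assms
proof (induction "subdegree (at_x0 (fps2_of_cps F))" arbitrary: F rule: less_induct)
  case (less F)
  show ?case
  proof (cases "fps2_of_cps F $ 0 $ 0 = 0")
    case False
    thus ?thesis by (intro exI[of _ "{#}"] exI[of _ F]) (auto simp: cps_unit_iff)
  next
    case True
    then obtain m u where mu: "m \<ge> 1" "u $ 0 = 0" "convergent_fps u" "eval_at (fps_X ^ m) u (fps2_of_cps F) = 0"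
      using newton_puiseux[OF convergent_fps2_of_cps less.prems] by blast
    obtain p where p: "prime_elem p" "p dvd F"
      using branch_prime[OF mu(1,3,2)] mu(4) by metis
    obtain q where q: "F = p * q" using p by (elim dvdE)
    have at: "at_x0 (fps2_of_cps F) = at_x0 (fps2_of_cps p) * at_x0 (fps2_of_cps q)"
      by (simp add: q times_cps.rep_eq at_x0_mult)
    have nz: "at_x0 (fps2_of_cps p) \<noteq> 0" "at_x0 (fps2_of_cps q) \<noteq> 0"
      using less.prems at by auto
    have "fps2_of_cps p $ 0 $ 0 = 0" using p(1) cps_unit_iff[of p] by (auto simp: prime_elem_def)
    hence "subdegree (at_x0 (fps2_of_cps p)) > 0" using nz by (metis at_x0_nth gr0I subdegree_eq_0_iff)
    hence "subdegree (at_x0 (fps2_of_cps q)) < subdegree (at_x0 (fps2_of_cps F))"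
      using nz by (simp add: at)
    then obtain A c where A: "\<forall>p\<in>#A. prime_elem p" "c dvd 1" "q = c * prod_mset A"
      using less.hyps nz by blast
    show ?thesis
      by (intro exI[of _ "add_mset p A"] exI[of _ c]) (use A p q in \<open>auto simp: mult_ac\<close>)
  qed
qed

section \<open>Invariant curves: the Leibniz rule and pullbacks\<close>

lemma fps2_of_cps_dx: "fps2_of_cps (cps_dx F) = dx (fps2_of_cps F)"
  by (simp add: cps_dx.rep_eq dx_def)

lemma form_wedge_d_mult:
  "form_wedge W (form_d (F * G)) = F * form_wedge W (form_d G) + G * form_wedge W (form_d F)"
proof -
  have "cps_dx (F * G) = cps_dx F * G + F * cps_dx G"
    unfolding fps2_of_cps_inject[symmetric]
    by (simp add: fps2_of_cps_dx times_cps.rep_eq plus_cps.rep_eq dx_mult)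
  moreover have "cps_dy (F * G) = cps_dy F * G + F * cps_dy G"
    unfolding fps2_of_cps_inject[symmetric]
    by (simp add: cps_dy.rep_eq times_cps.rep_eq plus_cps.rep_eq)
  ultimately show ?thesis by (simp add: form_wedge_def form_d_def algebra_simps)
qed

text \<open>For \<open>F = p q\<close>, Leibniz shows that \<open>p\<close> divides \<open>q\<close>
  times the wedge of \<open>W\<close> with \<open>dp\<close>, and \<open>p\<close> does not divide
  \<open>q\<close>.\<close>

lemma prime_factor_invariant:
  assumes "F dvd form_wedge W (form_d F)" "prime_elem p" "p dvd F" "\<not> p ^ 2 dvd F"
  shows "p dvd form_wedge W (form_d p)"
proof -
  obtain q where q: "F = p * q" using assms by (elim dvdE)
  have "\<not> p dvd q" using assms(4) unfolding q power2_eq_square by (auto intro: mult_dvd_mono)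
  moreover have "p dvd p * form_wedge W (form_d q) + q * form_wedge W (form_d p)"
    using assms(1,3) dvd_trans unfolding q form_wedge_d_mult[symmetric] by blast
  hence "p dvd q * form_wedge W (form_d p)" by (simp add: dvd_add_right_iff)
  ultimately show ?thesis using assms(2) by (simp add: prime_elem_dvd_mult_iff)
qed

text \<open>The pullback of \<open>W\<close> to the parametrised curve \<open>(t\<^sup>m, u(t))\<close> vanishes.\<close>
definition integral_curve :: "oneform \<Rightarrow> nat \<Rightarrow> complex fps \<Rightarrow> bool" where
  "integral_curve W m u \<longleftrightarrow>
     eval_at (fps_X ^ m) u (fps2_of_cps (fst W)) * fps_deriv (fps_X ^ m) +
     eval_at (fps_X ^ m) u (fps2_of_cps (snd W)) * fps_deriv u = 0"

text \<open>Along the curve \<open>p_x x' + p_y u' = 0\<close>, so \<open>p_y\<close> times the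
  pullback of \<open>W\<close> equals \<open>x'\<close> times the wedge coefficient. Neither
  \<open>p_y\<close> nor \<open>x'\<close> vanishes along the curve, hence both conditions
  agree.\<close>

lemma branch_separatrix_iff:
  assumes m: "m \<ge> 1" and u: "convergent_fps u" "u $ 0 = 0"
    and p: "prime_elem p" "\<And>F. p dvd F \<longleftrightarrow> eval_at (fps_X ^ m) u (fps2_of_cps F) = 0"
      "at_x0 (fps2_of_cps p) \<noteq> 0"
  shows "p dvd form_wedge W (form_d p) \<longleftrightarrow> integral_curve W m u"
proof -
  have m0: "(fps_X ^ m) $ 0 = (0 :: complex)" using m by simp
  define E where "E F = eval_at (fps_X ^ m) u (fps2_of_cps F)" for F
  define x' where "x' = fps_deriv (fps_X ^ m :: complex fps)"
  have x': "x' \<noteq> 0"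
  proof
    assume "x' = 0"
    hence "(fps_X ^ m :: complex fps) $ m = 0" using m by (auto simp: x'_def fps_deriv_eq_0_iff)
    thus False by simp
  qed
  have "E p = 0" unfolding E_def p(2)[symmetric] by simp
  hence "fps_deriv (E p) = 0" by simp
  hence chain: "E (cps_dx p) * x' + E (cps_dy p) * fps_deriv u = 0"
    unfolding E_def deriv_eval_at[OF m0 u(2)] fps2_of_cps_dx cps_dy.rep_eq x'_def .
  have wedge: "E (form_wedge W (form_d p)) = E (fst W) * E (cps_dy p) - E (snd W) * E (cps_dx p)"
    by (simp add: E_def form_wedge_def form_d_def minus_cps.rep_eq times_cps.rep_eq eval_at_diff[OF m0 u(2)] eval_at_mult[OF m0 u(2)])
  have key: "E (cps_dy p) * (E (fst W) * x' + E (snd W) * fps_deriv u) = x' * E (form_wedge W (form_d p))"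
  proof -
    have "E (cps_dy p) * (E (fst W) * x' + E (snd W) * fps_deriv u) - x' * E (form_wedge W (form_d p)) =
        E (snd W) * (E (cps_dx p) * x' + E (cps_dy p) * fps_deriv u)"
      unfolding wedge by (simp add: algebra_simps)
    thus ?thesis using chain by simp
  qed
  have "E (cps_dy p) \<noteq> 0"
  proof
    assume "E (cps_dy p) = 0"
    hence "p dvd cps_dy p" unfolding p(2) E_def .
    then obtain Q where Q: "cps_dy p = p * Q" by (elim dvdE)
    \<comment> \<open>On \<open>x = 0\<close> the divisibility makes \<open>h\<close> divide
      \<open>h'\<close>, which is impossible: \<open>h\<close> has positive order, \<open>p\<close>
      being no unit, and differentiation lowers it by one.\<close>
    define h where "h = at_x0 (fps2_of_cps p)"
    have hnz: "h \<noteq> 0" using p(3) by (simp add: h_def)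
    have "at_x0 (dy F) = fps_deriv (at_x0 F)" for F
      by (rule fps_ext) simp
    hence hQ: "fps_deriv h = h * at_x0 (fps2_of_cps Q)"
      using Q unfolding h_def by (metis at_x0_mult cps_dy.rep_eq times_cps.rep_eq)
    have "h $ 0 = 0" using p(1) cps_unit_iff[of p] by (auto simp: prime_elem_def h_def)
    hence "subdegree h \<noteq> 0" using hnz by (auto simp: subdegree_eq_0_iff)
    then obtain d where d: "subdegree h = Suc d" by (cases "subdegree h") auto
    have "fps_deriv h $ d = of_nat (Suc d) * h $ Suc d" by simp
    hence nz: "fps_deriv h $ d \<noteq> 0"
      using nth_subdegree_nonzero[OF hnz] d by (simp del: of_nat_Suc)
    hence "subdegree (fps_deriv h) \<le> d" by (rule subdegree_leI)
    moreover have "fps_deriv h \<noteq> 0" using nz by (metis fps_zero_nth)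
    hence "subdegree (fps_deriv h) \<ge> subdegree h" unfolding hQ by simp
    ultimately show False using d by simp
  qed
  with key x' have "E (fst W) * x' + E (snd W) * fps_deriv u = 0 \<longleftrightarrow> E (form_wedge W (form_d p)) = 0"
    by auto
  thus ?thesis unfolding p(2) integral_curve_def E_def x'_def by blast
qed

text \<open>If \<open>g(0, y) = 0\<close>, then \<open>g\<close> is \<open>x\<close> up to a unit;
  invariance of \<open>x = 0\<close> means that \<open>x\<close> divides \<open>snd W\<close>, which
  the assumption on \<open>S(0, y)\<close> excludes.\<close>

lemma separatrix_regular:
  assumes g: "irreducible g" "g dvd form_wedge W (form_d g)" and S: "at_x0 (fps2_of_cps (snd W)) \<noteq> 0"
  shows "at_x0 (fps2_of_cps g) \<noteq> 0"
proof
  assume at: "at_x0 (fps2_of_cps g) = 0"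
  define x where "x = Abs_cps varx"
  have x: "fps2_of_cps x = varx" by (simp add: x_def Abs_cps_inverse)
  have "fps2_of_cps g = varx ^ 1 * xshift 1 (fps2_of_cps g)"
    by (rule xshift_eq) (use at in \<open>auto simp: fps_eq_iff\<close>)
  hence "x dvd g" unfolding cps_dvd_iff x using convergent_fps2_xshift[OF convergent_fps2_of_cps] by auto
  then obtain q where q: "g = x * q" by (elim dvdE)
  have "\<not> x dvd 1" by (simp add: cps_unit_iff x)
  hence "q dvd 1" using irreducibleD[OF g(1) q] by blast
  have "x dvd x * form_wedge W (form_d q) + q * form_wedge W (form_d x)"
    using g(2) unfolding form_wedge_d_mult[symmetric] q by (rule dvd_mult_left)
  hence "x dvd q * form_wedge W (form_d x)" by (simp add: dvd_add_right_iff)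
  hence "x dvd form_wedge W (form_d x)" using \<open>q dvd 1\<close> by (simp add: dvd_mult_unit_iff')
  moreover have "cps_dx x = 1" "cps_dy x = 0"
    unfolding fps2_of_cps_inject[symmetric] by (simp_all add: fps2_of_cps_dx cps_dy.rep_eq x one_cps.rep_eq zero_cps.rep_eq)
  ultimately have "x dvd snd W" by (simp add: form_wedge_def form_d_def)
  then obtain Q where "fps2_of_cps (snd W) = varx * Q" unfolding cps_dvd_iff x by blast
  hence "at_x0 (fps2_of_cps (snd W)) = 0" by (simp add: at_x0_mult)
  thus False using S by simp
qed

section \<open>Counting integral curves\<close>

text \<open>
  Integral curves \<open>y = u(x)\<close> through the origin of the logarithmic form \<open>\<alpha> dx / x + \<beta> dy\<close>.
\<close>
definition log_solution :: "pser \<Rightarrow> pser \<Rightarrow> complex fps \<Rightarrow> bool" where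
  "log_solution \<alpha> \<beta> u \<longleftrightarrow> u $ 0 = 0 \<and> eval_at fps_X u \<alpha> + eval_at fps_X u \<beta> * (fps_X * fps_deriv u) = 0"

text \<open>With \<open>u = x (w + c)\<close> one has \<open>x u' = u + x (x w')\<close>, so
  \<open>\<alpha> + \<beta> x u'\<close> becomes
  \<open>(\<alpha> + u \<beta>) + x \<beta> (x w')\<close>. The logarithmic shape thus survives
  blowing up, which is the reason for writing the equation with \<open>dx / x\<close>.\<close>

lemma log_solution_blowup:
  fixes \<alpha> \<beta> :: pser and c :: complex and w :: "complex fps"
  assumes A: "subst varx (varx ^ 1 * (vary + cst c)) (\<alpha> + vary * \<beta>) = varx ^ e * A"
    and B: "subst varx (varx ^ 1 * (vary + cst c)) (varx * \<beta>) = varx ^ e * B"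
    and w: "w $ 0 = 0"
  shows "log_solution \<alpha> \<beta> (fps_X * (w + fps_const c)) \<longleftrightarrow> log_solution A B w"
proof -
  define U where "U = varx ^ 1 * (vary + cst c)"
  define u where "u = fps_X * (w + fps_const c)"
  have X0: "(fps_X :: complex fps) $ 0 = 0" by simp
  have u0: "u $ 0 = 0" by (simp add: u_def)
  have U0: "U $ 0 $ 0 = 0" by (simp add: U_def)
  have pU: "eval_at fps_X w U = u"
    unfolding U_def u_def eval_at_mult[OF X0 w] eval_at_varx_power[OF X0 w] eval_at_add[OF X0 w] eval_at_vary[OF X0 w] eval_at_const[OF X0 w]
    by simp
  have blow: "eval_at fps_X w (subst varx U F) = eval_at fps_X u F" for F
    unfolding eval_at_subst[OF X0 w varx_nth_00 U0] pU eval_at_varx[OF X0 w] ..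
  have a: "fps_X ^ e * eval_at fps_X w A = eval_at fps_X u \<alpha> + u * eval_at fps_X u \<beta>"
    using arg_cong[OF A, of "eval_at fps_X w"]
    unfolding U_def[symmetric] blow eval_at_mult[OF X0 w] eval_at_varx_power[OF X0 w]
      eval_at_add[OF X0 u0] eval_at_mult[OF X0 u0] eval_at_vary[OF X0 u0] by simp
  have b: "fps_X ^ e * eval_at fps_X w B = fps_X * eval_at fps_X u \<beta>"
    using arg_cong[OF B, of "eval_at fps_X w"]
    unfolding U_def[symmetric] blow eval_at_mult[OF X0 w] eval_at_varx_power[OF X0 w]
      eval_at_mult[OF X0 u0] eval_at_varx[OF X0 u0] by simp
  have du: "fps_X * fps_deriv u = u + fps_X * (fps_X * fps_deriv w)"
    by (simp add: u_def algebra_simps)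
  have "fps_X ^ e * (eval_at fps_X w A + eval_at fps_X w B * (fps_X * fps_deriv w)) =
      fps_X ^ e * eval_at fps_X w A + fps_X ^ e * eval_at fps_X w B * (fps_X * fps_deriv w)"
    by (simp add: algebra_simps)
  also have "\<dots> = eval_at fps_X u \<alpha> + eval_at fps_X u \<beta> * (fps_X * fps_deriv u)"
    unfolding a b du by (simp add: algebra_simps)
  finally have "fps_X ^ e * (eval_at fps_X w A + eval_at fps_X w B * (fps_X * fps_deriv w)) =
      eval_at fps_X u \<alpha> + eval_at fps_X u \<beta> * (fps_X * fps_deriv u)" .
  moreover have "(fps_X ^ e :: complex fps) \<noteq> 0" by simp
  ultimately show ?thesis unfolding log_solution_def u_def[symmetric]
    using w u0 by (metis mult_eq_0_iff)
qed

lemma log_solution_nth_00: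
  assumes "log_solution \<alpha> \<beta> u" shows "\<alpha> $ 0 $ 0 = 0"
proof -
  have u: "u $ 0 = 0" "eval_at fps_X u \<alpha> + eval_at fps_X u \<beta> * (fps_X * fps_deriv u) = 0"
    using assms by (auto simp: log_solution_def)
  have "(eval_at fps_X u \<alpha> + eval_at fps_X u \<beta> * (fps_X * fps_deriv u)) $ 0 = eval_at fps_X u \<alpha> $ 0" by simp
  thus ?thesis using u by (simp add: eval_at_nth_0)
qed

lemma fps_X_shift_decomp: "u $ 0 = 0 \<Longrightarrow> u = fps_X * ((fps_shift 1 u - fps_const c) + fps_const c)"
  for u :: "complex fps"
  by (rule fps_ext) simp

text \<open>
  Induction on the maximal contact \<open>K\<close> of the solutions, by blowing up \<open>u = x (w + c)\<close>. Let \<open>e\<close> be the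
  order of \<open>(\<alpha>, y \<beta>)\<close>, and \<open>\<Phi>\<close>, \<open>\<Psi>\<close> the parts of \<open>\<alpha> + y \<beta>\<close>, \<open>x \<beta>\<close> of degree \<open>e\<close>. If \<open>\<Phi> = 0\<close>
  (the dicritical case), every \<open>c\<close> with \<open>\<Psi>(c) \<noteq> 0\<close> is the tangent of a convergent solution, so there
  are infinitely many. Otherwise at most \<open>order c \<Phi>\<close> solutions have tangent \<open>c\<close>, and these orders
  sum up to at most \<open>degree \<Phi> \<le> e \<le> H\<close>.
\<close>
lemma log_solution_count:
  assumes "convergent_fps2 \<alpha>" "convergent_fps2 \<beta>" "finite Z" "\<And>u. u \<in> Z \<Longrightarrow> log_solution \<alpha> \<beta> u"
    and "\<And>u v. u \<in> Z \<Longrightarrow> v \<in> Z \<Longrightarrow> u \<noteq> v \<Longrightarrow> subdegree (u - v) \<le> K"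
    and "finite {u. convergent_fps u \<and> log_solution \<alpha> \<beta> u}"
    and "\<alpha> $ H $ 0 \<noteq> 0 \<or> H \<ge> 1 \<and> \<beta> $ (H - 1) $ 0 \<noteq> 0"
  shows "card Z \<le> H"
  using assms
proof (induction K arbitrary: \<alpha> \<beta> Z H)
  case (0 \<alpha> \<beta> Z H)
  \<comment> \<open>Two distinct solutions both vanish at 0 and so have contact at least 1; for
    \<open>K = 0\<close> there is at most one. If one exists, \<open>\<alpha>(0,0) = 0\<close> and
    therefore \<open>H \<ge> 1\<close>.\<close>
  have "u = v" if "u \<in> Z" "v \<in> Z" for u v
  proof (rule ccontr)
    assume "u \<noteq> v"
    hence "subdegree (u - v) = 0" using 0 that by simp
    moreover have "(u - v) $ 0 = 0" using 0(4) that by (simp add: log_solution_def)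
    ultimately show False using \<open>u \<noteq> v\<close> by (metis nth_subdegree_nonzero right_minus_eq)
  qed
  hence "card Z \<le> 1" using 0(3) by (simp add: card_le_Suc0_iff_eq)
  moreover have "H \<ge> 1" if "Z \<noteq> {}"
    using that 0(4,7) log_solution_nth_00 by (cases "H = 0") auto
  ultimately show ?case by (cases "Z = {}") auto
next
  case (Suc K \<alpha> \<beta> Z H)
  show ?case
  proof (cases "Z = {}")
    case False
    have \<alpha>00: "\<alpha> $ 0 $ 0 = 0" using False Suc.prems(4) log_solution_nth_00 by blast
    have s1: "(1 :: nat) \<le> 1" by simp
    define a where "a = \<alpha> + vary * \<beta>"
    define b where "b = varx * \<beta>"
    have vary_nth: "(vary * \<beta>) $ j = (if j = 0 then 0 else \<beta> $ (j - 1))" for j by simp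
    have hb: "weighted_part 1 k (vary * \<beta>) = pCons 0 (weighted_part 1 k b)" for k
    proof (rule poly_eqI)
      fix j
      show "coeff (weighted_part 1 k (vary * \<beta>)) j = coeff (pCons 0 (weighted_part 1 k b)) j"
        by (cases j) (auto simp: coeff_weighted_part coeff_pCons b_def)
    qed
    have ha: "weighted_part 1 k a = weighted_part 1 k \<alpha> + pCons 0 (weighted_part 1 k b)" for k
      unfolding hb[symmetric] by (rule poly_eqI) (simp add: coeff_weighted_part a_def)
    define nz where "nz k \<longleftrightarrow> weighted_part 1 k \<alpha> \<noteq> 0 \<or> weighted_part 1 k b \<noteq> 0" for k
    have nzH: "nz H"
    proof -
      have "coeff (weighted_part 1 H \<alpha>) H \<noteq> 0 \<or> coeff (weighted_part 1 H (vary * \<beta>)) H \<noteq> 0"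
        using Suc.prems(7) unfolding coeff_weighted_part[OF s1] vary_nth by auto
      thus ?thesis unfolding nz_def hb by auto
    qed
    define e where "e = (LEAST k. nz k)"
    have nze: "nz e" unfolding e_def by (rule LeastI[of nz, OF nzH])
    have eH: "e \<le> H" unfolding e_def by (rule Least_le[of nz, OF nzH])
    have z: "weighted_part 1 k a = 0" "weighted_part 1 k b = 0" if "k < e" for k
    proof -
      have "\<not> nz k" using not_less_Least[of k nz] that unfolding e_def by blast
      thus "weighted_part 1 k a = 0" "weighted_part 1 k b = 0" using ha[of k] unfolding nz_def by simp_all
    qed
    define \<Phi> where "\<Phi> = weighted_part 1 e a"
    define \<Psi> where "\<Psi> = weighted_part 1 e b"
    define A where "A c = xshift e (subst varx (varx ^ 1 * (vary + cst c)) a)" for c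
    define B where "B c = xshift e (subst varx (varx ^ 1 * (vary + cst c)) b)" for c
    have Aeq: "subst varx (varx ^ 1 * (vary + cst c)) a = varx ^ e * A c" for c
      unfolding A_def by (rule xshift_eq) (unfold subst_blowup_nth[OF s1], simp add: z del: One_nat_def)
    have Beq: "subst varx (varx ^ 1 * (vary + cst c)) b = varx ^ e * B c" for c
      unfolding B_def by (rule xshift_eq) (unfold subst_blowup_nth[OF s1], simp add: z del: One_nat_def)
    have conv_blow: "convergent_fps2 (subst varx (varx ^ 1 * (vary + cst c)) F)" if "convergent_fps2 F" for c F
      by (intro convergent_fps2_subst convergent_fps2_intros that varx_nth_00) simp
    have convA: "convergent_fps2 (A c)" for c
      unfolding A_def a_def using Suc.prems
      by (intro convergent_fps2_xshift conv_blow convergent_fps2_add convergent_fps2_mult convergent_fps2_X)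
    have convB: "convergent_fps2 (B c)" for c
      unfolding B_def b_def using Suc.prems
      by (intro convergent_fps2_xshift conv_blow convergent_fps2_mult convergent_fps2_varx)
    have atA: "at_x0 (A c) = fps_of_poly (pcompose \<Phi> [:c, 1:])" for c
      by (rule fps_ext) (unfold A_def \<Phi>_def at_x0_nth xshift_nth subst_blowup_nth[OF s1], simp)
    have atB: "at_x0 (B c) = fps_of_poly (pcompose \<Psi> [:c, 1:])" for c
      by (rule fps_ext) (unfold B_def \<Psi>_def at_x0_nth xshift_nth subst_blowup_nth[OF s1], simp)
    have sol: "log_solution \<alpha> \<beta> (fps_X * (w + fps_const c)) \<longleftrightarrow> log_solution (A c) (B c) w" if "w $ 0 = 0" for w c
      by (rule log_solution_blowup[OF Aeq[unfolded a_def] Beq[unfolded b_def] that])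
    have conv_up: "convergent_fps (fps_X * (w + fps_const c))" if "convergent_fps w" for w c
      using convergent_fps2_mult[OF convergent_fps2_varx convergent_fps2_add[OF that convergent_fps2_cst[of c]]] by simp
    show ?thesis
    proof (cases "\<Phi> = 0")
      case True
      have "\<Psi> \<noteq> 0" using nze True ha[of e] by (auto simp: nz_def \<Phi>_def \<Psi>_def)
      \<comment> \<open>As \<open>\<Phi> = 0\<close>, the whole transformed equation is divisible by
        \<open>x\<close>. The quotient is an ordinary differential equation in which
        \<open>w'\<close> has the coefficient \<open>\<Psi>(c)\<close> at the origin. Distinct
        \<open>c\<close> give distinct \<open>u\<close>, since \<open>c\<close> is the linear
        coefficient.\<close>
      have ex: "\<exists>u. (convergent_fps u \<and> log_solution \<alpha> \<beta> u) \<and> u $ 1 = c" if c: "poly \<Psi> c \<noteq> 0" for c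
      proof -
        have "B c $ 0 $ 0 \<noteq> 0"
          using arg_cong[OF atB[of c], of "\<lambda>f. f $ 0"] c by (simp add: poly_pcompose flip: poly_0_coeff_0)
        then obtain w where w: "w $ 0 = 0" "convergent_fps w"
            "eval_at fps_X w (xshift 1 (A c)) + eval_at fps_X w (B c) * fps_deriv w = 0"
          using ode_solution[OF convergent_fps2_xshift[OF convA] convB] by metis
        have "at_x0 (A c) = 0" using atA[of c] True by simp
        hence "A c = varx ^ 1 * xshift 1 (A c)" by (intro xshift_eq) (auto simp: fps_eq_iff)
        hence "eval_at fps_X w (A c) = fps_X * eval_at fps_X w (xshift 1 (A c))"
          using w(1) by (metis fps_X_nth eval_at_mult eval_at_varx power_one_right zero_neq_one)
        hence "eval_at fps_X w (A c) + eval_at fps_X w (B c) * (fps_X * fps_deriv w) =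
            fps_X * (eval_at fps_X w (xshift 1 (A c)) + eval_at fps_X w (B c) * fps_deriv w)"
          by (simp add: algebra_simps)
        hence "log_solution (A c) (B c) w" using w by (simp add: log_solution_def)
        hence "log_solution \<alpha> \<beta> (fps_X * (w + fps_const c))" using sol w by blast
        moreover have "(fps_X * (w + fps_const c)) $ 1 = c" using w by simp
        ultimately show ?thesis using conv_up[OF w(2)] by blast
      qed
      hence "{c. poly \<Psi> c \<noteq> 0} \<subseteq> (\<lambda>u. u $ 1) ` {u. convergent_fps u \<and> log_solution \<alpha> \<beta> u}" by fastforce
      hence "finite {c. poly \<Psi> c \<noteq> 0}" using Suc.prems(6) finite_surj by blast
      moreover have "finite {c. poly \<Psi> c = 0}" using \<open>\<Psi> \<noteq> 0\<close> by (rule poly_roots_finite)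
      ultimately have "finite ({c. poly \<Psi> c \<noteq> 0} \<union> {c. poly \<Psi> c = 0})" by blast
      moreover have "{c. poly \<Psi> c \<noteq> 0} \<union> {c. poly \<Psi> c = 0} = UNIV" by blast
      ultimately show ?thesis using infinite_UNIV_char_0[where 'a = complex] by simp
    next
      case nonzero: False
      define Zc where "Zc c = {u \<in> Z. u $ 1 = c}" for c
      define low where "low c u = fps_shift 1 u - fps_const c" for c and u :: "complex fps"
      have up: "u = fps_X * (low c u + fps_const c)" "low c u $ 0 = 0" if "u \<in> Zc c" for u c
        using that Suc.prems(4) fps_X_shift_decomp[of u c] by (auto simp: low_def Zc_def log_solution_def)
      \<comment> \<open>The blow-up lowers every contact by one, so the induction hypothesis applies
        with \<open>order c \<Phi>\<close> as the new \<open>H\<close>. If \<open>c\<close> is not a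
        root, this order is 0 and no solution in \<open>Z\<close> has tangent
        \<open>c\<close>.\<close>
      have bound: "card (Zc c) \<le> order c \<Phi>" for c
      proof -
        have inj: "inj_on (low c) (Zc c)" by (rule inj_onI) (metis up(1))
        have "card (low c ` Zc c) \<le> order c \<Phi>"
        proof (rule Suc.IH[OF convA[of c] convB[of c]])
          show "finite (low c ` Zc c)" using Suc.prems(3) by (simp add: Zc_def)
          show "log_solution (A c) (B c) w" if "w \<in> low c ` Zc c" for w
          proof -
            obtain u where u: "u \<in> Zc c" "w = low c u" using \<open>w \<in> low c ` Zc c\<close> by blast
            have "log_solution \<alpha> \<beta> u" using u(1) Suc.prems(4) by (simp add: Zc_def)
            hence "log_solution \<alpha> \<beta> (fps_X * (low c u + fps_const c))" using up(1)[OF u(1)] by metis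
            thus ?thesis unfolding u(2) sol[OF up(2)[OF u(1)]] .
          qed
          show "subdegree (v - w) \<le> K" if vw: "v \<in> low c ` Zc c" "w \<in> low c ` Zc c" "v \<noteq> w" for v w
          proof -
            obtain u1 u2 where u12: "u1 \<in> Zc c" "u2 \<in> Zc c" "v = low c u1" "w = low c u2" using vw by blast
            have "u1 - u2 = fps_X * (v - w)"
              using up(1)[OF u12(1)] up(1)[OF u12(2)] u12(3,4) by (metis add_diff_cancel_right right_diff_distrib)
            moreover have "u1 \<noteq> u2" using u12 vw by auto
            ultimately have "subdegree (fps_X * (v - w)) \<le> Suc K"
              using Suc.prems(5)[of u1 u2] u12 by (auto simp: Zc_def)
            thus ?thesis using vw(3) by simp
          qed
          have "(\<lambda>w. fps_X * (w + fps_const c)) ` {w. convergent_fps w \<and> log_solution (A c) (B c) w}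
              \<subseteq> {u. convergent_fps u \<and> log_solution \<alpha> \<beta> u}"
            using sol conv_up by (auto simp: log_solution_def[of "A c"])
          hence "finite ((\<lambda>w. fps_X * (w + fps_const c)) ` {w. convergent_fps w \<and> log_solution (A c) (B c) w})"
            using Suc.prems(6) finite_subset by blast
          thus "finite {w. convergent_fps w \<and> log_solution (A c) (B c) w}"
            by (rule finite_imageD) (auto intro!: inj_onI)
          have "at_x0 (A c) $ order c \<Phi> \<noteq> 0"
            unfolding atA subdegree_fps_of_poly_pcompose(1)[OF nonzero, of c, symmetric]
            by (rule nth_subdegree_nonzero[OF subdegree_fps_of_poly_pcompose(2)[OF nonzero]])
          thus "A c $ order c \<Phi> $ 0 \<noteq> 0 \<or> order c \<Phi> \<ge> 1 \<and> B c $ (order c \<Phi> - 1) $ 0 \<noteq> 0" by simp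
        qed
        thus ?thesis using card_image[OF inj] by simp
      qed
      define C where "C = (\<lambda>u. u $ 1) ` Z"
      have finC: "finite C" using Suc.prems(3) by (simp add: C_def)
      have "Z = (\<Union>c\<in>C. Zc c)" by (auto simp: C_def Zc_def)
      hence "card Z \<le> (\<Sum>c\<in>C. card (Zc c))" using card_UN_le[OF finC] by metis
      also have "\<dots> \<le> (\<Sum>c\<in>C. order c \<Phi>)" by (intro sum_mono bound)
      also have "\<dots> = (\<Sum>c\<in>C \<inter> {c. poly \<Phi> c = 0}. order c \<Phi>)"
        using finC nonzero by (intro sum.mono_neutral_right) (auto simp: order_root)
      also have "\<dots> \<le> (\<Sum>c | poly \<Phi> c = 0. order c \<Phi>)"
        using poly_roots_finite[OF nonzero] by (intro sum_mono2) auto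
      also have "\<dots> \<le> degree \<Phi>" by (rule sum_order_le_degree[OF nonzero])
      also have "\<dots> \<le> e" unfolding \<Phi>_def by (rule degree_weighted_part_le)
      finally show ?thesis using eH by simp
    qed
  qed simp
qed

section \<open>Curves up to units, and the number of integral curves\<close>

lemma curve_eqD:
  assumes "curve F = curve G" shows "F dvd G"
proof -
  have "G = 1 * G" "(1 :: cps) dvd 1" by simp_all
  hence "G \<in> curve G" unfolding curve_def by blast
  hence "G \<in> curve F" using assms by simp
  then obtain v where "G = v * F" unfolding curve_def by blast
  thus ?thesis by simp
qed

lemma curve_unit_mult:
  assumes "c dvd 1" shows "curve (c * F) = curve F"
proof
  show "curve (c * F) \<subseteq> curve F"
  proof
    fix G assume "G \<in> curve (c * F)"
    then obtain v where v: "v dvd 1" "G = v * (c * F)" by (auto simp: curve_def)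
    have "v * c dvd 1" using mult_dvd_mono[OF v(1) assms] by simp
    moreover have "G = (v * c) * F" using v(2) by (simp only: mult.assoc)
    ultimately show "G \<in> curve F" unfolding curve_def by blast
  qed
  obtain d where d: "c * d = 1" using assms by (metis dvdE)
  show "curve F \<subseteq> curve (c * F)"
  proof
    fix G assume "G \<in> curve F"
    then obtain v where v: "v dvd 1" "G = v * F" by (auto simp: curve_def)
    have "(v * d) * (c * F) = (c * d) * (v * F)" by (simp only: mult_ac)
    hence "G = (v * d) * (c * F)" using v(2) d by simp
    moreover have "d dvd 1" using dvd_triv_right[of d c] unfolding d .
    from mult_dvd_mono[OF v(1) this] have "v * d dvd 1" by simp
    ultimately show "G \<in> curve (c * F)" unfolding curve_def by blast
  qed
qed

text \<open>Each \<open>u\<close> is sent to the separatrix cut out by its prime equation; a fibre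
  consists of conjugates \<open>u(\<zeta> t)\<close> with \<open>\<zeta>^m = 1\<close> and is
  finite. This is how nondicriticality rules out the dicritical case of
  \<open>log_solution_count\<close>.\<close>

lemma finite_integral_curves:
  assumes W: "finite (separatrices W)" and m: "m \<ge> 1"
  shows "finite {u. convergent_fps u \<and> u $ 0 = 0 \<and> integral_curve W m u}" (is "finite ?I")
proof -
  define good where "good u p \<longleftrightarrow> curve p \<in> separatrices W \<and> eval_at (fps_X ^ m) u (fps2_of_cps p) = 0 \<and>
      (\<forall>v. v $ 0 = 0 \<and> eval_at (fps_X ^ m) v (fps2_of_cps p) = 0 \<longrightarrow> (\<exists>\<zeta>. \<zeta> ^ m = 1 \<and> v = fps_rotate \<zeta> u))" for u p
  have "\<exists>p. good u p"
    if u: "u \<in> ?I" for u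
  proof -
    have u: "convergent_fps u" "u $ 0 = 0" "integral_curve W m u" using that by auto
    obtain p where p: "prime_elem p" "\<And>F. p dvd F \<longleftrightarrow> eval_at (fps_X ^ m) u (fps2_of_cps F) = 0"
      "at_x0 (fps2_of_cps p) \<noteq> 0"
      "\<And>v. v $ 0 = 0 \<Longrightarrow> eval_at (fps_X ^ m) v (fps2_of_cps p) = 0 \<Longrightarrow> \<exists>\<zeta>. \<zeta> ^ m = 1 \<and> v = fps_rotate \<zeta> u"
      using branch_prime[OF m u(1,2)] by metis
    have "p dvd form_wedge W (form_d p)"
      using branch_separatrix_iff[OF m u(1,2) p(1,2,3)] u(3) by blast
    hence "curve p \<in> separatrices W" using p(1) by (auto simp: separatrices_def prime_elem_imp_irreducible)
    moreover have "eval_at (fps_X ^ m) u (fps2_of_cps p) = 0" using p(2)[of p] by simp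
    ultimately have "good u p" using p(4) unfolding good_def by blast
    thus ?thesis ..
  qed
  then obtain P where "\<And>u. u \<in> ?I \<Longrightarrow> good u (P u)" by metis
  hence P: "\<And>u. u \<in> ?I \<Longrightarrow> curve (P u) \<in> separatrices W"
      "\<And>u. u \<in> ?I \<Longrightarrow> eval_at (fps_X ^ m) u (fps2_of_cps (P u)) = 0"
      "\<And>u v. u \<in> ?I \<Longrightarrow> v $ 0 = 0 \<Longrightarrow> eval_at (fps_X ^ m) v (fps2_of_cps (P u)) = 0 \<Longrightarrow> \<exists>\<zeta>. \<zeta> ^ m = 1 \<and> v = fps_rotate \<zeta> u"
    unfolding good_def by blast+
  have "finite ((\<lambda>u. curve (P u)) -` separatrices W \<inter> ?I)"
  proof (rule finite_finite_vimage_IntI[OF W])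
    fix C
    show "finite ((\<lambda>u. curve (P u)) -` {C} \<inter> ?I)"
    proof (cases "(\<lambda>u. curve (P u)) -` {C} \<inter> ?I = {}")
      case False
      then obtain u where u: "u \<in> ?I" "curve (P u) = C" by auto
      have "(\<lambda>u. curve (P u)) -` {C} \<inter> ?I \<subseteq> (\<lambda>\<zeta>. fps_rotate \<zeta> u) ` {\<zeta>. \<zeta> ^ m = 1}"
      proof
        fix v assume v: "v \<in> (\<lambda>u. curve (P u)) -` {C} \<inter> ?I"
        hence "P v dvd P u" using u by (intro curve_eqD) auto
        then obtain q where "P u = P v * q" by (elim dvdE)
        moreover have "(fps_X ^ m) $ 0 = (0 :: complex)" "v $ 0 = 0" using m v by auto
        ultimately have "eval_at (fps_X ^ m) v (fps2_of_cps (P u)) = 0"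
          using P(2)[of v] v by (simp add: times_cps.rep_eq eval_at_mult)
        then obtain \<zeta> where "\<zeta> ^ m = 1" "v = fps_rotate \<zeta> u" using P(3)[OF u(1)] \<open>v $ 0 = 0\<close> by blast
        thus "v \<in> (\<lambda>\<zeta>. fps_rotate \<zeta> u) ` {\<zeta>. \<zeta> ^ m = 1}" by blast
      qed
      moreover have "finite ((\<lambda>\<zeta>. fps_rotate \<zeta> u) ` {\<zeta>. \<zeta> ^ m = 1})"
        using m by (intro finite_imageI finite_roots_unity) auto
      ultimately show ?thesis by (rule finite_subset)
    qed auto
  qed
  moreover have "?I = (\<lambda>u. curve (P u)) -` separatrices W \<inter> ?I" using P(1) by auto
  ultimately show ?thesis by metis
qed

lemma card_integral_curves_le:
  assumes W: "finite (separatrices W)" and m: "m \<ge> 1"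
    and S: "n \<ge> 1" "fps2_of_cps (snd W) $ (n - 1) $ 0 \<noteq> 0"
    and Z: "finite Z" "\<And>u. u \<in> Z \<Longrightarrow> u $ 0 = 0 \<and> integral_curve W m u"
  shows "card Z \<le> n"
proof -
  \<comment> \<open>The pullback of \<open>W\<close> multiplied by \<open>t\<close>: the factor
    \<open>m t^m\<close> is \<open>t\<close> times the derivative of \<open>t^m\<close>.\<close>
  define \<alpha> where "\<alpha> = cst (of_nat m) * varx ^ m * ramify m (fps2_of_cps (fst W))"
  define \<beta> where "\<beta> = ramify m (fps2_of_cps (snd W))"
  have X0: "(fps_X :: complex fps) $ 0 = 0" by simp
  have "m - 1 + 1 = m" using m by simp
  hence Xm: "fps_X * fps_deriv (fps_X ^ m :: complex fps) = fps_const (of_nat m) * fps_X ^ m"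
    by (simp add: fps_deriv_power fps_of_nat power_Suc[symmetric] mult_ac del: power_Suc)
  have sol: "log_solution \<alpha> \<beta> u \<longleftrightarrow> u $ 0 = 0 \<and> integral_curve W m u" for u
  proof (cases "u $ 0 = 0")
    case True
    have "eval_at fps_X u \<alpha> + eval_at fps_X u \<beta> * (fps_X * fps_deriv u) =
        fps_X * (eval_at (fps_X ^ m) u (fps2_of_cps (fst W)) * fps_deriv (fps_X ^ m) +
         eval_at (fps_X ^ m) u (fps2_of_cps (snd W)) * fps_deriv u)"
    proof -
      have "eval_at fps_X u \<alpha> = fps_const (of_nat m) * fps_X ^ m * eval_at (fps_X ^ m) u (fps2_of_cps (fst W))"
        unfolding \<alpha>_def eval_at_mult[OF X0 True] eval_at_const[OF X0 True] eval_at_varx_power[OF X0 True] eval_at_ramify[OF m True X0] ..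
      moreover have "eval_at fps_X u \<beta> = eval_at (fps_X ^ m) u (fps2_of_cps (snd W))"
        unfolding \<beta>_def eval_at_ramify[OF m True X0] ..
      ultimately show ?thesis unfolding Xm[symmetric] by (simp only: distrib_left mult_ac)
    qed
    thus ?thesis using True by (simp add: log_solution_def integral_curve_def)
  qed (simp add: log_solution_def)
  \<comment> \<open>A bound for all contacts in the finite set \<open>Z\<close>; the inserted 0
    covers the empty set.\<close>
  define K where "K = Max (insert 0 ((\<lambda>(u, v). subdegree (u - v)) ` (Z \<times> Z)))"
  show ?thesis
  proof (rule log_solution_count[of \<alpha> \<beta> Z K])
    show "convergent_fps2 \<alpha>" unfolding \<alpha>_def
      by (intro convergent_fps2_mult convergent_fps2_cst convergent_fps2_power convergent_fps2_varx
        convergent_fps2_ramify m convergent_fps2_of_cps)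
    show "convergent_fps2 \<beta>" unfolding \<beta>_def by (intro convergent_fps2_ramify m convergent_fps2_of_cps)
    show "subdegree (u - v) \<le> K" if "u \<in> Z" "v \<in> Z" for u v
      unfolding K_def by (rule Max_ge) (use Z(1) that in auto)
    show "finite {u. convergent_fps u \<and> log_solution \<alpha> \<beta> u}"
      unfolding sol using finite_integral_curves[OF W m] by simp
    show "\<alpha> $ n $ 0 \<noteq> 0 \<or> n \<ge> 1 \<and> \<beta> $ (n - 1) $ 0 \<noteq> 0"
      using S unfolding \<beta>_def subst_ramify_nth[OF m] by simp
  qed (use Z sol in auto)
qed

section \<open>Every separatrix divides \<open>f\<close>, and \<open>f\<close> is their
  union\<close>

lemma associated_of_prime_dvd_irreducible:
  fixes p g :: "'a :: idom_divide"
  assumes "prime_elem p" "irreducible g" "p dvd g"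
  obtains c where "c dvd 1" "g = c * p"
proof -
  obtain c where c: "g = p * c" using assms by (elim dvdE)
  hence "c dvd 1" using irreducibleD[OF assms(2) c] assms(1) by (auto simp: prime_elem_def)
  thus ?thesis using c that by (simp add: mult.commute)
qed

text \<open>
  A separatrix not dividing \<open>f\<close> would yield, together with the \<open>n\<close> Puiseux roots of \<open>f\<close>, at least
  \<open>n + 1\<close> integral curves over a common ramification \<open>x = t\<^sup>M\<close>.
\<close>
lemma separatrix_dvd:
  assumes W: "finite (separatrices W)" and S: "n \<ge> 1" "fps2_of_cps (snd W) $ (n - 1) $ 0 \<noteq> 0"
    and f: "squarefree f" "f dvd form_wedge W (form_d f)" "at_x0 (fps2_of_cps f) \<noteq> 0"
      "subdegree (at_x0 (fps2_of_cps f)) = n"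
    and g: "irreducible g" "g dvd form_wedge W (form_d g)"
  shows "g dvd f"
proof (rule ccontr)
  assume ngf: "\<not> g dvd f"
  have "at_x0 (fps2_of_cps (snd W)) \<noteq> 0" using S by (metis at_x0_nth fps_zero_nth)
  hence atg: "at_x0 (fps2_of_cps g) \<noteq> 0" by (rule separatrix_regular[OF g])
  have "\<not> g dvd 1" using g(1) by (auto simp: irreducible_def)
  hence g00: "fps2_of_cps g $ 0 $ 0 = 0" by (simp add: cps_unit_iff)
  obtain m u where mu: "m \<ge> 1" "u $ 0 = 0" "convergent_fps u" "eval_at (fps_X ^ m) u (fps2_of_cps g) = 0"
    using newton_puiseux[OF convergent_fps2_of_cps atg g00] by blast
  obtain p where p: "prime_elem p" "p dvd g"
    using branch_prime[OF mu(1,3,2)] mu(4) by metis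
  obtain c where c: "c dvd 1" "g = c * p" using associated_of_prime_dvd_irreducible[OF p(1) g(1) p(2)] by blast
  have npf: "\<not> p dvd f" using ngf c by (simp add: mult_unit_dvd_iff')
  define F where "F = f * g"
  have prime_dvd_F: "q dvd f \<or> q dvd g" if "prime_elem q" "q dvd F" for q
    using that by (simp add: F_def prime_elem_dvd_mult_iff)
  have sq_f: "\<not> q ^ 2 dvd f" if "prime_elem q" for q
    using that f(1) by (auto simp: squarefree_def prime_elem_def)
  have sq_g: "\<not> q ^ 2 dvd g" if q: "prime_elem q" for q
  proof
    assume "q ^ 2 dvd g"
    then obtain k where "g = q ^ 2 * k" by (elim dvdE)
    hence "g = q * (q * k)" by (simp only: power2_eq_square mult.assoc)
    from irreducibleD[OF g(1) this] have "q dvd 1" by (metis dvd_mult_left)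
    thus False using q by (auto simp: prime_elem_def)
  qed
  have sqf: "\<not> q ^ 2 dvd F" if q: "prime_elem q" for q
  proof
    assume "q ^ 2 dvd F"
    then obtain k where "f * g = q ^ 2 * k" unfolding F_def by (elim dvdE)
    hence k: "f * g = q * (q * k)" by (simp only: power2_eq_square mult.assoc)
    show False
    \<comment> \<open>If \<open>q\<close> divides \<open>g\<close>, it is \<open>g\<close> up to a
      unit, and cancelling it leaves \<open>q\<close>, hence \<open>g\<close>, as a divisor of
      \<open>f\<close>. Otherwise both factors \<open>q\<close> must come from \<open>f\<close>,
      which is squarefree.\<close>
    proof (cases "q dvd g")
      case True
      then obtain d where d: "d dvd 1" "g = d * q"
        using associated_of_prime_dvd_irreducible[OF q g(1)] by blast
      have "q * (f * d) = q * (q * k)" using k d by (simp add: mult_ac)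
      moreover have "q \<noteq> 0" using q by (auto simp: prime_elem_def)
      ultimately have "f * d = q * k" by simp
      hence "q dvd f" using d(1) by (metis dvd_triv_left dvd_mult_unit_iff)
      moreover have "g dvd q" using d by (simp add: mult_unit_dvd_iff')
      ultimately show False using ngf dvd_trans by blast
    next
      case False
      have "q dvd f * g" unfolding k by simp
      hence "q dvd f" using q False by (simp add: prime_elem_dvd_mult_iff)
      then obtain f' where f': "f = q * f'" by (elim dvdE)
      have "q \<noteq> 0" using q by (auto simp: prime_elem_def)
      hence "f' * g = q * k" using k by (simp add: f' mult.assoc)
      hence "q dvd f' * g" by simp
      hence "q dvd f'" using q False by (simp add: prime_elem_dvd_mult_iff)
      hence "q ^ 2 dvd f" unfolding f' power2_eq_square by (intro mult_dvd_mono) auto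
      thus False using sq_f[OF q] by blast
    qed
  qed
  have atF: "at_x0 (fps2_of_cps F) = at_x0 (fps2_of_cps f) * at_x0 (fps2_of_cps g)"
    by (simp add: F_def times_cps.rep_eq at_x0_mult)
  obtain M us Q where us: "M \<ge> 1" "length us = subdegree (at_x0 (fps2_of_cps F))"
      "\<forall>u\<in>set us. convergent_fps u \<and> u $ 0 = 0"
      "ramify M (fps2_of_cps F) = (\<Prod>u\<leftarrow>us. vary - fps_const u) * Q"
    using puiseux_split[OF convergent_fps2_of_cps, of F] f(3) atg unfolding atF by auto
  have "distinct us" by (rule squarefree_imp_distinct_roots[OF us(1) _ us(4) sqf]) (use us(3) in auto)
  \<comment> \<open>The prime of the branch of \<open>v\<close> divides \<open>f\<close> or
    \<open>g\<close> and exactly once, so it inherits invariance from that factor.\<close>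
  have "integral_curve W M v" if v: "v \<in> set us" for v
  proof -
    have vc: "convergent_fps v" "v $ 0 = 0" using us(3) v by auto
    obtain q where q: "prime_elem q" "\<And>F. q dvd F \<longleftrightarrow> eval_at (fps_X ^ M) v (fps2_of_cps F) = 0"
      "at_x0 (fps2_of_cps q) \<noteq> 0"
      using branch_prime[OF us(1) vc] by metis
    have X0: "(fps_X :: complex fps) $ 0 = 0" by simp
    obtain xs ys where "us = xs @ v # ys" using v by (meson split_list)
    hence "(\<Prod>u\<leftarrow>us. vary - fps_const u) =
        (vary - fps_const v) * ((\<Prod>u\<leftarrow>xs. vary - fps_const u) * (\<Prod>u\<leftarrow>ys. vary - fps_const u))"
      by (simp add: mult_ac)
    hence "eval_at fps_X v (ramify M (fps2_of_cps F)) = 0"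
      unfolding us(4) by (simp add: eval_at_mult[OF X0 vc(2)] eval_at_linear[OF X0 vc(2)])
    hence "q dvd F" unfolding q(2) eval_at_ramify[OF us(1) vc(2) X0] .
    hence "q dvd f \<or> q dvd g" by (rule prime_dvd_F[OF q(1)])
    hence "q dvd form_wedge W (form_d q)"
      using prime_factor_invariant[OF f(2) q(1) _ sq_f[OF q(1)]] prime_factor_invariant[OF g(2) q(1) _ sq_g[OF q(1)]]
      by blast
    thus ?thesis using branch_separatrix_iff[OF us(1) vc q] by blast
  qed
  hence "card (set us) \<le> n" using us(3) by (intro card_integral_curves_le[OF W us(1) S]) auto
  moreover have "card (set us) = n + subdegree (at_x0 (fps2_of_cps g))"
    using \<open>distinct us\<close> f(3,4) atg us(2) by (simp add: distinct_card atF)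
  moreover have "subdegree (at_x0 (fps2_of_cps g)) \<noteq> 0"
    using g00 atg by (simp add: subdegree_eq_0_iff)
  ultimately show False by simp
qed

text \<open>The prime factors of \<open>f\<close> are the required equations: squarefreeness makes
  them simple and pairwise non-associated, invariance of \<open>f\<close> passes to each, and
  \<open>sep\<close> shows that no separatrix is missed.\<close>

lemma union_of_separatricesI:
  assumes f: "squarefree f" "f dvd form_wedge W (form_d f)" "at_x0 (fps2_of_cps f) \<noteq> 0"
    and sep: "\<And>g. irreducible g \<Longrightarrow> g dvd form_wedge W (form_d g) \<Longrightarrow> g dvd f"
  shows "is_union_of_separatrices (curve f) W"
proof -
  obtain A c where A: "\<forall>p\<in>#A. prime_elem p" "c dvd 1" "f = c * prod_mset A"
    using prime_factorization_regular[OF f(3)] by blast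
  have sq_f: "\<not> q ^ 2 dvd f" if "prime_elem q" for q
    using that f(1) by (auto simp: squarefree_def prime_elem_def)
  \<comment> \<open>Phrased with a submultiset so as to cover both a repeated factor,
    \<open>p = q\<close>, and two associated ones.\<close>
  have not_dvd: "\<not> p dvd q" if pq: "{#p, q#} \<subseteq># A" for p q
  proof
    assume "p dvd q"
    have pA: "prime_elem p" using pq A(1) by (auto dest: mset_subset_eqD)
    obtain A' where "A = {#p, q#} + A'" using pq by (auto simp: subset_mset.le_iff_add)
    hence "f = (p * q) * (c * prod_mset A')" using A(3) by (simp add: mult_ac)
    moreover have "p ^ 2 dvd p * q" using \<open>p dvd q\<close> unfolding power2_eq_square by (intro mult_dvd_mono) auto
    ultimately have "p ^ 2 dvd f" by simp
    thus False using sq_f[OF pA] by blast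
  qed
  have pair: "{#p, q#} \<subseteq># A" if "p \<in># A" "q \<in># A" "p \<noteq> q" for p q
    using that by (intro mset_subset_eqI) (auto simp: Suc_le_eq)
  have count1: "count A p = 1" if "p \<in># A" for p
  proof (rule ccontr)
    assume "count A p \<noteq> 1"
    moreover have "count A p > 0" using that by simp
    ultimately have "count A p \<ge> 2" by linarith
    hence "{#p, p#} \<subseteq># A" by (simp add: subseteq_mset_def)
    thus False using not_dvd[of p p] by simp
  qed
  have prod: "(\<Prod>p\<in>set_mset A. p) = prod_mset A"
    by (simp add: prod_mset_multiplicity count1)
  have dvd_f: "p dvd f" if "p \<in># A" for p
    using that A(3) by (simp add: dvd_prod_mset)
  have bij: "bij_betw curve (set_mset A) (separatrices W)"
    unfolding bij_betw_def
  proof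
    show "inj_on curve (set_mset A)"
    proof (rule inj_onI, rule ccontr)
      fix p q assume "p \<in># A" "q \<in># A" "curve p = curve q" "p \<noteq> q"
      thus False using not_dvd[OF pair] curve_eqD by metis
    qed
    show "curve ` set_mset A = separatrices W"
    proof
      show "curve ` set_mset A \<subseteq> separatrices W"
        using A(1) prime_factor_invariant[OF f(2) _ dvd_f sq_f]
        by (auto simp: separatrices_def prime_elem_imp_irreducible)
      show "separatrices W \<subseteq> curve ` set_mset A"
      proof
        fix C assume "C \<in> separatrices W"
        then obtain g where g: "C = curve g" "irreducible g" "g dvd form_wedge W (form_d g)"
          by (auto simp: separatrices_def)
        have "g dvd f" using sep g by blast
        then obtain k where k: "f = g * k" by (elim dvdE)
        \<comment> \<open>Otherwise all prime factors of \<open>f = g * k\<close> could be moved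
          into \<open>k\<close>, so \<open>f\<close> would divide \<open>k\<close> and
          \<open>g\<close> would be a unit.\<close>
        have "\<exists>p\<in>#A. p dvd g"
        proof (rule ccontr)
          assume none: "\<not> (\<exists>p\<in>#A. p dvd g)"
          have "\<forall>p\<in>#B. prime_elem p \<and> \<not> p dvd g \<Longrightarrow> prod_mset B dvd g * l \<Longrightarrow> prod_mset B dvd l" for B l
          proof (induction B arbitrary: l)
            case (add p B)
            have "p * prod_mset B dvd g * l" using add.prems(2) by simp
            hence "p dvd g * l" by (rule dvd_mult_left)
            hence "p dvd l" using add.prems(1) by (simp add: prime_elem_dvd_mult_iff)
            then obtain l' where l': "l = p * l'" by (elim dvdE)
            have "p \<noteq> 0" using add.prems(1) by (auto simp: prime_elem_def)
            have "g * l = p * (g * l')" unfolding l' by (rule mult.left_commute)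
            hence "prod_mset (add_mset p B) dvd p * (g * l')" using add.prems(2) by (simp only:)
            hence "prod_mset B dvd g * l'" using \<open>p \<noteq> 0\<close> by simp
            moreover have "\<forall>p\<in>#B. prime_elem p \<and> \<not> p dvd g" using add.prems(1) by simp
            ultimately have "prod_mset B dvd l'" using add.IH by blast
            thus ?case unfolding l' by simp
          qed simp
          moreover have "prod_mset A dvd g * k" using A(3) k by (metis dvd_triv_right)
          ultimately have "prod_mset A dvd k" using A(1) none by blast
          hence "f dvd k" using A(2,3) by (simp add: mult_unit_dvd_iff')
          then obtain l where "k = f * l" by (elim dvdE)
          hence "f = f * (g * l)" using k by (simp add: mult_ac)
          moreover have "f \<noteq> 0"
          proof
            assume "f = 0"
            hence "at_x0 (fps2_of_cps f) = 0" by (intro fps_ext) (simp add: zero_cps.rep_eq)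
            thus False using f(3) by simp
          qed
          ultimately have "g * l = 1" by (metis mult.right_neutral mult_left_cancel)
          hence "g dvd 1" by (metis dvd_triv_left)
          thus False using g(2) by (auto simp: irreducible_def)
        qed
        then obtain p where p: "p \<in># A" "p dvd g" by blast
        then obtain d where "d dvd 1" "g = d * p"
          using associated_of_prime_dvd_irreducible[OF _ g(2)] A(1) by metis
        thus "C \<in> curve ` set_mset A" using p(1) by (simp add: g(1) curve_unit_mult)
      qed
    qed
  qed
  have "curve f = curve (\<Prod>p\<in>set_mset A. p)"
    unfolding prod A(3) by (rule curve_unit_mult[OF A(2)])
  thus ?thesis unfolding is_union_of_separatrices_def using bij by blast
qed

section \<open>Coefficients of polynomials in \<open>y\<close>, and the conclusion\<close>

lemma fps2_of_cps_sum: "fps2_of_cps (sum h A) = (\<Sum>x\<in>A. fps2_of_cps (h x))"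
  by (induction A rule: infinite_finite_induct) (auto simp: zero_cps.rep_eq plus_cps.rep_eq)

lemma fps2_of_cps_Y_power: "fps2_of_cps (cps_Y ^ k) = vary ^ k"
  by (induction k) (auto simp: one_cps.rep_eq times_cps.rep_eq cps_Y.rep_eq)

text \<open>\<open>deg_y\<close> is a \<open>Max\<close>, which carries information only for a
  finite set.\<close>

lemma finite_y_support:
  assumes "F \<in> cps_Cx_y" shows "finite {j. \<exists>i. cps_coeff F i j \<noteq> 0}"
proof -
  obtain m a where a: "\<forall>j\<le>m. a j \<in> cps_Cx" "F = (\<Sum>j\<le>m. a j * cps_Y ^ j)"
    using assms unfolding cps_Cx_y_def mem_Collect_eq by (elim exE conjE)
  have "cps_coeff F i j = 0" if "j > m" for i j
  proof -
    have "fps2_of_cps F $ j $ i = (\<Sum>k\<le>m. (fps2_of_cps (a k) * vary ^ k) $ j $ i)"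
      unfolding a(2) fps2_of_cps_sum fps_sum_nth times_cps.rep_eq fps2_of_cps_Y_power ..
    also have "\<dots> = 0"
    proof (rule sum.neutral, rule ballI)
      fix k assume "k \<in> {..m}"
      hence "a k \<in> cps_Cx" "k < j" using a(1) that by auto
      thus "(fps2_of_cps (a k) * vary ^ k) $ j $ i = 0"
        unfolding fps_X_power_mult_right_nth by (simp add: cps_Cx_def cps_coeff_def)
    qed
    finally show ?thesis by (simp add: cps_coeff_def)
  qed
  note zero = this
  have "{j. \<exists>i. cps_coeff F i j \<noteq> 0} \<subseteq> {..m}"
  proof
    fix j assume "j \<in> {j. \<exists>i. cps_coeff F i j \<noteq> 0}"
    then obtain i where "cps_coeff F i j \<noteq> 0" by blast
    hence "\<not> j > m" using zero[of j i] by blast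
    thus "j \<in> {..m}" by simp
  qed
  thus ?thesis by (rule finite_subset) simp
qed

lemma coeff_eq_0_of_deg_y_less:
  assumes "F \<in> cps_Cx_y" "F = 0 \<or> deg_y F < k" shows "fps2_of_cps F $ k $ i = 0"
proof (rule ccontr)
  assume nz: "fps2_of_cps F $ k $ i \<noteq> 0"
  hence "F \<noteq> 0" by (auto simp: zero_cps.rep_eq)
  moreover have "k \<le> deg_y F" unfolding deg_y_def
    using nz by (intro Max_ge finite_y_support assms(1)) (auto simp: cps_coeff_def)
  ultimately show False using assms(2) by simp
qed

theorem proposition4p3:
  fixes f h p A B :: cps and a :: "nat \<Rightarrow> cps" and n :: nat and W :: oneform
  assumes a_Cx: "\<And>i. i \<le> n \<Longrightarrow> a i \<in> cps_Cx"
    and f_eq: "f = (\<Sum>i\<le>n. a i * cps_Y ^ (n - i))"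
    and f_reduced: "squarefree f"
    and deg_f: "deg_y f = n"
    and ord_f: "cps_ord f = n"
    and n_gt_1: "n > 1"
    and a0: "cps_coeff (a 0) 0 0 \<noteq> 0"
    and W: "W \<in> Fol_forms f"
    and weierstrass: "weierstrass_form f W h p A B"
    and h_unit: "h dvd 1"
  shows "foliation W \<in> Fol f \<and> is_union_of_separatrices (curve f) W"
proof -
  have f_nth: "fps2_of_cps f $ j $ i = (\<Sum>k\<le>n. if j = n - k then fps2_of_cps (a k) $ 0 $ i else 0)" for i j
  proof -
    have "fps2_of_cps f $ j $ i = (\<Sum>k\<le>n. (fps2_of_cps (a k) * vary ^ (n - k)) $ j $ i)"
      unfolding f_eq fps2_of_cps_sum fps_sum_nth times_cps.rep_eq fps2_of_cps_Y_power ..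
    also have "\<dots> = (\<Sum>k\<le>n. if j = n - k then fps2_of_cps (a k) $ 0 $ i else 0)"
    proof (rule sum.cong[OF refl])
      fix k assume "k \<in> {..n}"
      hence "a k \<in> cps_Cx" using a_Cx by simp
      thus "(fps2_of_cps (a k) * vary ^ (n - k)) $ j $ i = (if j = n - k then fps2_of_cps (a k) $ 0 $ i else 0)"
        unfolding fps_X_power_mult_right_nth by (auto simp: cps_Cx_def cps_coeff_def)
    qed
    finally show ?thesis .
  qed
  have fn: "fps2_of_cps f $ n $ 0 \<noteq> 0"
  proof -
    have "fps2_of_cps f $ n $ 0 = (\<Sum>k\<le>n. if k = 0 then fps2_of_cps (a k) $ 0 $ 0 else 0)"
      unfolding f_nth using n_gt_1 by (intro sum.cong refl if_cong) auto
    thus ?thesis using a0 by (simp add: cps_coeff_def)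
  qed
  have f_low: "fps2_of_cps f $ j $ i = 0" if "i + j < n" for i j
  proof -
    have "i + j < (LEAST d. \<exists>i j. i + j = d \<and> cps_coeff f i j \<noteq> 0)"
      using that ord_f unfolding cps_ord_def by simp
    from not_less_Least[OF this] show ?thesis unfolding cps_coeff_def by blast
  qed
  have atf: "at_x0 (fps2_of_cps f) \<noteq> 0" using fn by (metis at_x0_nth fps_zero_nth)
  have subdeg: "subdegree (at_x0 (fps2_of_cps f)) = n"
    by (rule subdegreeI) (use fn f_low in auto)
  have nondic: "finite (separatrices W)" and inv: "f dvd form_wedge W (form_d f)"
    using W by (auto simp: Fol_forms_def nondicritical_def)
  have "snd W = h * cps_dy f + B" and B: "B \<in> cps_Cx_y" "B = 0 \<or> deg_y B < n - 1"
    using weierstrass deg_f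
    by (auto simp: weierstrass_form_def form_scale_def form_d_def form_dx_def form_dy_def)
  hence "fps2_of_cps (snd W) $ (n - 1) $ 0 = (fps2_of_cps h * dy (fps2_of_cps f)) $ (n - 1) $ 0"
    using coeff_eq_0_of_deg_y_less[OF B] by (simp add: plus_cps.rep_eq times_cps.rep_eq cps_dy.rep_eq)
  also have "\<dots> = (\<Sum>j\<le>n-1. fps2_of_cps h $ j $ 0 * (dy (fps2_of_cps f) $ (n - 1 - j) $ 0))"
    unfolding pser_mult_nth by simp
  \<comment> \<open>For \<open>j > 0\<close> the coefficient of \<open>f_y(0, y)\<close> is a
    multiple of that of \<open>y^(n - j)\<close> in \<open>f(0, y)\<close>, zero because
    \<open>ord f = n\<close>. Only \<open>h(0,0)\<close> times \<open>n a_0(0)\<close> survives, and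
    this is where \<open>h\<close> being a unit enters.\<close>
  also have "\<dots> = (\<Sum>j\<le>n-1. if j = 0 then fps2_of_cps h $ 0 $ 0 * (of_nat n * fps2_of_cps f $ n $ 0) else 0)"
  proof (rule sum.cong[OF refl])
    fix j assume j: "j \<in> {..n-1}"
    have "Suc (n - 1 - j) = n - j" using j n_gt_1 by auto
    hence "dy (fps2_of_cps f) $ (n - 1 - j) $ 0 = of_nat (n - j) * fps2_of_cps f $ (n - j) $ 0"
      unfolding dy_nth by simp
    thus "fps2_of_cps h $ j $ 0 * (dy (fps2_of_cps f) $ (n - 1 - j) $ 0) =
        (if j = 0 then fps2_of_cps h $ 0 $ 0 * (of_nat n * fps2_of_cps f $ n $ 0) else 0)"
      using f_low[of 0 "n - j"] n_gt_1 by (cases "j = 0") simp_all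
  qed
  also have "\<dots> = fps2_of_cps h $ 0 $ 0 * (of_nat n * fps2_of_cps f $ n $ 0)" by simp
  finally have S: "fps2_of_cps (snd W) $ (n - 1) $ 0 \<noteq> 0"
    using fn n_gt_1 h_unit by (simp add: cps_unit_iff)
  have "is_union_of_separatrices (curve f) W"
  proof (rule union_of_separatricesI[OF f_reduced inv atf])
    fix g assume "irreducible g" "g dvd form_wedge W (form_d g)"
    thus "g dvd f"
      using n_gt_1 by (intro separatrix_dvd[OF nondic _ S f_reduced inv atf subdeg]) auto
  qed
  thus ?thesis using W unfolding Fol_def by blast
qed

end
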